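(* Let $\tilde N$ be a Poisson point process on $\mathbb{X}$ with intensity $\omega$ and law $\mathbf P_N$, and let $\Phi$ be a Gibbs point process with density $f_\Phi$ with respect to $\tilde N$, i.e. $\mathbf P_\Phi(\mathrm d\nu)=f_\Phi(\nu)\mathbf P_N(\mathrm d\nu)$. Assume $H(\mathrm ds)=h(s)\mathrm ds$. Fix $\bm y\in\mathbb{X}^n$ with distinct values $\bm y^*=(y^*_1,\dots,y^*_k)$ and $u>0$, and let $\tilde\mu'$ be a random measure with Laplace functional $$\mathsf E\Big[e^{-\int f\,\mathrm d\tilde\mu'}\Big]=\frac{\mathsf E\big[\exp\{-\int_{\mathbb{X}}(f(z)+u)\tilde\mu^!_{\bm y^*}(\mathrm dz)\}\big]}{\mathsf E\big[\exp\{-\int_{\mathbb{X}}u\,\tilde\mu^!_{\bm y^*}(\mathrm dz)\}\big]}$$ for all bounded non-negative measurable $f$ with bounded support. Then $\tilde\mu'$ is equal in distribution to the random measure $\tilde\eta(A)=\int_{A\times\mathbb{R}_+}s\,\Psi'(\mathrm dx\,\mathrm ds)=\sum_{j\ge1}S'_j\delta_{X'_j}(A)$, $A\in\mathcal{X}$, where $\Psi'=\sum_j\delta_{(X'_j,S'_j)}$ is a marked point process whose unmarked process $\Phi'=\sum_j\delta_{X'_j}$ is of Gibbs type with density with respect to $\tilde N$ $$f_{\Phi'}(\nu)=\frac{\exp\{\int_{\mathbb{X}}\log(\int_{\mathbb{R}_+}e^{-su}H(\mathrm ds))\,\nu(\mathrm dx)\}\,f_\Phi(\nu+\sum_{j=1}^k\delta_{y^*_j})}{\mathsf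 E_{\tilde N}\big[\exp\{\int_{\mathbb{X}}\log(\int_{\mathbb{R}_+}e^{-su}H(\mathrm ds))\,\tilde N(\mathrm dx)\}\,f_\Phi(\tilde N+\sum_{j=1}^k\delta_{y^*_j})\big]},$$ and whose marks $S'_j$ are i.i.d. with distribution $H'(\mathrm ds)=\dfrac{e^{-su}H(\mathrm ds)}{\int_{\mathbb{R}_+}e^{-su}H(\mathrm ds)}$.
   Context: $(\mathbb{X},\mathcal{X})$ is a Polish space; $\Phi$ has a.s. finitely many points. $H$ is a probability on $\mathbb{R}_+$. $\tilde\mu=\sum_jS_j\delta_{X_j}$ with i.i.d. marks $S_j\sim H$ on the points of $\Phi$; given $\tilde\mu$, $Y_1,\dots,Y_n$ i.i.d. from $\tilde\mu/\tilde\mu(\mathbb{X})$. For $\bm x\in\mathbb{X}^k$, $\mathbf P^{\bm x}_\Phi$ is the $k$-th Palm distribution (the $M_{\Phi^k}$-a.e. unique kernel with $\mathsf E[\int_B\mathbf 1_L(\Phi)\Phi^k(\mathrm d\bm x)]=\int_B\mathbf P^{\bm x}_\Phi(L)M_{\Phi^k}(\mathrm d\bm x)$, where $M_{\Phi^k}(A_1\times\cdots\times A_k)=\mathsf E[\prod\Phi(A_i)]$); $\Phi_{\bm x}\sim\mathbf P^{\bm x}_\Phi$ and the reduced Palm version is $\Phi^!_{\bm x}=\Phi_{\bm x}-\sum_j\delta_{x_j}$; $\tilde\mu^!_{\bm x}$ denotes $\Phi^!_{\bm x}$ with points weighted by i.i.d. $H$-distributed marks. $\mathsf E_{\tilde N}$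 is expectation with respect to $\tilde N$. *)

theory Defs
  imports "HOL-Probability.Probability"
begin

(* Finite counting measures on X are represented as finite multisets. *)

definition cnt :: "'b set \<Rightarrow> 'b multiset \<Rightarrow> nat" where
  "cnt A \<nu> = size (filter_mset (\<lambda>x. x \<in> A) \<nu>)"

definition cfg_space :: "('b::topological_space) multiset measure" where
  "cfg_space = sigma UNIV {{\<nu>. cnt A \<nu> = n} | A n. A \<in> sets borel}"

definition cfg_int :: "('b \<Rightarrow> real) \<Rightarrow> 'b multiset \<Rightarrow> real" where
  "cfg_int g \<nu> = sum_mset (image_mset g \<nu>)"

definition poisson_pp :: "'b::topological_space measure \<Rightarrow> 'b multiset measure \<Rightarrow> bool" where
  "poisson_pp \<omega> P \<longleftrightarrow> prob_space P \<and> sets P = sets cfg_space \<and>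
     (\<forall>m (As :: nat \<Rightarrow> 'b set) (ns :: nat \<Rightarrow> nat).
        (\<forall>i<m. As i \<in> sets borel) \<and> disjoint_family_on As {..<m} \<longrightarrow>
        measure P {\<nu> \<in> space P. \<forall>i<m. cnt (As i) \<nu> = ns i} =
        (\<Prod>i<m. measure \<omega> (As i) ^ ns i / fact (ns i) * exp (- measure \<omega> (As i))))"

definition enum_mset :: "'b multiset \<Rightarrow> 'b list" where
  "enum_mset \<nu> = (SOME xs. mset xs = \<nu>)"

definition mark_law :: "real measure \<Rightarrow> 'b::topological_space multiset \<Rightarrow> ('b \<times> real) multiset measure" where
  "mark_law K \<nu> = (let xs = enum_mset \<nu> in
     distr (PiM {..<length xs} (\<lambda>_. K)) cfg_space
       (\<lambda>s. mset (map (\<lambda>i. (xs ! i, s i)) [0..<length xs])))"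

definition wmeas :: "('b::topological_space \<times> real) multiset \<Rightarrow> 'b measure" where
  "wmeas \<psi> = measure_of UNIV (sets borel)
     (\<lambda>A. sum_mset (image_mset (\<lambda>(x, s). if x \<in> A then ennreal s else 0) \<psi>))"

definition meas_algebra :: "'b measure \<Rightarrow> 'b measure measure" where
  "meas_algebra K = (SUP A \<in> sets K. vimage_algebra {M. sets M = sets K} (\<lambda>M. emeasure M A) borel)"

definition rm_law :: "'b::topological_space multiset measure \<Rightarrow> real measure \<Rightarrow> 'b measure measure" where
  "rm_law P K = distr (P \<bind> mark_law K) (meas_algebra borel) wmeas"

definition exp_neg_ext :: "ennreal \<Rightarrow> real" where
  "exp_neg_ext t = (if t = \<infinity> then 0 else exp (- enn2real t))"

definition laplace :: "'b measure measure \<Rightarrow> ('b \<Rightarrow> real) \<Rightarrow> real" where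
  "laplace Q g = (\<integral>m. exp_neg_ext (\<integral>\<^sup>+x. ennreal (g x) \<partial>m) \<partial>Q)"

definition tup_space :: "nat \<Rightarrow> (nat \<Rightarrow> 'b::topological_space) measure" where
  "tup_space k = PiM {..<k} (\<lambda>_. borel)"

definition cfg_pow :: "nat \<Rightarrow> 'b multiset \<Rightarrow> (nat \<Rightarrow> 'b) set \<Rightarrow> nat" where
  "cfg_pow k \<nu> B = (let xs = enum_mset \<nu> in
     card {js \<in> PiE {..<k} (\<lambda>_. {..<length xs}). (\<lambda>i\<in>{..<k}. xs ! js i) \<in> B})"

definition moment_measure :: "nat \<Rightarrow> 'b::topological_space multiset measure \<Rightarrow> (nat \<Rightarrow> 'b) measure" where
  "moment_measure k P = measure_of (space (tup_space k)) (sets (tup_space k))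
     (\<lambda>B. \<integral>\<^sup>+\<nu>. of_nat (cfg_pow k \<nu> B) \<partial>P)"

definition is_palm_kernel :: "nat \<Rightarrow> 'b::topological_space multiset measure \<Rightarrow>
    ((nat \<Rightarrow> 'b) \<Rightarrow> 'b multiset measure) \<Rightarrow> bool" where
  "is_palm_kernel k P Palm \<longleftrightarrow>
     (\<forall>x\<in>space (tup_space k). prob_space (Palm x) \<and> sets (Palm x) = sets cfg_space) \<and>
     (\<forall>L\<in>sets cfg_space. (\<lambda>x. emeasure (Palm x) L) \<in> borel_measurable (tup_space k)) \<and>
     (\<forall>B\<in>sets (tup_space k). \<forall>L\<in>sets cfg_space.
        (\<integral>\<^sup>+\<nu>. indicator L \<nu> * of_nat (cfg_pow k \<nu> B) \<partial>P) =
        (\<integral>\<^sup>+x\<in>B. emeasure (Palm x) L \<partial>moment_measure k P))"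

definition tup_mset :: "nat \<Rightarrow> (nat \<Rightarrow> 'b) \<Rightarrow> 'b multiset" where
  "tup_mset k y = mset (map y [0..<k])"

definition lap_u :: "real measure \<Rightarrow> real \<Rightarrow> real" where
  "lap_u H u = (\<integral>s. exp (- s * u) \<partial>H)"

definition tilt :: "real measure \<Rightarrow> real \<Rightarrow> real measure" where
  "tilt H u = density H (\<lambda>s. ennreal (exp (- s * u) / lap_u H u))"

definition post_density :: "'b multiset measure \<Rightarrow> ('b multiset \<Rightarrow> real) \<Rightarrow> real measure \<Rightarrow> real
    \<Rightarrow> 'b multiset \<Rightarrow> 'b multiset \<Rightarrow> real" where
  "post_density PN f H u Y \<nu> =
     exp (cfg_int (\<lambda>x. ln (lap_u H u)) \<nu>) * f (\<nu> + Y) /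
     (\<integral>N. exp (cfg_int (\<lambda>x. ln (lap_u H u)) N) * f (N + Y) \<partial>PN)"

end

(*  The reduced Palm law comes from the Mecke formula.  For tuples with distinct entries the k-fold
    Mecke formula says that the Campbell measure of the Gibbs process is
    E[f(N + Y_y) 1_L(N + Y_y)] \<omega>^k(dy), where Y_y is the configuration of the points of y.
    Disintegrating (densities are a.e. unique and the configuration space is countably generated)
    shows that the reduced Palm law at y has density f(\<nu> + Y_y) / c with respect to the Poisson law.
    Integrating out independent marks turns the Laplace functional at g into the integral of
    the product of the Laplace transforms \<phi>(g(x)) over the points x of \<nu>, and
      \<phi>(g(x) + u) = \<phi>(u) * (\<phi>(g(x) + u) / \<phi>(u))
    moves the factors \<phi>(u) into the density of the points and the quotients into the tilted marks.
    Finally a law of random measures is determined by its Laplace functional on bounded functions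
    with bounded support. *)

theory Submission
  imports Defs
begin

section \<open>Configuration space\<close>

text \<open>Distinctness of the tuple shapes the Palm part. The ordinary power of a configuration
  also counts tuples that use one point twice, and such diagonal terms need not have a density with
  respect to the product intensity. On tuples with distinct entries the ordinary and the factorial
  power agree, even if points of the configuration coincide. The constant c is the k-point
  correlation function at y: it is finite almost everywhere because the moment measure is
  sigma-finite, and positive almost everywhere because a measure does not charge the zeros of its
  own density. It cancels in the quotient of Laplace functionals, so only its finiteness and
  positivity matter. The second obstacle is that \<open>enum_mset\<close> is an arbitrary choice,
  with no measurability available. Sums over points and the marking kernel therefore have to be
  shown measurable without ordering the points: sums are reduced to counts, and marking is reduced
  to an average over the point that is marked first. The random measures compared may have infinite
  mass on some sets; working with exp (- M A) in [0, 1], with value 0 at infinity, treats this case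
  uniformly.\<close>

lemma cnt_empty [simp]: "cnt A {#} = 0"
  by (simp add: cnt_def)

lemma cnt_add_mset [simp]: "cnt A (add_mset x \<nu>) = (if x \<in> A then Suc (cnt A \<nu>) else cnt A \<nu>)"
  by (simp add: cnt_def)

lemma cnt_union [simp]: "cnt A (\<mu> + \<nu>) = cnt A \<mu> + cnt A \<nu>"
  by (simp add: cnt_def)

lemma cnt_UNIV [simp]: "cnt UNIV \<nu> = size \<nu>"
  by (simp add: cnt_def)

lemma cnt_eq_0: "set_mset \<nu> \<inter> A = {} \<Longrightarrow> cnt A \<nu> = 0"
  by (induction \<nu>) auto

lemma cnt_diff_single:
  "cnt A (\<nu> - {#x#}) = cnt A \<nu> - (if x \<in> A \<and> x \<in># \<nu> then 1 else 0)"
proof (cases "x \<in># \<nu>")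
  case True
  then obtain \<nu>' where "\<nu> = add_mset x \<nu>'" by (metis insert_DiffM)
  then show ?thesis by simp
qed (simp add: diff_single_trivial)

lemma cnt_disjoint_UN:
  assumes "finite I" "disjoint_family_on A I"
  shows "cnt (\<Union>i\<in>I. A i) \<nu> = (\<Sum>i\<in>I. cnt (A i) \<nu>)"
proof (induction \<nu>)
  case (add x \<nu>)
  show ?case
  proof (cases "\<exists>j\<in>I. x \<in> A j")
    case True
    then obtain j where j: "j \<in> I" "x \<in> A j" by auto
    have "\<And>i. i \<in> I \<Longrightarrow> x \<in> A i \<longleftrightarrow> i = j"
      using assms(2) j by (auto simp: disjoint_family_on_def)
    then have "(\<Sum>i\<in>I. cnt (A i) (add_mset x \<nu>)) = (\<Sum>i\<in>I. cnt (A i) \<nu> + (if i = j then 1 else 0))"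
      by (intro sum.cong) auto
    also have "\<dots> = Suc (\<Sum>i\<in>I. cnt (A i) \<nu>)"
      using assms(1) j by (simp add: sum.distrib)
    finally show ?thesis using add j by auto
  next
    case False
    then have "(\<Sum>i\<in>I. cnt (A i) (add_mset x \<nu>)) = (\<Sum>i\<in>I. cnt (A i) \<nu>)"
      by (intro sum.cong) auto
    with False add show ?thesis by auto
  qed
qed simp

lemma space_cfg_space [simp]: "space cfg_space = UNIV"
  by (simp add: cfg_space_def space_measure_of_conv)

lemma sets_cfg_space:
  "sets (cfg_space :: 'b::topological_space multiset measure)
     = sigma_sets UNIV {{\<nu>. cnt A \<nu> = n} | A n. A \<in> sets borel}"
  unfolding cfg_space_def by (rule sets_measure_of) auto

lemma measurable_cnt [measurable (raw)]:
  assumes "A \<in> sets borel" "f \<in> measurable M cfg_space"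
  shows "(\<lambda>x. cnt A (f x)) \<in> measurable M (count_space UNIV)"
proof -
  have "cnt A \<in> measurable cfg_space (count_space UNIV)"
  proof (subst measurable_count_space_eq2_countable, safe)
    fix n
    have "cnt A -` {n} \<inter> space cfg_space = {\<nu>. cnt A \<nu> = n}" by auto
    then show "cnt A -` {n} \<inter> space cfg_space \<in> sets cfg_space"
      using assms(1) by (auto simp: sets_cfg_space intro!: sigma_sets.Basic)
  qed auto
  from measurable_compose[OF assms(2) this] show ?thesis .
qed

lemma measurable_cfg_spaceI:
  fixes f :: "'c \<Rightarrow> 'b::topological_space multiset"
  assumes "\<And>A. A \<in> sets borel \<Longrightarrow> (\<lambda>x. cnt A (f x)) \<in> measurable M (count_space UNIV)"
  shows "f \<in> measurable M cfg_space"
proof (rule measurable_sigma_sets[OF sets_cfg_space])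
  fix y assume "y \<in> {{\<nu>. cnt A \<nu> = n} | A n. A \<in> sets (borel :: 'b measure)}"
  then obtain A n where A: "A \<in> sets borel" "y = {\<nu>. cnt A \<nu> = n}" by auto
  have "f -` y \<inter> space M = (\<lambda>x. cnt A (f x)) -` {n} \<inter> space M" using A by auto
  also have "\<dots> \<in> sets M" using assms[OF A(1)] by (rule measurable_sets) simp
  finally show "f -` y \<inter> space M \<in> sets M" .
qed auto

lemma measurable_add_mset [measurable (raw)]:
  assumes [measurable]: "f \<in> measurable M borel" "g \<in> measurable M cfg_space"
  shows "(\<lambda>x. add_mset (f x) (g x)) \<in> measurable M cfg_space"
  by (rule measurable_cfg_spaceI) simp

lemma measurable_union_mset [measurable (raw)]:
  assumes [measurable]: "f \<in> measurable M cfg_space" "g \<in> measurable M cfg_space"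
  shows "(\<lambda>x. f x + g x) \<in> measurable M cfg_space"
  by (rule measurable_cfg_spaceI) simp

lemma measurable_const_mset [measurable]: "(\<lambda>x. \<nu>) \<in> measurable M cfg_space"
  by (rule measurable_cfg_spaceI) simp

lemma measurable_size_mset [measurable (raw)]:
  assumes [measurable]: "f \<in> measurable M cfg_space"
  shows "(\<lambda>x. size (f x)) \<in> measurable M (count_space UNIV)"
  using measurable_cnt[OF _ assms, of UNIV] by simp

text \<open>The support of a multiset is finite, hence closed in a T1 space, so a point outside it
  has a basic neighbourhood that contains no point of the multiset. Membership thus becomes a
  countable family of conditions on counts.\<close>

lemma measurable_member_mset [measurable (raw)]:
  fixes f :: "'c \<Rightarrow> 'b::{second_countable_topology, t1_space}"
  assumes [measurable]: "f \<in> measurable M borel" "g \<in> measurable M cfg_space"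
  shows "Measurable.pred M (\<lambda>x. f x \<in># g x)"
proof -
  obtain B :: "'b set set" where B: "countable B" "topological_basis B"
    using ex_countable_basis by blast
  have [measurable]: "U \<in> sets borel" if "U \<in> B" for U
    using topological_basis_open[OF B(2) that] by simp
  have eq: "f x \<in># g x \<longleftrightarrow> (\<forall>U\<in>B. f x \<in> U \<longrightarrow> cnt U (g x) \<noteq> 0)" for x
  proof
    assume "f x \<in># g x"
    then obtain \<nu> where "g x = add_mset (f x) \<nu>" by (metis insert_DiffM)
    then show "\<forall>U\<in>B. f x \<in> U \<longrightarrow> cnt U (g x) \<noteq> 0" by auto
  next
    assume *: "\<forall>U\<in>B. f x \<in> U \<longrightarrow> cnt U (g x) \<noteq> 0"
    show "f x \<in># g x"
    proof (rule ccontr)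
      assume "f x \<notin># g x"
      moreover have "open (- set_mset (g x))" by (intro open_Compl finite_imp_closed) simp
      ultimately obtain U where U: "U \<in> B" "f x \<in> U" "U \<subseteq> - set_mset (g x)"
        using topological_basisE[OF B(2)] by (metis ComplI)
      then have "cnt U (g x) = 0" by (intro cnt_eq_0) auto
      with * U show False by auto
    qed
  qed
  show ?thesis unfolding eq using B(1) by measurable
qed

lemma measurable_diff_single [measurable (raw)]:
  fixes f :: "'c \<Rightarrow> 'b::{second_countable_topology, t1_space}"
  assumes [measurable]: "f \<in> measurable M borel" "g \<in> measurable M cfg_space"
  shows "(\<lambda>x. g x - {#f x#}) \<in> measurable M cfg_space"
  by (rule measurable_cfg_spaceI) (simp add: cnt_diff_single)

lemma measurable_diff_const_mset:
  fixes Y :: "'b::{second_countable_topology, t1_space} multiset"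
  shows "(\<lambda>\<nu>. \<nu> - Y) \<in> measurable cfg_space cfg_space"
proof (induction Y)
  case (add y Y)
  note add [measurable]
  have "(\<lambda>\<nu>. (\<nu> - Y) - {#y#}) \<in> measurable cfg_space cfg_space" by measurable
  then show ?case by simp
qed simp

section \<open>Cylinder events and a countable generator of the configuration space\<close>

definition cylinder :: "('b set \<times> nat) list \<Rightarrow> 'b multiset set" where
  "cylinder l = {\<nu>. \<forall>(A, n)\<in>set l. cnt A \<nu> = n}"

text \<open>Constraints are kept in lists: appending two lists gives the intersection, the empty
  list gives the whole space, and a countable family admits only countably many lists.\<close>

definition cylinders :: "'b set set \<Rightarrow> 'b multiset set set" where
  "cylinders \<G> = cylinder ` lists (\<G> \<times> UNIV)"

lemma Int_stable_cylinders:
  fixes \<G> :: "'b set set"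
  shows "Int_stable (cylinders \<G>)"
proof (rule Int_stableI)
  fix L L' assume "L \<in> cylinders \<G>" "L' \<in> cylinders \<G>"
  then obtain l l' where "L = cylinder l" "L' = cylinder l'" "l @ l' \<in> lists (\<G> \<times> UNIV)"
    by (auto simp: cylinders_def)
  moreover have "cylinder l \<inter> cylinder l' = cylinder (l @ l')"
    by (simp add: cylinder_def ball_Un Collect_conj_eq)
  ultimately show "L \<inter> L' \<in> cylinders \<G>" by (auto simp: cylinders_def)
qed

lemma UNIV_in_cylinders: "UNIV \<in> cylinders \<G>"
  unfolding cylinders_def by (rule image_eqI[of _ _ "[]"]) (auto simp: cylinder_def)

lemma countable_cylinders: "countable \<G> \<Longrightarrow> countable (cylinders \<G>)"
  unfolding cylinders_def by (intro countable_image countable_lists) auto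

lemma sets_cylinder:
  assumes "l \<in> lists (sets borel \<times> UNIV)"
  shows "cylinder l \<in> sets cfg_space"
proof -
  have "cylinder l = {\<nu> \<in> space cfg_space. \<forall>p\<in>set l. cnt (fst p) \<nu> = snd p}"
    by (auto simp: cylinder_def)
  also have "\<dots> \<in> sets cfg_space"
    using assms by (intro sets.sets_Collect_finite_All)
      (fastforce simp: sets_cfg_space intro!: sigma_sets.Basic)+
  finally show ?thesis .
qed

text \<open>Counts are finite, so the count of a complement is a difference of counts, and the count
  of a disjoint union is a sum. The sets with measurable count therefore form a Dynkin system
  containing the intersection-stable generator.\<close>

lemma sets_cfg_space_eq_cylinders:
  fixes \<G> :: "'b::topological_space set set"
  assumes "Int_stable \<G>" and borel: "sets borel = sigma_sets UNIV \<G>"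
    and "UNIV \<in> \<G>"
  shows "sets cfg_space = sigma_sets UNIV (cylinders \<G>)"
proof (intro antisym)
  have \<G>: "\<G> \<subseteq> sets borel" unfolding borel by (auto intro: sigma_sets.Basic)
  show "sigma_sets UNIV (cylinders \<G>) \<subseteq> sets cfg_space"
  proof (rule sets.sigma_sets_subset[where M=cfg_space, simplified])
    show "cylinders \<G> \<subseteq> sets cfg_space"
      using \<G> by (auto simp: cylinders_def intro!: sets_cylinder)
  qed
  define M where "M = sigma UNIV (cylinders \<G>)"
  have M: "sets M = sigma_sets UNIV (cylinders \<G>)" "space M = UNIV"
    unfolding M_def by (auto simp: sets_measure_of_conv space_measure_of_conv)
  have G: "cnt A \<in> measurable M (count_space UNIV)" if "A \<in> \<G>" for A
  proof (subst measurable_count_space_eq2_countable, safe)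
    fix n
    have "cnt A -` {n} \<inter> space M = cylinder [(A, n)]" by (auto simp: cylinder_def M)
    moreover have "cylinder [(A, n)] \<in> cylinders \<G>" using that by (auto simp: cylinders_def)
    ultimately show "cnt A -` {n} \<inter> space M \<in> sets M" by (auto simp: M)
  qed (auto simp: M)
  have "\<G> \<subseteq> Pow UNIV" by simp
  have "cnt A \<in> measurable M (count_space UNIV)" if "A \<in> sets borel" for A
    using assms(1) \<open>\<G> \<subseteq> Pow UNIV\<close> that[unfolded borel]
  proof (induction rule: sigma_sets_induct_disjoint)
    case (compl A)
    note compl(2)[measurable] G[OF assms(3), measurable]
    have "cnt UNIV \<nu> = cnt (UNIV - A) \<nu> + cnt A \<nu>" for \<nu>
      by (induction \<nu>) auto
    then have "cnt (UNIV - A) = (\<lambda>\<nu>. cnt UNIV \<nu> - cnt A \<nu>)" by auto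
    moreover have "(\<lambda>\<nu>. cnt UNIV \<nu> - cnt A \<nu>) \<in> measurable M (count_space UNIV)"
      by measurable
    ultimately show ?case by simp
  next
    case (union A)
    note union(3)[measurable]
    \<comment> \<open>In \<open>ennreal\<close> the infinite sum needs no convergence argument; the
      count is read off again from the singletons \<open>{of_nat n}\<close>.\<close>
    have "of_nat (cnt (\<Union>i. A i) \<nu>) = (\<Sum>i. of_nat (cnt (A i) \<nu>) :: ennreal)" for \<nu>
    proof (induction \<nu>)
      case (add x \<nu>)
      have "(\<Sum>i. of_nat (cnt (A i) (add_mset x \<nu>)) :: ennreal)
          = (\<Sum>i. indicator (A i) x + of_nat (cnt (A i) \<nu>))"
        by (intro suminf_cong) auto
      also have "\<dots> = (\<Sum>i. indicator (A i) x) + (\<Sum>i. of_nat (cnt (A i) \<nu>))"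
        by (rule suminf_add[symmetric]) auto
      also have "(\<Sum>i. indicator (A i) x :: ennreal) = indicator (\<Union>i. A i) x"
        by (rule suminf_indicator) fact
      finally show ?case using add by (simp split: split_indicator)
    qed simp
    moreover have "(\<lambda>\<nu>. \<Sum>i. of_nat (cnt (A i) \<nu>) :: ennreal) \<in> borel_measurable M"
      by measurable
    ultimately have *: "(\<lambda>\<nu>. of_nat (cnt (\<Union>i. A i) \<nu>) :: ennreal) \<in> borel_measurable M" by simp
    show ?case
    proof (subst measurable_count_space_eq2_countable, safe)
      fix n
      have "cnt (\<Union>i. A i) -` {n} \<inter> space M
          = (\<lambda>\<nu>. of_nat (cnt (\<Union>i. A i) \<nu>) :: ennreal) -` {of_nat n} \<inter> space M"
        by auto
      then show "cnt (\<Union>i. A i) -` {n} \<inter> space M \<in> sets M"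
        using measurable_sets[OF *, of "{of_nat n}"] by simp
    qed (auto simp: M)
  qed (use G in \<open>auto simp: cnt_eq_0\<close>)
  then have "(\<lambda>x. x) \<in> measurable M cfg_space"
    by (intro measurable_cfg_spaceI) auto
  from measurable_sets[OF this] show "sets cfg_space \<subseteq> sigma_sets UNIV (cylinders \<G>)"
    by (auto simp: M)
qed

text \<open>Countability lets the exceptional sets of the individual events be united into one null
  set; closure under intersections makes agreement on the generator enough for equality of
  laws.\<close>

lemma cfg_space_countable_generator:
  obtains \<L> :: "'b::second_countable_topology multiset set set" where
    "countable \<L>" "Int_stable \<L>" "UNIV \<in> \<L>" "sets cfg_space = sigma_sets UNIV \<L>"
proof -
  obtain B :: "'b set set" where B: "countable B" "topological_basis B"
    using ex_countable_basis by blast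
  \<comment> \<open>The empty family contributes \<open>UNIV\<close>, whose count is needed to treat
    complements.\<close>
  define \<G> where "\<G> = (\<lambda>F. \<Inter>F) ` {F. finite F \<and> F \<subseteq> B}"
  have "countable \<G>" unfolding \<G>_def by (intro countable_image countable_Collect_finite_subset B)
  moreover have "Int_stable \<G>"
  proof (unfold Int_stable_def \<G>_def, safe)
    fix F F' assume "finite F" "F \<subseteq> B" "finite F'" "F' \<subseteq> B"
    then show "\<Inter>F \<inter> \<Inter>F' \<in> Inter ` {F. finite F \<and> F \<subseteq> B}"
      by (intro image_eqI[of _ _ "F \<union> F'"]) auto
  qed
  moreover have "UNIV \<in> \<G>" unfolding \<G>_def by (intro image_eqI[of _ _ "{}"]) auto
  moreover have "sets borel = sigma_sets UNIV \<G>"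
  proof (intro antisym)
    have "B \<subseteq> \<G>"
    proof
      fix U assume "U \<in> B" then show "U \<in> \<G>" unfolding \<G>_def by (intro image_eqI[of _ _ "{U}"]) auto
    qed
    then show "sets borel \<subseteq> sigma_sets UNIV \<G>"
      using sigma_sets_subseteq[of B \<G> UNIV]
      by (simp add: borel_eq_countable_basis[OF B] sets_measure_of_conv)
    have "F \<in> sets borel" if "F \<in> \<G>" for F
    proof -
      from that obtain G where G: "finite G" "G \<subseteq> B" "F = \<Inter>G" by (auto simp: \<G>_def)
      then have "open F" using topological_basis_open[OF B(2)] by (auto intro!: open_Inter)
      then show ?thesis by simp
    qed
    then show "sigma_sets UNIV \<G> \<subseteq> sets borel"
      using sets.sigma_sets_subset[where M="borel::'b measure" and a=\<G>] by auto
  qed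
  ultimately show ?thesis
    using that[of "cylinders \<G>"] sets_cfg_space_eq_cylinders Int_stable_cylinders
      UNIV_in_cylinders countable_cylinders by blast
qed

section \<open>Laplace functionals determine laws of random measures\<close>

lemma space_meas_algebra: "space (meas_algebra K) = {M. sets M = sets K}"
  by (auto simp: meas_algebra_def space_Sup_eq_UN)

lemma measurable_emeasure_meas_algebra [measurable]:
  "A \<in> sets K \<Longrightarrow> (\<lambda>M. emeasure M A) \<in> borel_measurable (meas_algebra K)"
  by (auto intro!: measurable_Sup1 measurable_vimage_algebra1 simp: meas_algebra_def)

lemma measurable_meas_algebraI:
  "(\<And>x. x \<in> space M \<Longrightarrow> sets (f x) = sets K) \<Longrightarrow>
   (\<And>A. A \<in> sets K \<Longrightarrow> (\<lambda>x. emeasure (f x) A) \<in> borel_measurable M) \<Longrightarrow>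
   f \<in> measurable M (meas_algebra K)"
  by (auto intro!: measurable_Sup2 measurable_vimage_algebra2 simp: meas_algebra_def)

lemma measurable_nn_integral_meas_algebra:
  assumes "g \<in> borel_measurable K"
  shows "(\<lambda>M. \<integral>\<^sup>+x. g x \<partial>M) \<in> borel_measurable (meas_algebra K)"
  using assms
proof (induction rule: borel_measurable_induct)
  case (cong f g)
  have "(\<integral>\<^sup>+x. f x \<partial>M) = (\<integral>\<^sup>+x. g x \<partial>M)" if "M \<in> space (meas_algebra K)" for M
    using cong that by (intro nn_integral_cong) (auto simp: space_meas_algebra dest: sets_eq_imp_space_eq)
  with cong show ?case by (simp cong: measurable_cong)
next
  case (set A)
  have "(\<lambda>M. \<integral>\<^sup>+x. indicator A x \<partial>M) \<in> borel_measurable (meas_algebra K) \<longleftrightarrow>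
        (\<lambda>M. emeasure M A) \<in> borel_measurable (meas_algebra K)"
    using set by (intro measurable_cong) (auto simp: space_meas_algebra intro!: nn_integral_indicator)
  with set show ?case by simp
next
  case (mult u c)
  have "(\<lambda>M. \<integral>\<^sup>+x. c * u x \<partial>M) \<in> borel_measurable (meas_algebra K) \<longleftrightarrow>
        (\<lambda>M. c * (\<integral>\<^sup>+x. u x \<partial>M)) \<in> borel_measurable (meas_algebra K)"
    using mult by (intro measurable_cong nn_integral_cmult)
      (auto simp: space_meas_algebra cong: measurable_cong_sets)
  with mult show ?case by simp
next
  case (add u v)
  have "(\<lambda>M. \<integral>\<^sup>+x. v x + u x \<partial>M) \<in> borel_measurable (meas_algebra K) \<longleftrightarrow>
        (\<lambda>M. (\<integral>\<^sup>+x. v x \<partial>M) + (\<integral>\<^sup>+x. u x \<partial>M)) \<in> borel_measurable (meas_algebra K)"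
    using add by (intro measurable_cong nn_integral_add)
      (auto simp: space_meas_algebra cong: measurable_cong_sets)
  with add show ?case by simp
next
  case (seq U)
  have "(\<lambda>M. \<integral>\<^sup>+x. (SUP i. U i) x \<partial>M) \<in> borel_measurable (meas_algebra K) \<longleftrightarrow>
        (\<lambda>M. SUP i. \<integral>\<^sup>+x. U i x \<partial>M) \<in> borel_measurable (meas_algebra K)"
    unfolding SUP_apply
    using seq by (intro measurable_cong nn_integral_monotone_convergence_SUP)
      (auto simp: space_meas_algebra cong: measurable_cong_sets)
  with seq show ?case by simp
qed

lemma measurable_exp_neg_ext [measurable]: "exp_neg_ext \<in> borel_measurable borel"
  unfolding exp_neg_ext_def by measurable

lemma exp_neg_ext_bounds: "0 \<le> exp_neg_ext t" "exp_neg_ext t \<le> 1"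
  by (auto simp: exp_neg_ext_def)

lemma exp_neg_ext_0 [simp]: "exp_neg_ext 0 = 1"
  by (simp add: exp_neg_ext_def)

lemma exp_neg_ext_ennreal: "0 \<le> t \<Longrightarrow> exp_neg_ext (ennreal t) = exp (- t)"
  by (simp add: exp_neg_ext_def)

lemma exp_neg_ext_add: "exp_neg_ext (a + b) = exp_neg_ext a * exp_neg_ext b"
  by (cases a; cases b) (auto simp: exp_neg_ext_def exp_add[symmetric] simp flip: ennreal_plus)

lemma exp_neg_ext_of_nat_mult: "exp_neg_ext (of_nat n * a) = exp_neg_ext a ^ n"
  by (induction n) (simp_all add: distrib_right exp_neg_ext_add)

text \<open>The mass is recovered from a number in [0, 1], with 0 coding infinite mass. Hence the
  bounded variables exp (- M A) generate the same events as the masses themselves.\<close>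

lemma exp_neg_ext_inverse:
  "a = (if exp_neg_ext a = 0 then \<infinity> else ennreal (- ln (exp_neg_ext a)))"
  by (cases a) (auto simp: exp_neg_ext_def)

text \<open>Moments determine the law of Z because polynomials are uniformly dense in the continuous
  functions on [0, 1]. The weight G carries the factors that belong to other variables, so that a
  joint law can be treated one variable at a time.\<close>

lemma integral_indicator_eqI_moments:
  fixes G Z :: "'c \<Rightarrow> real"
  assumes "prob_space M" "prob_space N" and sets: "sets M = sets N"
    and [measurable]: "G \<in> borel_measurable M" "Z \<in> borel_measurable M"
    and G: "\<And>x. 0 \<le> G x" "\<And>x. G x \<le> 1" and Z: "\<And>x. 0 \<le> Z x" "\<And>x. Z x \<le> 1"
    and moments: "\<And>n. (\<integral>x. G x * Z x ^ n \<partial>M) = (\<integral>x. G x * Z x ^ n \<partial>N)"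
  shows "(\<integral>x. G x * indicator {..c} (Z x) \<partial>M) = (\<integral>x. G x * indicator {..c} (Z x) \<partial>N)"
proof -
  interpret M: prob_space M by fact
  interpret N: prob_space N by fact
  have [measurable]: "G \<in> borel_measurable N" "Z \<in> borel_measurable N"
    using assms(4,5) by (simp_all cong: measurable_cong_sets add: sets)
  have abs_le: "\<bar>G x * t\<bar> \<le> \<bar>t\<bar>" for x t
    using G[of x] by (simp add: abs_mult mult_left_le_one_le)
  have bdd: "\<bar>G x * \<phi> (Z x)\<bar> \<le> b" if "\<And>z. 0 \<le> z \<Longrightarrow> z \<le> 1 \<Longrightarrow> \<bar>\<phi> z\<bar> \<le> b" for \<phi> b x
    using abs_le[of x "\<phi> (Z x)"] that[of "Z x"] Z[of x] by linarith
  have pow: "\<bar>Z x ^ n\<bar> \<le> 1" for x n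
    using Z[of x] by (simp add: power_le_one)
  have intM: "integrable M (\<lambda>x. G x * Z x ^ n)" and intN: "integrable N (\<lambda>x. G x * Z x ^ n)" for n
    by (rule M.integrable_const_bound[where B=1] N.integrable_const_bound[where B=1];
        (rule AE_I2, unfold real_norm_def, rule order_trans[OF abs_le pow] | measurable))+
  \<comment> \<open>Since G is bounded by 1 and both measures are probabilities, replacing \<phi> by
    a polynomial within e / 2 costs at most e / 2 on each side; the polynomial integrals agree by
    the moments.\<close>
  have cont: "(\<integral>x. G x * \<phi> (Z x) \<partial>M) = (\<integral>x. G x * \<phi> (Z x) \<partial>N)"
    if \<phi>: "continuous_on UNIV \<phi>" for \<phi> :: "real \<Rightarrow> real"
  proof -
    have [measurable]: "\<phi> \<in> borel_measurable borel"
      using \<phi> by (rule borel_measurable_continuous_onI)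
    have "bounded (\<phi> ` {0..1})"
      using \<phi> by (intro compact_imp_bounded compact_continuous_image) (auto intro: continuous_on_subset)
    then obtain b where "\<forall>z\<in>{0..1}. \<bar>\<phi> z\<bar> \<le> b"
      unfolding bounded_iff by auto
    then have b: "\<And>z. 0 \<le> z \<Longrightarrow> z \<le> 1 \<Longrightarrow> \<bar>\<phi> z\<bar> \<le> b" by simp
    have b\<phi>: "\<bar>G x * \<phi> (Z x)\<bar> \<le> b" for x
      by (rule bdd[of \<phi>]) (rule b)
    have int\<phi>: "integrable M (\<lambda>x. G x * \<phi> (Z x))" "integrable N (\<lambda>x. G x * \<phi> (Z x))"
      by (rule M.integrable_const_bound[where B=b] N.integrable_const_bound[where B=b];
          (rule AE_I2, unfold real_norm_def, rule b\<phi> | measurable))+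
    have "\<bar>(\<integral>x. G x * \<phi> (Z x) \<partial>M) - (\<integral>x. G x * \<phi> (Z x) \<partial>N)\<bar> \<le> e" if e: "0 < e" for e
    proof -
      obtain g where g: "real_polynomial_function g" "\<And>x. x \<in> {0..1} \<Longrightarrow> \<bar>\<phi> x - g x\<bar> < e / 2"
        by (rule Stone_Weierstrass_real_polynomial_function[of "{0..1}" \<phi> "e/2"])
           (use continuous_on_subset[OF \<phi> subset_UNIV] e in auto)
      obtain a n where ga: "g = (\<lambda>x. \<Sum>i\<le>n. a i * x ^ i)"
        using g(1) real_polynomial_function_iff_sum by auto
      have eq: "G x * g (Z x) = (\<Sum>i\<le>n. a i * (G x * Z x ^ i))" for x
        by (simp add: ga sum_distrib_left algebra_simps)
      have ig: "integrable M (\<lambda>x. G x * g (Z x))" "integrable N (\<lambda>x. G x * g (Z x))"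
        unfolding eq using intM intN by auto
      have gg: "(\<integral>x. G x * g (Z x) \<partial>M) = (\<integral>x. G x * g (Z x) \<partial>N)"
        unfolding eq using intM intN moments by simp
      have close: "\<bar>G x * \<phi> (Z x) - G x * g (Z x)\<bar> \<le> e / 2" for x
        using bdd[of "\<lambda>z. \<phi> z - g z" "e/2" x] g(2) by (simp add: right_diff_distrib less_imp_le)
      have "\<bar>(\<integral>x. G x * \<phi> (Z x) \<partial>M) - (\<integral>x. G x * g (Z x) \<partial>M)\<bar> \<le> e / 2"
      proof -
        have "\<bar>\<integral>x. G x * \<phi> (Z x) - G x * g (Z x) \<partial>M\<bar> \<le> (\<integral>x. e / 2 \<partial>M)"
          using close int\<phi> ig by (intro order_trans[OF integral_abs_bound] integral_mono) auto
        then show ?thesis using int\<phi> ig by (simp add: M.prob_space)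
      qed
      moreover have "\<bar>(\<integral>x. G x * \<phi> (Z x) \<partial>N) - (\<integral>x. G x * g (Z x) \<partial>N)\<bar> \<le> e / 2"
      proof -
        have "\<bar>\<integral>x. G x * \<phi> (Z x) - G x * g (Z x) \<partial>N\<bar> \<le> (\<integral>x. e / 2 \<partial>N)"
          using close int\<phi> ig by (intro order_trans[OF integral_abs_bound] integral_mono) auto
        then show ?thesis using int\<phi> ig by (simp add: N.prob_space)
      qed
      ultimately show ?thesis unfolding gg by linarith
    qed
    then have "\<bar>(\<integral>x. G x * \<phi> (Z x) \<partial>M) - (\<integral>x. G x * \<phi> (Z x) \<partial>N)\<bar> \<le> 0"
      by (rule field_le_epsilon[of _ 0, simplified])
    then show ?thesis by simp
  qed
  \<comment> \<open>A ramp equal to 1 up to c that, for positive j, has fallen to 0 at c + 1 / j.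
    Descending to the right of c makes the limit the indicator of the closed half-line.\<close>
  define \<phi> :: "nat \<Rightarrow> real \<Rightarrow> real" where "\<phi> j z = max 0 (min 1 (1 - real j * (z - c)))" for j z
  have \<phi>_cont: "continuous_on UNIV (\<phi> j)" for j
    unfolding \<phi>_def by (intro continuous_intros)
  then have [measurable]: "\<phi> j \<in> borel_measurable borel" for j
    by (rule borel_measurable_continuous_onI)
  have lim: "(\<lambda>j. \<phi> j z) \<longlonglongrightarrow> indicator {..c} z" for z
  proof (cases "z \<le> c")
    case True
    then have "\<phi> j z = 1" for j by (simp add: \<phi>_def mult_nonneg_nonpos)
    with True show ?thesis by simp
  next
    case False
    then obtain n where n: "1 < real n * (z - c)"
      using reals_Archimedean3[of "z - c"] by auto
    have "\<forall>\<^sub>F j in sequentially. \<phi> j z = 0"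
      using eventually_ge_at_top[of n]
    proof eventually_elim
      case (elim j)
      then have "real n * (z - c) \<le> real j * (z - c)" using False by (intro mult_right_mono) auto
      with n have "1 < real j * (z - c)" by linarith
      then show ?case by (simp add: \<phi>_def)
    qed
    with False show ?thesis by (simp add: tendsto_eventually)
  qed
  have \<phi>1: "\<bar>\<phi> j z\<bar> \<le> 1" for j z by (simp add: \<phi>_def)
  have "(\<lambda>j. \<integral>x. G x * \<phi> j (Z x) \<partial>M) \<longlonglongrightarrow> (\<integral>x. G x * indicator {..c} (Z x) \<partial>M)"
    by (rule integral_dominated_convergence[where w="\<lambda>_. 1"])
       (use lim bdd[of "\<phi> _" 1, OF \<phi>1] in \<open>auto intro!: tendsto_intros\<close>)
  moreover have "(\<lambda>j. \<integral>x. G x * \<phi> j (Z x) \<partial>N) \<longlonglongrightarrow> (\<integral>x. G x * indicator {..c} (Z x) \<partial>N)"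
    by (rule integral_dominated_convergence[where w="\<lambda>_. 1"])
       (use lim bdd[of "\<phi> _" 1, OF \<phi>1] in \<open>auto intro!: tendsto_intros\<close>)
  ultimately show ?thesis
    using cont[OF \<phi>_cont] by (simp add: LIMSEQ_unique)
qed


text \<open>Mixed moments of the variables exp (- M B) are values of a Laplace functional: the
  exponents add up to the integral of a simple function, which is bounded with bounded support when
  the sets B are bounded.\<close>

lemma prod_list_exp_neg_ext_eq:
  fixes Bs :: "('b::metric_space set \<times> nat) list"
  assumes "sets M = sets borel" "\<And>B n. (B, n) \<in> set Bs \<Longrightarrow> B \<in> sets borel"
  shows "(\<Prod>(B, n)\<leftarrow>Bs. exp_neg_ext (emeasure M B) ^ n)
       = exp_neg_ext (\<integral>\<^sup>+z. ennreal (\<Sum>(B, n)\<leftarrow>Bs. real n * indicator B z) \<partial>M)"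
  using assms(2)
proof (induction Bs)
  case (Cons p Bs)
  obtain B n where p: "p = (B, n)" by (cases p)
  have B: "B \<in> sets M" using Cons.prems[of B n] assms(1) p by simp
  have nn: "0 \<le> (\<Sum>(B, n)\<leftarrow>Bs. real n * indicator B z)" for z :: 'b
    by (intro sum_list_nonneg) auto
  have m: "(\<lambda>z. \<Sum>(B, n)\<leftarrow>Bs. real n * indicator B z) \<in> borel_measurable M"
    using Cons.prems assms(1)
  proof (induction Bs)
    case (Cons q Bs)
    obtain C k where q: "q = (C, k)" by (cases q)
    have [measurable]: "C \<in> sets M" "(\<lambda>z. \<Sum>(B, n)\<leftarrow>Bs. real n * indicator B z) \<in> borel_measurable M"
      using Cons q by auto
    show ?case unfolding q by simp
  qed simp
  have "(\<integral>\<^sup>+z. ennreal (\<Sum>(B, n)\<leftarrow>p # Bs. real n * indicator B z) \<partial>M)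
      = (\<integral>\<^sup>+z. of_nat n * indicator B z + ennreal (\<Sum>(B, n)\<leftarrow>Bs. real n * indicator B z) \<partial>M)"
    unfolding p using nn
    by (intro nn_integral_cong) (auto simp: ennreal_of_nat_eq_real_of_nat ennreal_mult' split: split_indicator)
  also have "\<dots> = of_nat n * emeasure M B + (\<integral>\<^sup>+z. ennreal (\<Sum>(B, n)\<leftarrow>Bs. real n * indicator B z) \<partial>M)"
    using B m by (subst nn_integral_add) (auto simp: nn_integral_cmult)
  moreover have "(\<Prod>(B, n)\<leftarrow>Bs. exp_neg_ext (emeasure M B) ^ n)
      = exp_neg_ext (\<integral>\<^sup>+z. ennreal (\<Sum>(B, n)\<leftarrow>Bs. real n * indicator B z) \<partial>M)"
    using Cons.prems by (intro Cons.IH) auto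
  ultimately show ?case
    unfolding p by (simp add: exp_neg_ext_add exp_neg_ext_of_nat_mult)
qed simp

text \<open>Instead of a multivariate Laplace inversion, the moments of the variables
  \<open>exp (- M A) \<in> [0, 1]\<close> are turned into indicators of lower sets one variable at a time.\<close>

lemma laplace_eq_imp_joint_eq:
  fixes Q R :: "'b::metric_space measure measure"
  assumes Q: "prob_space Q" "sets Q = sets (meas_algebra borel)"
    and R: "prob_space R" "sets R = sets (meas_algebra borel)"
    and eq: "\<And>f. f \<in> borel_measurable borel \<Longrightarrow> (\<And>z. 0 \<le> f z) \<Longrightarrow> bounded (range f) \<Longrightarrow>
               bounded {z. f z \<noteq> 0} \<Longrightarrow> laplace Q f = laplace R f"
    and "\<And>A c. (A, c) \<in> set As \<Longrightarrow> A \<in> sets borel \<and> bounded A"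
    and "\<And>B n. (B, n) \<in> set Bs \<Longrightarrow> B \<in> sets borel \<and> bounded B"
  shows "(\<integral>M. (\<Prod>(A, c)\<leftarrow>As. indicator {..c} (exp_neg_ext (emeasure M A))) *
               (\<Prod>(B, n)\<leftarrow>Bs. exp_neg_ext (emeasure M B) ^ n) \<partial>Q)
       = (\<integral>M. (\<Prod>(A, c)\<leftarrow>As. indicator {..c} (exp_neg_ext (emeasure M A))) *
               (\<Prod>(B, n)\<leftarrow>Bs. exp_neg_ext (emeasure M B) ^ n) \<partial>R)"
  using assms(6,7)
proof (induction As arbitrary: Bs)
  case Nil
  define f :: "'b \<Rightarrow> real" where "f z = (\<Sum>(B, n)\<leftarrow>Bs. real n * indicator B z)" for z
  have "f \<in> borel_measurable borel \<and> (\<forall>z. 0 \<le> f z) \<and> bounded (range f) \<and> bounded {z. f z \<noteq> 0}"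
    unfolding f_def using Nil(2)
  proof (induction Bs)
    case (Cons q Bs)
    obtain B n where q: "q = (B, n)" by (cases q)
    define g :: "'b \<Rightarrow> real" where "g z = (\<Sum>(B, n)\<leftarrow>Bs. real n * indicator B z)" for z
    have IH: "g \<in> borel_measurable borel" "\<And>z. 0 \<le> g z" "bounded (range g)" "bounded {z. g z \<noteq> 0}"
      using Cons.IH Cons.prems unfolding g_def by auto
    have B: "B \<in> sets borel" "bounded B" using Cons.prems[of B n] q by auto
    have "(\<lambda>z. real n * indicator B z + g z) \<in> borel_measurable borel" using B IH by measurable
    moreover have "bounded (range (\<lambda>z. real n * indicator B z + g z))"
      by (intro bounded_plus_comp IH(3) boundedI[where B="real n"]) (auto split: split_indicator)
    moreover have "bounded {z. real n * indicator B z + g z \<noteq> 0}"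
      by (rule bounded_subset[of "B \<union> {z. g z \<noteq> 0}"]) (use B IH in \<open>auto split: split_indicator_asm\<close>)
    ultimately show ?case using IH(2) unfolding q g_def by simp
  qed simp
  then have "laplace Q f = laplace R f" by (intro eq) auto
  moreover have "(\<integral>M. (\<Prod>(B, n)\<leftarrow>Bs. exp_neg_ext (emeasure M B) ^ n) \<partial>P) = laplace P f"
    if P: "sets P = sets (meas_algebra borel)" for P
    unfolding laplace_def f_def using Nil(2) sets_eq_imp_space_eq[OF P]
    by (intro Bochner_Integration.integral_cong prod_list_exp_neg_ext_eq)
       (auto simp: space_meas_algebra)
  ultimately show ?case using Q R by simp
next
  case (Cons p As)
  obtain A c where p: "p = (A, c)" by (cases p)
  let ?G = "\<lambda>M. (\<Prod>(A, c)\<leftarrow>As. indicator {..c} (exp_neg_ext (emeasure M A))) *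
               (\<Prod>(B, n)\<leftarrow>Bs. exp_neg_ext (emeasure M B) ^ n) :: real"
  let ?Z = "\<lambda>M. exp_neg_ext (emeasure M A)"
  have A: "A \<in> sets borel" "bounded A" using Cons.prems(1)[of A c] p by auto
  have P01: "0 \<le> prod_list xs \<and> prod_list xs \<le> 1" if "\<And>x. x \<in> set xs \<Longrightarrow> 0 \<le> x \<and> x \<le> 1" for xs :: "real list"
    using that by (induction xs) (auto simp: mult_le_one)
  have G1: "0 \<le> (\<Prod>(A, c)\<leftarrow>As. indicator {..c} (exp_neg_ext (emeasure M A)) :: real) \<and>
    (\<Prod>(A, c)\<leftarrow>As. indicator {..c} (exp_neg_ext (emeasure M A))) \<le> (1::real)" for M :: "'b measure"
    by (rule P01) (auto split: split_indicator)
  have G2: "0 \<le> (\<Prod>(B, n)\<leftarrow>Bs. exp_neg_ext (emeasure M B) ^ n) \<and>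
    (\<Prod>(B, n)\<leftarrow>Bs. exp_neg_ext (emeasure M B) ^ n) \<le> (1::real)" for M :: "'b measure"
    by (rule P01) (auto simp: exp_neg_ext_bounds intro!: power_le_one)
  have mp: "(\<lambda>M. \<Prod>q\<leftarrow>qs. F q M) \<in> borel_measurable Q"
    if "\<And>q. q \<in> set qs \<Longrightarrow> F q \<in> borel_measurable Q" for qs and F :: "'d \<Rightarrow> 'b measure \<Rightarrow> real"
    using that by (induction qs) auto
  have [measurable]: "C \<in> sets borel \<Longrightarrow> (\<lambda>M. emeasure M C) \<in> borel_measurable Q" for C
    using measurable_emeasure_meas_algebra[of C borel] Q(2) by (simp cong: measurable_cong_sets)
  have mI: "(\<lambda>M. indicat_real {..c} (exp_neg_ext (emeasure M C))) \<in> borel_measurable Q"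
    and mZ: "(\<lambda>M. exp_neg_ext (emeasure M C) ^ n) \<in> borel_measurable Q"
    if [measurable]: "C \<in> sets borel" for C c n
    by measurable
  have sb: "(A, c) \<in> set As \<Longrightarrow> A \<in> sets borel" "(B, n) \<in> set Bs \<Longrightarrow> B \<in> sets borel" for A B c n
    using Cons.prems by auto
  have "(\<integral>M. ?G M * indicator {..c} (?Z M) \<partial>Q) = (\<integral>M. ?G M * indicator {..c} (?Z M) \<partial>R)"
  proof (rule integral_indicator_eqI_moments)
    show "?G \<in> borel_measurable Q"
      by (intro borel_measurable_times mp) (auto intro!: mI mZ intro: sb)
    show "?Z \<in> borel_measurable Q" using A by measurable
    \<comment> \<open>The power of the variable being converted joins the list of moments, which is
      why the induction leaves \<open>Bs\<close> arbitrary.\<close>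
    show "(\<integral>M. ?G M * ?Z M ^ n \<partial>Q) = (\<integral>M. ?G M * ?Z M ^ n \<partial>R)" for n
      using Cons.IH[of "(A, n) # Bs"] Cons.prems A by (auto simp: ac_simps)
  qed (use Q R G1 G2 exp_neg_ext_bounds in \<open>auto intro!: mult_le_one\<close>)
  then show ?case unfolding p by (simp add: ac_simps)
qed

text \<open>Events that bound finitely many variables exp (- M A), with A bounded, are stable under
  intersection and generate \<open>meas_algebra\<close>. Their probabilities agree by the joint
  identity with an empty list of moments.\<close>

theorem laplace_unique:
  fixes Q R :: "'b::metric_space measure measure"
  assumes Q: "prob_space Q" "sets Q = sets (meas_algebra borel)"
    and R: "prob_space R" "sets R = sets (meas_algebra borel)"
    and eq: "\<And>f. f \<in> borel_measurable borel \<Longrightarrow> (\<And>z. 0 \<le> f z) \<Longrightarrow> bounded (range f) \<Longrightarrow>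
               bounded {z. f z \<noteq> 0} \<Longrightarrow> laplace Q f = laplace R f"
  shows "Q = R"
proof -
  interpret Q: prob_space Q by fact
  interpret R: prob_space R by fact
  let ?\<Omega> = "{M :: 'b measure. sets M = sets borel}"
  define \<B> where "\<B> = {A :: 'b set. A \<in> sets borel \<and> bounded A}"
  define C where "C As = {M \<in> ?\<Omega>. \<forall>(A, c)\<in>set As. exp_neg_ext (emeasure M A) \<le> c}"
    for As :: "('b set \<times> real) list"
  define E where "E = C ` lists (\<B> \<times> UNIV)"
  have sp: "space Q = ?\<Omega>" "space R = ?\<Omega>"
    using sets_eq_imp_space_eq[OF Q(2)] sets_eq_imp_space_eq[OF R(2)]
    by (simp_all add: space_meas_algebra)
  have [measurable]: "A \<in> sets borel \<Longrightarrow> (\<lambda>M. emeasure M A) \<in> borel_measurable Q" for A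
    using measurable_emeasure_meas_algebra[of A borel] Q(2) by (simp cong: measurable_cong_sets)
  have C_sets: "C As \<in> sets Q" if "As \<in> lists (\<B> \<times> UNIV)" for As
  proof -
    have "C As = {M \<in> space Q. \<forall>p\<in>set As. exp_neg_ext (emeasure M (fst p)) \<le> snd p}"
      unfolding C_def sp by auto
    also have "\<dots> \<in> sets Q"
    proof (intro sets.sets_Collect_finite_All)
      fix p assume "p \<in> set As"
      then have [measurable]: "fst p \<in> sets borel" using that by (auto simp: \<B>_def)
      show "{M \<in> space Q. exp_neg_ext (emeasure M (fst p)) \<le> snd p} \<in> sets Q" by measurable
    qed simp
    finally show ?thesis .
  qed
  have sigma: "sets (meas_algebra borel) = sigma_sets ?\<Omega> E"
  proof (intro antisym)
    show "sigma_sets ?\<Omega> E \<subseteq> sets (meas_algebra borel)"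
      using sets.sigma_sets_subset[of E Q] C_sets unfolding E_def sp Q(2) by auto
    define S where "S = sigma ?\<Omega> E"
    have E: "E \<subseteq> Pow ?\<Omega>" by (auto simp: E_def C_def)
    have S: "space S = ?\<Omega>" "sets S = sigma_sets ?\<Omega> E"
      unfolding S_def using E by (auto simp: space_measure_of_conv sets_measure_of)
    have bdd: "(\<lambda>M. emeasure M A) \<in> borel_measurable S" if "A \<in> \<B>" for A
    proof -
      have [measurable]: "(\<lambda>M. exp_neg_ext (emeasure M A)) \<in> borel_measurable S"
      proof (subst borel_measurable_iff_le, safe)
        fix c
        have "{M \<in> space S. exp_neg_ext (emeasure M A) \<le> c} = C [(A, c)]"
          by (auto simp: S C_def)
        also have "\<dots> \<in> sets S" using that by (auto simp: S E_def intro!: sigma_sets.Basic)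
        finally show "{M \<in> space S. exp_neg_ext (emeasure M A) \<le> c} \<in> sets S" .
      qed
      show ?thesis by (subst exp_neg_ext_inverse) measurable
    qed
    have "(\<lambda>M. M) \<in> measurable S (meas_algebra borel)"
    proof (rule measurable_meas_algebraI)
      fix A :: "'b set" assume A: "A \<in> sets borel"
      fix a :: 'b
      \<comment> \<open>The generating events involve bounded sets only; an arbitrary Borel set is
        exhausted by its intersections with balls about an arbitrary centre.\<close>
      have "emeasure M A = (SUP r. emeasure M (A \<inter> ball a (real r)))" if "M \<in> space S" for M
      proof -
        have "(SUP r. emeasure M (A \<inter> ball a (real r))) = emeasure M (\<Union>r. A \<inter> ball a (real r))"
          using A that by (intro SUP_emeasure_incseq) (force simp: S incseq_def)+
        also have "(\<Union>r. A \<inter> ball a (real r)) = A"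
          using reals_Archimedean2 by auto
        finally show ?thesis by simp
      qed
      moreover have "(\<lambda>M. SUP r. emeasure M (A \<inter> ball a (real r))) \<in> borel_measurable S"
        using A by (intro borel_measurable_SUP bdd) (auto simp: \<B>_def intro: bounded_subset)
      ultimately show "(\<lambda>M. emeasure M A) \<in> borel_measurable S"
        by (simp cong: measurable_cong)
    qed (simp add: S)
    note id_measurable = this
    show "sets (meas_algebra borel) \<subseteq> sigma_sets ?\<Omega> E"
    proof
      fix X :: "'b measure set" assume X: "X \<in> sets (meas_algebra borel)"
      have "X \<subseteq> ?\<Omega>" using sets.sets_into_space[OF X] by (simp add: space_meas_algebra)
      then have "(\<lambda>M. M) -` X \<inter> space S = X" by (auto simp: S)
      with measurable_sets[OF id_measurable X] show "X \<in> sigma_sets ?\<Omega> E" by (simp add: S)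
    qed
  qed
  show ?thesis
  proof (rule measure_eqI_generator_eq[where E=E and \<Omega>="?\<Omega>" and A="\<lambda>_. ?\<Omega>"])
    show "Int_stable E"
    proof (rule Int_stableI)
      fix L L' assume "L \<in> E" "L' \<in> E"
      then obtain l l' where "L = C l" "L' = C l'" "l @ l' \<in> lists (\<B> \<times> UNIV)"
        by (auto simp: E_def)
      moreover have "C l \<inter> C l' = C (l @ l')"
        unfolding C_def set_append ball_Un by blast
      ultimately show "L \<inter> L' \<in> E" by (auto simp: E_def)
    qed
    show "range (\<lambda>_. ?\<Omega>) \<subseteq> E"
      unfolding E_def by (auto simp: C_def intro!: image_eqI[of _ _ "[]"])
    fix X assume "X \<in> E"
    then obtain As where As: "As \<in> lists (\<B> \<times> UNIV)" "X = C As" by (auto simp: E_def)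
    have ind: "indicator X M = (\<Prod>(A, c)\<leftarrow>As. indicator {..c} (exp_neg_ext (emeasure M A)) :: real)"
      if "sets M = sets borel" for M
    proof -
      have "indicator (C (p # l)) M
          = indicator {..snd p} (exp_neg_ext (emeasure M (fst p))) * (indicator (C l) M :: real)" for p l
        by (simp add: C_def indicator_def that split: prod.split)
      moreover have "indicator (C []) M = (1 :: real)" by (simp add: C_def that)
      ultimately have "indicator (C l) M
          = (\<Prod>(A, c)\<leftarrow>l. indicator {..c} (exp_neg_ext (emeasure M A)) :: real)" for l
        by (induction l) (simp_all add: split_beta)
      then show ?thesis by (simp add: As(2))
    qed
    have meas: "measure P X = (\<integral>M. (\<Prod>(A, c)\<leftarrow>As. indicator {..c} (exp_neg_ext (emeasure M A))) \<partial>P)"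
      if "sets P = sets Q" for P
    proof -
      have "X \<in> sets P" "space P = ?\<Omega>"
        using C_sets[OF As(1)] that sets_eq_imp_space_eq[OF that] by (simp_all add: As(2) sp)
      then have "measure P X = (\<integral>M. indicator X M \<partial>P)"
        using sets.sets_into_space[of X P] by (simp add: Int_absorb2)
      also have "\<dots> = (\<integral>M. (\<Prod>(A, c)\<leftarrow>As. indicator {..c} (exp_neg_ext (emeasure M A))) \<partial>P)"
        using \<open>space P = ?\<Omega>\<close> by (intro Bochner_Integration.integral_cong ind) auto
      finally show ?thesis .
    qed
    have "measure Q X = (\<integral>M. (\<Prod>(A, c)\<leftarrow>As. indicator {..c} (exp_neg_ext (emeasure M A))) \<partial>Q)"
      by (rule meas) simp
    also have "\<dots> = (\<integral>M. (\<Prod>(A, c)\<leftarrow>As. indicator {..c} (exp_neg_ext (emeasure M A))) \<partial>R)"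
      using laplace_eq_imp_joint_eq[OF Q R eq, of As "[]"] As(1) by (fastforce simp: \<B>_def)
    also have "\<dots> = measure R X"
      by (rule meas[symmetric]) (simp add: Q R)
    finally show "emeasure Q X = emeasure R X"
      by (simp add: Q.emeasure_eq_measure R.emeasure_eq_measure)
  qed (use sigma Q R in \<open>auto simp: E_def C_def\<close>)
qed

section \<open>Sums over points and tuples of points\<close>

lemma sum_mset_indicator: "(\<Sum>x\<in>#\<nu>. indicator A x :: ennreal) = of_nat (cnt A \<nu>)"
  by (induction \<nu>) (auto split: split_indicator)

lemma size_eq_cnt_Compl_add: "size \<nu> = cnt (- A) \<nu> + cnt A \<nu>"
  by (induction \<nu>) auto

lemma sum_mset_suminf:
  fixes f :: "nat \<Rightarrow> 'b \<Rightarrow> ennreal"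
  shows "(\<Sum>x\<in>#\<nu>. \<Sum>i. f i x) = (\<Sum>i. \<Sum>x\<in>#\<nu>. f i x)"
  by (induction \<nu>) (auto simp: suminf_add)

lemma sum_mset_SUP:
  fixes f :: "nat \<Rightarrow> 'b \<Rightarrow> ennreal"
  assumes "\<And>x. incseq (\<lambda>i. f i x)"
  shows "(\<Sum>x\<in>#\<nu>. SUP i. f i x) = (SUP i. \<Sum>x\<in>#\<nu>. f i x)"
proof (induction \<nu>)
  case (add y \<nu>)
  have "incseq (\<lambda>i. \<Sum>x\<in>#\<nu>. f i x)"
    using assms by (intro incseq_SucI sum_mset_mono) (auto dest: incseq_SucD)
  with add assms show ?case by (simp add: ennreal_SUP_add)
qed simp

text \<open>No ordering of the points is used: on a rectangle the sum is a count times an indicator,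
  a complement is a difference of finite quantities, and monotone limits pass through the finite
  sum.\<close>

lemma measurable_sum_mset:
  fixes F :: "'b::topological_space \<times> 'p \<Rightarrow> ennreal"
  assumes n [measurable]: "n \<in> measurable P cfg_space" and F: "F \<in> borel_measurable (borel \<Otimes>\<^sub>M P)"
  shows "(\<lambda>p. \<Sum>x\<in>#n p. F (x, p)) \<in> borel_measurable P"
  using F
proof (induction rule: borel_measurable_induct)
  case (cong f g)
  then have "(\<Sum>x\<in>#n p. f (x, p)) = (\<Sum>x\<in>#n p. g (x, p))" if "p \<in> space P" for p
    using that by (auto simp: space_pair_measure)
  with cong show ?case by (simp cong: measurable_cong)
next
  case (set A)
  let ?G = "{a \<times> b | a b. a \<in> sets (borel :: 'b measure) \<and> b \<in> sets P}"
  have "?G \<subseteq> Pow (space borel \<times> space P)"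
    using sets.sets_into_space by fastforce
  from Int_stable_pair_measure_generator this set[unfolded sets_pair_measure] show ?case
  proof (induction rule: sigma_sets_induct_disjoint)
    case (basic A)
    then obtain a b where [measurable]: "a \<in> sets borel" "b \<in> sets P" and A: "A = a \<times> b" by auto
    have "(\<Sum>x\<in>#n p. indicator A (x, p)) = indicator b p * (of_nat (cnt a (n p)) :: ennreal)" for p
      unfolding A indicator_times by (simp add: sum_mset_indicator[symmetric] sum_mset_distrib_left mult.commute)
    then show ?case by simp
  next
    case (compl A)
    have "(\<Sum>x\<in>#n p. indicator (space borel \<times> space P - A) (x, p))
        = of_nat (size (n p)) - (\<Sum>x\<in>#n p. indicator A (x, p) :: ennreal)" if "p \<in> space P" for p
    proof -
      have "(\<Sum>x\<in>#n p. indicator (space borel \<times> space P - A) (x, p))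
          = (\<Sum>x\<in>#n p. indicator (- {x. (x, p) \<in> A}) x :: ennreal)"
        using that by (intro arg_cong[where f=sum_mset] image_mset_cong) (auto split: split_indicator)
      moreover have "(\<Sum>x\<in>#n p. indicator A (x, p) :: ennreal)
          = (\<Sum>x\<in>#n p. indicator {x. (x, p) \<in> A} x)"
        by (intro arg_cong[where f=sum_mset] image_mset_cong) (auto split: split_indicator)
      moreover have "size (n p) = cnt (- {x. (x, p) \<in> A}) (n p) + cnt {x. (x, p) \<in> A} (n p)"
        by (rule size_eq_cnt_Compl_add)
      ultimately show ?thesis by (simp add: sum_mset_indicator)
    qed
    with compl show ?case by (simp cong: measurable_cong)
  next
    case (union A)
    have "(\<Sum>x\<in>#n p. indicator (\<Union>i. A i) (x, p)) = (\<Sum>i. \<Sum>x\<in>#n p. indicator (A i) (x, p) :: ennreal)" for p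
      using union(1) by (simp add: suminf_indicator[symmetric] sum_mset_suminf)
    with union show ?case by simp
  qed simp
next
  case (mult u c)
  then show ?case by (simp add: sum_mset_distrib_left[symmetric])
next
  case (add u v)
  then show ?case by (simp add: sum_mset.distrib)
next
  case (seq U)
  have "incseq (\<lambda>i. U i z)" for z
    using seq(3) by (cases z) (auto simp: incseq_def le_fun_def)
  then have "(\<Sum>x\<in>#n p. (SUP i. U i) (x, p)) = (SUP i. \<Sum>x\<in>#n p. U i (x, p))" for p
    unfolding SUP_apply by (rule sum_mset_SUP)
  with seq show ?case by simp
qed

text \<open>The coordinates are assigned from \<open>k - 1\<close> downwards, on top of a background function \<open>z\<close>:
  this way the parameter of the recursion always lives in the same type.\<close>

primrec tuple_sum :: "nat \<Rightarrow> ((nat \<Rightarrow> 'b) \<Rightarrow> ennreal) \<Rightarrow> (nat \<Rightarrow> 'b) \<Rightarrow> 'b multiset \<Rightarrow> ennreal" where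
  "tuple_sum 0 G z \<nu> = G z"
| "tuple_sum (Suc k) G z \<nu> = (\<Sum>x\<in>#\<nu>. tuple_sum k G (z(k := x)) \<nu>)"

text \<open>The recursion evaluates its function only at tuples that agree with the background from
  index k on, so the comparison may assume this of y.\<close>

lemma tuple_sum_cong:
  assumes "\<And>y. (\<And>i. k \<le> i \<Longrightarrow> y i = z i) \<Longrightarrow> G y = G' y"
  shows "tuple_sum k G z \<nu> = tuple_sum k G' z \<nu>"
  using assms
proof (induction k arbitrary: z)
  case (Suc k)
  have "tuple_sum k G (z(k := x)) \<nu> = tuple_sum k G' (z(k := x)) \<nu>" for x
  proof (rule Suc.IH)
    fix y assume *: "\<And>i. k \<le> i \<Longrightarrow> y i = (z(k := x)) i"
    show "G y = G' y" by (rule Suc.prems) (simp add: *)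
  qed
  then show ?case by simp
qed simp

lemma tuple_sum_0 [simp]: "tuple_sum k (\<lambda>y. 0) z \<nu> = 0"
  by (induction k arbitrary: z) auto

lemma tuple_sum_eq_0:
  assumes "\<And>y. (\<And>i. k \<le> i \<Longrightarrow> y i = z i) \<Longrightarrow> G y = 0"
  shows "tuple_sum k G z \<nu> = 0"
  using tuple_sum_cong[of k z G "\<lambda>_. 0", OF assms] by simp

text \<open>Summands in which a coordinate below k equals x vanish, so the extra occurrence of x
  contributes nothing. After the Mecke formula has split off one point, this removes it from the
  range of the remaining coordinates.\<close>

lemma tuple_sum_add_mset:
  assumes "\<And>y i. (\<And>i. k \<le> i \<Longrightarrow> y i = z i) \<Longrightarrow> i < k \<Longrightarrow> y i = x \<Longrightarrow> G y = 0"
  shows "tuple_sum k G z (add_mset x \<nu>) = tuple_sum k G z \<nu>"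
  using assms
proof (induction k arbitrary: z)
  case (Suc k)
  have "tuple_sum k G (z(k := x)) (add_mset x \<nu>) = 0"
  proof (rule tuple_sum_eq_0)
    fix y assume *: "\<And>i. k \<le> i \<Longrightarrow> y i = (z(k := x)) i"
    show "G y = 0" by (rule Suc.prems[of y k]) (simp_all add: *)
  qed
  moreover have "tuple_sum k G (z(k := w)) (add_mset x \<nu>) = tuple_sum k G (z(k := w)) \<nu>" for w
  proof (rule Suc.IH)
    fix y i assume *: "\<And>i. k \<le> i \<Longrightarrow> y i = (z(k := w)) i" "i < k" "y i = x"
    show "G y = 0" by (rule Suc.prems[of y i]) (simp_all add: * less_SucI)
  qed
  ultimately show ?case by simp
qed simp

lemma tuple_sum_mult:
  "tuple_sum k (\<lambda>y. c * G y) z \<nu> = c * tuple_sum k G z \<nu>"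
  by (induction k arbitrary: z) (auto simp: sum_mset_distrib_left)

text \<open>The background function is part of the measurable argument, so that each coordinate is
  one application of \<open>measurable_sum_mset\<close>, composed with the map that overwrites
  coordinate k.\<close>

lemma measurable_tuple_sum:
  fixes F :: "(nat \<Rightarrow> 'b::topological_space) \<times> 'p \<Rightarrow> ennreal"
  assumes [measurable]: "n \<in> measurable P cfg_space"
    and F [measurable]: "F \<in> borel_measurable (PiM UNIV (\<lambda>_. borel) \<Otimes>\<^sub>M P)"
  shows "(\<lambda>(z, p). tuple_sum k (\<lambda>y. F (y, p)) z (n p)) \<in> borel_measurable (PiM UNIV (\<lambda>_. borel) \<Otimes>\<^sub>M P)"
proof (induction k)
  case 0
  then show ?case using F by simp
next
  case (Suc k)
  let ?R = "PiM UNIV (\<lambda>_::nat. borel :: 'b measure) \<Otimes>\<^sub>M P"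
  have [measurable]: "(\<lambda>w. ((fst (snd w))(k := fst w), snd (snd w))) \<in> measurable (borel \<Otimes>\<^sub>M ?R) ?R"
  proof -
    have "(\<lambda>w. (fst (snd w))(k := fst w)) \<in> measurable (borel \<Otimes>\<^sub>M ?R) (PiM UNIV (\<lambda>_. borel))"
      by (rule measurable_PiM_single') (auto simp: space_PiM)
    then show ?thesis by measurable
  qed
  define H where "H w = tuple_sum k (\<lambda>y. F (y, snd (snd w))) ((fst (snd w))(k := fst w)) (n (snd (snd w)))"
    for w :: "'b \<times> (nat \<Rightarrow> 'b) \<times> 'p"
  have "H \<in> borel_measurable (borel \<Otimes>\<^sub>M ?R)"
    using measurable_compose[OF _ Suc, of "\<lambda>w. ((fst (snd w))(k := fst w), snd (snd w))"]
    by (simp add: H_def[abs_def])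
  then have "(\<lambda>r. \<Sum>x\<in>#n (snd r). H (x, r)) \<in> borel_measurable ?R"
    by (intro measurable_sum_mset) auto
  then show ?case by (simp add: H_def split_beta)
qed

lemma mset_enum_mset: "mset (enum_mset \<nu>) = \<nu>"
  unfolding enum_mset_def by (rule someI_ex) (rule ex_mset)

text \<open>The right side depends on the list only through its multiset, so counts defined by way
  of \<open>enum_mset\<close> do not depend on the enumeration chosen.\<close>

lemma sum_index_tuples_eq_tuple_sum:
  fixes G :: "(nat \<Rightarrow> 'b) \<Rightarrow> ennreal"
  shows "(\<Sum>js\<in>PiE {..<k} (\<lambda>_. {..<length xs}). G (\<lambda>i. if i < k then xs ! js i else z i))
    = tuple_sum k G z (mset xs)"
proof (induction k arbitrary: z)
  case (Suc k)
  have ins: "{..<Suc k} = insert k {..<k}" by auto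
  have "(\<Sum>js\<in>PiE {..<Suc k} (\<lambda>_. {..<length xs}). G (\<lambda>i. if i < Suc k then xs ! js i else z i))
     = (\<Sum>js\<in>(\<lambda>(j, js). js(k := j)) ` ({..<length xs} \<times> PiE {..<k} (\<lambda>_. {..<length xs})).
          G (\<lambda>i. if i < Suc k then xs ! js i else z i))"
    by (simp only: ins PiE_insert_eq)
  also have "\<dots> = (\<Sum>(j, js)\<in>{..<length xs} \<times> PiE {..<k} (\<lambda>_. {..<length xs}).
          G (\<lambda>i. if i < Suc k then xs ! (js(k := j)) i else z i))"
    by (subst sum.reindex[OF inj_combinator]) (simp, intro sum.cong refl, simp only: o_def case_prod_beta)
  also have "\<dots> = (\<Sum>j<length xs. \<Sum>js\<in>PiE {..<k} (\<lambda>_. {..<length xs}).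
          G (\<lambda>i. if i < k then xs ! js i else (z(k := xs ! j)) i))"
    unfolding sum.cartesian_product[symmetric]
    by (intro sum.cong refl arg_cong[where f=G] ext) auto
  also have "\<dots> = (\<Sum>j<length xs. tuple_sum k G (z(k := xs ! j)) (mset xs))"
    by (simp only: Suc.IH)
  also have "\<dots> = (\<Sum>x\<in>#mset xs. tuple_sum k G (z(k := x)) (mset xs))"
    by (simp add: sum_mset_sum_list sum_list_sum_nth atLeast0LessThan del: mset_map flip: mset_map)
  finally show ?case by simp
qed simp

text \<open>The background \<open>undefined\<close> is the value that extensional functions take
  outside their domain, so the recursion visits exactly the tuples tested by
  \<open>cfg_pow\<close>.\<close>

lemma cfg_pow_eq_tuple_sum:
  "of_nat (cfg_pow k \<nu> B) = tuple_sum k (indicator B) (\<lambda>_. undefined) \<nu>"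
proof -
  let ?xs = "enum_mset \<nu>"
  let ?S = "PiE {..<k} (\<lambda>_. {..<length ?xs})"
  have "of_nat (cfg_pow k \<nu> B)
     = (\<Sum>js\<in>?S. indicator B (\<lambda>i\<in>{..<k}. ?xs ! js i) :: ennreal)"
  proof -
    have "(\<Sum>js\<in>?S. indicator B (\<lambda>i\<in>{..<k}. ?xs ! js i) :: ennreal)
        = (\<Sum>js\<in>?S. if (\<lambda>i\<in>{..<k}. ?xs ! js i) \<in> B then 1 else 0)"
      by (simp add: indicator_def of_bool_def)
    also have "\<dots> = (\<Sum>js\<in>{js \<in> ?S. (\<lambda>i\<in>{..<k}. ?xs ! js i) \<in> B}. 1)"
      by (rule sum.inter_filter[symmetric]) (simp add: finite_PiE)
    finally show ?thesis by (simp add: cfg_pow_def Let_def)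
  qed
  also have "\<dots> = (\<Sum>js\<in>?S. indicator B (\<lambda>i. if i < k then ?xs ! js i else undefined))"
    by (simp add: restrict_def)
  also have "\<dots> = tuple_sum k (indicator B) (\<lambda>_. undefined) \<nu>"
    using sum_index_tuples_eq_tuple_sum[where k=k and xs="?xs" and G="indicator B" and z="\<lambda>_. undefined"]
    by (simp add: mset_enum_mset)
  finally show ?thesis .
qed

section \<open>The Mecke formula\<close>

text \<open>The finite-dimensional laws of a Poisson process are given for disjoint sets only. The
  sets in the list and A are therefore cut into the atoms of the finite Boolean algebra they
  generate, where all counts can be prescribed.\<close>

lemma cylinder_refinement:
  fixes A :: "'b::topological_space set"
  assumes l: "l \<in> lists (sets borel \<times> UNIV)" and A: "A \<in> sets borel"
  obtains m :: nat and D :: "nat \<Rightarrow> 'b set" and C :: "(nat \<Rightarrow> nat) set" and J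
  where "\<And>j. j < m \<Longrightarrow> D j \<in> sets borel" "disjoint_family_on D {..<m}"
    "countable C" "C \<subseteq> PiE {..<m} (\<lambda>_. UNIV)"
    "cylinder l = (\<Union>c\<in>C. {\<nu>. \<forall>j<m. cnt (D j) \<nu> = c j})"
    "J \<subseteq> {..<m}" "A = (\<Union>j\<in>J. D j)"
proof -
  define \<F> where "\<F> = insert A (fst ` set l)"
  have fin: "finite \<F>" by (simp add: \<F>_def)
  have borel: "B \<in> sets borel" if "B \<in> \<F>" for B
    using l A that by (auto simp: \<F>_def)
  obtain h where h: "bij_betw h {0..<card (Pow \<F>)} (Pow \<F>)"
    using ex_bij_betw_nat_finite[of "Pow \<F>"] fin by auto
  define m where "m = card (Pow \<F>)"
  define D where "D j = {x. \<forall>B\<in>\<F>. x \<in> B \<longleftrightarrow> B \<in> h j}" for j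
  define J where "J B = {j. j < m \<and> B \<in> h j}" for B
  have hm: "h j \<in> Pow \<F>" if "j < m" for j
    using h that by (auto simp: m_def bij_betw_def)
  have D_borel: "D j \<in> sets borel" for j
  proof -
    have "D j = {x \<in> space borel. \<forall>B\<in>\<F>. x \<in> B \<longleftrightarrow> B \<in> h j}" by (simp add: D_def)
    also have "\<dots> \<in> sets borel"
    proof (intro sets.sets_Collect_finite_All fin)
      fix B assume "B \<in> \<F>"
      note borel[OF this, measurable]
      show "{x \<in> space borel. (x \<in> B) = (B \<in> h j)} \<in> sets borel" by measurable
    qed
    finally show ?thesis .
  qed
  have disj: "disjoint_family_on D {..<m}"
  proof (unfold disjoint_family_on_def, safe)
    fix i j x assume ij: "i < m" "j < m" "i \<noteq> j" and "x \<in> D i" "x \<in> D j"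
    then have "h i = h j" using hm[of i] hm[of j] by (auto simp: D_def)
    with ij show "x \<in> {}" using h by (auto simp: bij_betw_def inj_on_def m_def)
  qed
  have union: "B = (\<Union>j\<in>J B. D j)" if B: "B \<in> \<F>" for B
  proof safe
    fix x assume "x \<in> B"
    define S where "S = {B'\<in>\<F>. x \<in> B'}"
    have "S \<in> h ` {0..<m}" using h by (auto simp: bij_betw_def S_def m_def)
    then obtain j where "j < m" "h j = S" by auto
    with \<open>x \<in> B\<close> B show "x \<in> (\<Union>j\<in>J B. D j)" by (auto simp: J_def D_def S_def)
  qed (use B in \<open>auto simp: J_def D_def\<close>)
  have cnt: "cnt B \<nu> = (\<Sum>j\<in>J B. cnt (D j) \<nu>)" if B: "B \<in> \<F>" for B \<nu>
  proof -
    have "cnt B \<nu> = cnt (\<Union>j\<in>J B. D j) \<nu>" using union[OF B] by simp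
    also have "\<dots> = (\<Sum>j\<in>J B. cnt (D j) \<nu>)"
      using disj by (intro cnt_disjoint_UN) (auto simp: J_def disjoint_family_on_def)
    finally show ?thesis .
  qed
  \<comment> \<open>The count vectors on the atoms that meet the constraints. Extensionality outside
    {..<m} keeps this set countable and makes distinct vectors give disjoint events.\<close>
  define C where "C = {c \<in> PiE {..<m} (\<lambda>_. UNIV). \<forall>(B, n)\<in>set l. (\<Sum>j\<in>J B. c j) = n}"
  have "cylinder l = (\<Union>c\<in>C. {\<nu>. \<forall>j<m. cnt (D j) \<nu> = c j})"
  proof (intro set_eqI iffI)
    fix \<nu> assume \<nu>: "\<nu> \<in> cylinder l"
    define c where "c = restrict (\<lambda>j. cnt (D j) \<nu>) {..<m}"
    have "(\<Sum>j\<in>J B. c j) = n" if "(B, n) \<in> set l" for B n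
    proof -
      have "B \<in> \<F>" using that by (force simp: \<F>_def)
      have "(\<Sum>j\<in>J B. c j) = (\<Sum>j\<in>J B. cnt (D j) \<nu>)"
        by (intro sum.cong) (auto simp: c_def J_def)
      with \<nu> that cnt[OF \<open>B \<in> \<F>\<close>] show ?thesis by (auto simp: cylinder_def)
    qed
    then have "c \<in> C" by (auto simp: C_def c_def)
    then show "\<nu> \<in> (\<Union>c\<in>C. {\<nu>. \<forall>j<m. cnt (D j) \<nu> = c j})"
      by (intro UN_I[of c]) (auto simp: c_def)
  next
    fix \<nu> assume "\<nu> \<in> (\<Union>c\<in>C. {\<nu>. \<forall>j<m. cnt (D j) \<nu> = c j})"
    then obtain c where c: "c \<in> C" "\<And>j. j < m \<Longrightarrow> cnt (D j) \<nu> = c j" by auto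
    have "cnt B \<nu> = n" if "(B, n) \<in> set l" for B n
    proof -
      have "B \<in> \<F>" using that by (force simp: \<F>_def)
      have "(\<Sum>j\<in>J B. cnt (D j) \<nu>) = (\<Sum>j\<in>J B. c j)"
        by (intro sum.cong) (auto simp: c J_def)
      with c(1) that cnt[OF \<open>B \<in> \<F>\<close>] show ?thesis by (auto simp: C_def)
    qed
    then show "\<nu> \<in> cylinder l" by (auto simp: cylinder_def)
  qed
  moreover have "countable C"
    by (rule countable_subset[of _ "PiE {..<m} (\<lambda>_. UNIV)"]) (auto simp: C_def intro!: countable_PiE)
  moreover have "A = (\<Union>j\<in>J A. D j)" by (rule union) (simp add: \<F>_def)
  ultimately show ?thesis
    using D_borel disj by (intro that[of m D C "J A"]) (auto simp: C_def J_def)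
qed

lemma sets_cnt_eq:
  fixes m :: nat
  assumes "\<And>i. i < m \<Longrightarrow> D i \<in> sets borel"
  shows "{\<nu>. \<forall>i<m. cnt (D i) \<nu> = c i} \<in> sets cfg_space"
proof -
  have "{\<nu>. \<forall>i<m. cnt (D i) \<nu> = c i} = {\<nu> \<in> space cfg_space. \<forall>i\<in>{..<m}. cnt (D i) \<nu> = c i}"
    by auto
  also have "\<dots> \<in> sets cfg_space"
  proof (intro sets.sets_Collect_finite_All)
    fix i assume "i \<in> {..<m}"
    then have [measurable]: "D i \<in> sets borel" using assms by simp
    show "{\<nu> \<in> space cfg_space. cnt (D i) \<nu> = c i} \<in> sets cfg_space" by measurable
  qed simp
  finally show ?thesis .
qed

lemma measurable_fun_upd_UNIV [measurable (raw)]: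
  assumes [measurable]: "f \<in> measurable M (PiM UNIV (\<lambda>_. borel))" "g \<in> measurable M borel"
  shows "(\<lambda>w. (f w)(k := g w)) \<in> measurable M (PiM UNIV (\<lambda>_. borel :: 'b::topological_space measure))"
  by (rule measurable_PiM_single') (auto simp: space_PiM)

lemma measurable_tup_mset [measurable (raw)]:
  assumes [measurable]: "\<And>i. i < k \<Longrightarrow> (\<lambda>w. f w i) \<in> measurable M borel"
  shows "(\<lambda>w. tup_mset k (f w)) \<in> measurable M cfg_space"
  using assms
proof (induction k)
  case (Suc k)
  then have [measurable]: "(\<lambda>w. tup_mset k (f w)) \<in> measurable M cfg_space" by simp
  have [measurable]: "(\<lambda>w. f w k) \<in> measurable M borel" using Suc by simp
  have "(\<lambda>w. add_mset (f w k) (tup_mset k (f w))) \<in> measurable M cfg_space" by measurable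
  then show ?case by (simp add: tup_mset_def)
qed (simp add: tup_mset_def)

locale poisson_process =
  fixes \<omega> :: "'a::polish_space measure" and PN :: "'a multiset measure"
  assumes finite_\<omega>: "finite_measure \<omega>" and sets_\<omega> [measurable_cong]: "sets \<omega> = sets borel"
    and poisson: "poisson_pp \<omega> PN"
begin

sublocale \<omega>: finite_measure \<omega> by (rule finite_\<omega>)

sublocale PN: prob_space PN using poisson by (simp add: poisson_pp_def)

lemma sets_PN [measurable_cong]: "sets PN = sets cfg_space"
  using poisson by (simp add: poisson_pp_def)

lemma space_PN [simp]: "space PN = UNIV"
  using sets_eq_imp_space_eq[OF sets_PN] by simp

lemma space_\<omega> [simp]: "space \<omega> = UNIV"
  using sets_eq_imp_space_eq[OF sets_\<omega>] by simp

lemma emeasure_PN_cnt: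
  fixes m :: nat
  assumes "\<And>i. i < m \<Longrightarrow> D i \<in> sets borel" "disjoint_family_on D {..<m}"
  shows "emeasure PN {\<nu>. \<forall>i<m. cnt (D i) \<nu> = c i}
    = ennreal (\<Prod>i<m. measure \<omega> (D i) ^ c i / fact (c i) * exp (- measure \<omega> (D i)))"
proof -
  note fdd = poisson[unfolded poisson_pp_def, THEN conjunct2, THEN conjunct2, rule_format, of m D c]
  have "measure PN {\<nu> \<in> space PN. \<forall>i<m. cnt (D i) \<nu> = c i}
      = (\<Prod>i<m. measure \<omega> (D i) ^ c i / fact (c i) * exp (- measure \<omega> (D i)))"
    using assms by (intro fdd) simp
  then show ?thesis by (simp add: PN.emeasure_eq_measure)
qed

text \<open>For Poisson weights p with mean a this is the recursion Suc n * p (Suc n) = a * p n; the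
  product form of the joint law over disjoint sets carries it to a vector of counts.\<close>

lemma mecke_atom:
  fixes m :: nat
  assumes D: "\<And>i. i < m \<Longrightarrow> D i \<in> sets borel" "disjoint_family_on D {..<m}" and j: "j < m"
  shows "of_nat (c j) * emeasure PN {\<nu>. \<forall>i<m. cnt (D i) \<nu> = c i}
    = (\<integral>\<^sup>+x. indicator (D j) x * (\<integral>\<^sup>+\<nu>. indicator {\<nu>. \<forall>i<m. cnt (D i) \<nu> = c i} (add_mset x \<nu>) \<partial>PN) \<partial>\<omega>)"
proof -
  let ?E = "\<lambda>c. {\<nu>. \<forall>i<m. cnt (D i) \<nu> = c i}"
  have E: "?E c \<in> sets PN" for c
    using sets_cnt_eq[OF D(1)] by (simp add: sets_PN)
  have Dj: "i < m \<Longrightarrow> x \<in> D j \<Longrightarrow> x \<in> D i \<longleftrightarrow> i = j" for i x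
    using D(2) j by (auto simp: disjoint_family_on_def)
  show ?thesis
  proof (cases "c j")
    \<comment> \<open>Both sides vanish: after a point of D j has been added, the count of D j is
      positive.\<close>
    case 0
    have "indicator (D j) x * (\<integral>\<^sup>+\<nu>. indicator (?E c) (add_mset x \<nu>) \<partial>PN) = 0" for x
    proof (cases "x \<in> D j")
      case True
      then have "add_mset x \<nu> \<notin> ?E c" for \<nu> using j 0 by auto
      then show ?thesis by simp
    qed simp
    then show ?thesis by (simp only: 0) simp
  next
    case (Suc n)
    \<comment> \<open>By disjointness, an added point of D j raises the j-th count and no
      other.\<close>
    define c' where "c' = c(j := n)"
    have shift: "add_mset x \<nu> \<in> ?E c \<longleftrightarrow> \<nu> \<in> ?E c'" if "x \<in> D j" for x \<nu>
      using Dj[OF _ that] Suc j by (auto simp: c'_def)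
    have "(\<integral>\<^sup>+x. indicator (D j) x * (\<integral>\<^sup>+\<nu>. indicator (?E c) (add_mset x \<nu>) \<partial>PN) \<partial>\<omega>)
        = (\<integral>\<^sup>+x. indicator (D j) x * emeasure PN (?E c') \<partial>\<omega>)"
    proof (intro nn_integral_cong)
      fix x
      show "indicator (D j) x * (\<integral>\<^sup>+\<nu>. indicator (?E c) (add_mset x \<nu>) \<partial>PN)
          = indicator (D j) x * emeasure PN (?E c')"
      proof (cases "x \<in> D j")
        case True
        then have "(\<integral>\<^sup>+\<nu>. indicator (?E c) (add_mset x \<nu>) \<partial>PN) = (\<integral>\<^sup>+\<nu>. indicator (?E c') \<nu> \<partial>PN)"
          by (intro nn_integral_cong) (simp only: indicator_def shift)
        then show ?thesis using E[of c'] by (simp del: mem_Collect_eq)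
      qed simp
    qed
    also have "\<dots> = emeasure \<omega> (D j) * emeasure PN (?E c')"
      using D(1)[OF j] by (simp add: nn_integral_multc sets_\<omega>)
    also have "\<dots> = ennreal (measure \<omega> (D j)) *
        ennreal (\<Prod>i<m. measure \<omega> (D i) ^ c' i / fact (c' i) * exp (- measure \<omega> (D i)))"
      by (simp add: emeasure_PN_cnt[OF D] \<omega>.emeasure_eq_measure)
    also have "\<dots> = ennreal (measure \<omega> (D j) *
        (\<Prod>i<m. measure \<omega> (D i) ^ c' i / fact (c' i) * exp (- measure \<omega> (D i))))"
      by (simp add: ennreal_mult' )
    also have "measure \<omega> (D j) * (\<Prod>i<m. measure \<omega> (D i) ^ c' i / fact (c' i) * exp (- measure \<omega> (D i)))
        = real (c j) * (\<Prod>i<m. measure \<omega> (D i) ^ c i / fact (c i) * exp (- measure \<omega> (D i)))"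
    proof -
      let ?a = "\<lambda>n i. measure \<omega> (D i) ^ n / fact n * exp (- measure \<omega> (D i))"
      have c'j: "c' j = n" by (simp add: c'_def)
      have rest: "(\<Prod>i\<in>{..<m} - {j}. ?a (c' i) i) = (\<Prod>i\<in>{..<m} - {j}. ?a (c i) i)"
        by (intro prod.cong) (auto simp: c'_def)
      have "measure \<omega> (D j) * ?a n j = real (Suc n) * ?a (Suc n) j"
        by (simp add: fact_Suc del: of_nat_Suc)
      moreover have "(\<Prod>i<m. ?a (c' i) i) = ?a n j * (\<Prod>i\<in>{..<m} - {j}. ?a (c i) i)"
        using j by (subst prod.remove[of _ j]) (simp_all only: rest finite_lessThan lessThan_iff c'j)
      moreover have "(\<Prod>i<m. ?a (c i) i) = ?a (Suc n) j * (\<Prod>i\<in>{..<m} - {j}. ?a (c i) i)"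
        using j by (subst prod.remove[of _ j]) (simp_all only: Suc finite_lessThan lessThan_iff)
      ultimately show ?thesis by (simp only: Suc mult.assoc[symmetric])
    qed
    also have "ennreal \<dots> = of_nat (c j) * emeasure PN (?E c)"
      by (simp add: emeasure_PN_cnt[OF D] ennreal_mult' ennreal_of_nat_eq_real_of_nat)
    finally show ?thesis by simp
  qed
qed

text \<open>Both sides are measures in L, the right one of finite total mass emeasure \<omega> A, so
  comparing them on cylinders is enough. A cylinder splits into events that fix all atom counts, A
  is a union of atoms, and \<open>mecke_atom\<close> is summed over these.\<close>

lemma mecke_rectangle:
  assumes A [measurable]: "A \<in> sets borel" and L: "L \<in> sets cfg_space"
  shows "(\<integral>\<^sup>+\<nu>. of_nat (cnt A \<nu>) * indicator L \<nu> \<partial>PN)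
    = (\<integral>\<^sup>+x. indicator A x * (\<integral>\<^sup>+\<nu>. indicator L (add_mset x \<nu>) \<partial>PN) \<partial>\<omega>)"
proof -
  define \<mu> where "\<mu> = density PN (\<lambda>\<nu>. of_nat (cnt A \<nu>))"
  define \<kappa> where "\<kappa> = distr (density \<omega> (indicator A) \<Otimes>\<^sub>M PN) cfg_space (\<lambda>(x, \<nu>). add_mset x \<nu>)"
  have \<mu>: "emeasure \<mu> X = (\<integral>\<^sup>+\<nu>. of_nat (cnt A \<nu>) * indicator X \<nu> \<partial>PN)" if "X \<in> sets cfg_space" for X
    unfolding \<mu>_def using that by (subst emeasure_density) (auto simp: sets_PN)
  have \<kappa>: "emeasure \<kappa> X = (\<integral>\<^sup>+x. indicator A x * (\<integral>\<^sup>+\<nu>. indicator X (add_mset x \<nu>) \<partial>PN) \<partial>\<omega>)"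
    if [measurable]: "X \<in> sets cfg_space" for X
  proof -
    have "emeasure \<kappa> X = (\<integral>\<^sup>+w. indicator X w \<partial>\<kappa>)" unfolding \<kappa>_def by simp
    also have "\<dots> = (\<integral>\<^sup>+w. indicator X (case w of (x, \<nu>) \<Rightarrow> add_mset x \<nu>) \<partial>(density \<omega> (indicator A) \<Otimes>\<^sub>M PN))"
      unfolding \<kappa>_def by (rule nn_integral_distr) measurable
    also have "\<dots> = (\<integral>\<^sup>+x. \<integral>\<^sup>+\<nu>. indicator X (add_mset x \<nu>) \<partial>PN \<partial>density \<omega> (indicator A))"
      by (subst PN.nn_integral_fst[symmetric]) auto
    also have "\<dots> = (\<integral>\<^sup>+x. indicator A x * (\<integral>\<^sup>+\<nu>. indicator X (add_mset x \<nu>) \<partial>PN) \<partial>\<omega>)"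
      by (rule nn_integral_density) measurable
    finally show ?thesis .
  qed
  have sets: "sets \<kappa> = sets cfg_space" "sets \<mu> = sets cfg_space"
    by (simp_all add: \<kappa>_def \<mu>_def sets_PN)
  have cyl: "emeasure \<kappa> X = emeasure \<mu> X" if "X \<in> cylinders (sets borel)" for X
  proof -
    obtain l where l: "l \<in> lists (sets borel \<times> UNIV)" "X = cylinder l"
      using \<open>X \<in> cylinders (sets borel)\<close> by (auto simp: cylinders_def)
    obtain m :: nat and D and C :: "(nat \<Rightarrow> nat) set" and J where D: "\<And>j. j < m \<Longrightarrow> D j \<in> sets borel" "disjoint_family_on D {..<m}"
      and C: "countable C" "C \<subseteq> PiE {..<m} (\<lambda>_. UNIV)"
      and X: "cylinder l = (\<Union>c\<in>C. {\<nu>. \<forall>j<m. cnt (D j) \<nu> = c j})"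
      and J: "J \<subseteq> {..<m}" "A = (\<Union>j\<in>J. D j)"
      by (rule cylinder_refinement[OF l(1) A]) (rule that; assumption)
    define E where "E c = {\<nu>. \<forall>j<m. cnt (D j) \<nu> = c j}" for c
    note X = X[folded E_def]
    have E_sets: "E c \<in> sets cfg_space" for c
      unfolding E_def by (rule sets_cnt_eq[OF D(1)])
    have "finite J" using J(1) by (rule finite_subset) simp
    have disjJ: "disjoint_family_on D J" using D(2) J(1) by (auto simp: disjoint_family_on_def)
    have atom: "emeasure \<kappa> (E c) = emeasure \<mu> (E c)" for c
    proof -
      note E_sets[of c, measurable]
      have "emeasure \<kappa> (E c) = (\<integral>\<^sup>+x. (\<Sum>j\<in>J. indicator (D j) x *
              (\<integral>\<^sup>+\<nu>. indicator (E c) (add_mset x \<nu>) \<partial>PN)) \<partial>\<omega>)"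
        unfolding \<kappa>[OF E_sets] sum_distrib_right[symmetric] J(2)
        by (simp only: indicator_UN_disjoint[OF \<open>finite J\<close> disjJ])
      also have "\<dots> = (\<Sum>j\<in>J. \<integral>\<^sup>+x. indicator (D j) x *
              (\<integral>\<^sup>+\<nu>. indicator (E c) (add_mset x \<nu>) \<partial>PN) \<partial>\<omega>)"
      proof (rule nn_integral_sum)
        fix j assume "j \<in> J"
        then have [measurable]: "D j \<in> sets borel" using D J by auto
        show "(\<lambda>x. indicator (D j) x * (\<integral>\<^sup>+\<nu>. indicator (E c) (add_mset x \<nu>) \<partial>PN)) \<in> borel_measurable \<omega>"
          by measurable
      qed
      also have "\<dots> = (\<Sum>j\<in>J. of_nat (c j) * emeasure PN (E c))"
        unfolding E_def using J(1) by (intro sum.cong mecke_atom[OF D, symmetric]) auto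
      also have "\<dots> = (\<integral>\<^sup>+\<nu>. of_nat (\<Sum>j\<in>J. c j) * indicator (E c) \<nu> \<partial>PN)"
        by (subst nn_integral_cmult_indicator) (auto simp: sum_distrib_right E_sets sets_PN)
      also have "\<dots> = (\<integral>\<^sup>+\<nu>. of_nat (cnt A \<nu>) * indicator (E c) \<nu> \<partial>PN)"
      proof (intro nn_integral_cong)
        fix \<nu>
        have "cnt A \<nu> = (\<Sum>j\<in>J. cnt (D j) \<nu>)"
          unfolding J(2) by (rule cnt_disjoint_UN[OF \<open>finite J\<close> disjJ])
        moreover have "(\<Sum>j\<in>J. cnt (D j) \<nu>) = (\<Sum>j\<in>J. c j)" if "\<nu> \<in> E c"
          using that J(1) by (intro sum.cong) (auto simp: E_def)
        ultimately show "of_nat (\<Sum>j\<in>J. c j) * indicator (E c) \<nu>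
            = (of_nat (cnt A \<nu>) * indicator (E c) \<nu> :: ennreal)"
          by (cases "\<nu> \<in> E c") (simp_all del: of_nat_sum)
      qed
      finally show ?thesis unfolding \<mu>[OF E_sets] .
    qed
    have disj: "disjoint_family_on E C"
      unfolding disjoint_family_on_def
    proof safe
      fix c c' \<nu> assume "c \<in> C" "c' \<in> C" "c \<noteq> c'"
        and "\<nu> \<in> E c" "\<nu> \<in> E c'"
      then have "c = c'" using C(2) by (intro PiE_ext[of c "{..<m}" "\<lambda>_. UNIV" c']) (auto simp: E_def)
      with \<open>c \<noteq> c'\<close> show "\<nu> \<in> {}" by simp
    qed
    have "emeasure \<kappa> X = (\<integral>\<^sup>+c. emeasure \<kappa> (E c) \<partial>count_space C)"
      unfolding l(2) X using C disj E_sets by (intro emeasure_UN_countable) (auto simp: sets)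
    also have "\<dots> = (\<integral>\<^sup>+c. emeasure \<mu> (E c) \<partial>count_space C)" by (simp add: atom)
    also have "\<dots> = emeasure \<mu> X"
      unfolding l(2) X using C disj E_sets by (intro emeasure_UN_countable[symmetric]) (auto simp: sets)
    finally show ?thesis .
  qed
  have sigma: "sets (cfg_space :: 'a multiset measure) = sigma_sets UNIV (cylinders (sets borel))"
    by (rule sets_cfg_space_eq_cylinders)
       (auto simp: Int_stable_def sets.sigma_sets_eq[where M="borel :: 'a measure", simplified])
  have "\<kappa> = \<mu>"
  proof (rule measure_eqI_generator_eq[where E="cylinders (sets borel)" and \<Omega>=UNIV and A="\<lambda>_. UNIV"])
    have "emeasure \<kappa> UNIV = emeasure \<omega> A"
      by (subst \<kappa>) (auto simp: PN.emeasure_space_1[simplified] sets_\<omega> sets.top[of cfg_space, simplified])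
    then show "emeasure \<kappa> UNIV \<noteq> \<infinity>" by simp
  qed (auto simp: cyl Int_stable_cylinders UNIV_in_cylinders sets sigma[symmetric])
  then show ?thesis using \<kappa>[OF L] \<mu>[OF L] by simp
qed

lemma measurable_sum_mset_self:
  fixes F :: "'a \<times> 'a multiset \<Rightarrow> ennreal"
  assumes "F \<in> borel_measurable (borel \<Otimes>\<^sub>M cfg_space)"
  shows "(\<lambda>\<nu>. \<Sum>x\<in>#\<nu>. F (x, \<nu>)) \<in> borel_measurable PN"
  using measurable_sum_mset[OF measurable_ident assms]
  by (simp cong: measurable_cong_sets add: sets_PN)

theorem mecke:
  fixes F :: "'a \<times> 'a multiset \<Rightarrow> ennreal"
  assumes "F \<in> borel_measurable (borel \<Otimes>\<^sub>M cfg_space)"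
  shows "(\<integral>\<^sup>+\<nu>. (\<Sum>x\<in>#\<nu>. F (x, \<nu>)) \<partial>PN) = (\<integral>\<^sup>+x. \<integral>\<^sup>+\<nu>. F (x, add_mset x \<nu>) \<partial>PN \<partial>\<omega>)"
  using assms
proof (induction rule: borel_measurable_induct)
  case (cong f g)
  then have "f = g" by (auto simp: space_pair_measure)
  with cong show ?case by simp
next
  case (set X)
  let ?G = "{a \<times> b | a b. a \<in> sets (borel :: 'a measure) \<and> b \<in> sets (cfg_space :: 'a multiset measure)}"
  let ?\<Omega> = "space (borel :: 'a measure) \<times> space (cfg_space :: 'a multiset measure)"
  let ?I = "\<lambda>X. \<integral>\<^sup>+\<nu>. (\<Sum>x\<in>#\<nu>. indicator X (x, \<nu>)) \<partial>PN"
  let ?J = "\<lambda>X. \<integral>\<^sup>+x. \<integral>\<^sup>+\<nu>. indicator X (x, add_mset x \<nu>) \<partial>PN \<partial>\<omega>"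
  have rect: "?I (a \<times> L) = ?J (a \<times> L)" if "a \<in> sets borel" "L \<in> sets cfg_space" for a L
  proof -
    note that [measurable]
    have "?I (a \<times> L) = (\<integral>\<^sup>+\<nu>. of_nat (cnt a \<nu>) * indicator L \<nu> \<partial>PN)"
      by (intro nn_integral_cong) (simp add: indicator_times sum_mset_distrib_right[symmetric] sum_mset_indicator)
    also have "\<dots> = (\<integral>\<^sup>+x. indicator a x * (\<integral>\<^sup>+\<nu>. indicator L (add_mset x \<nu>) \<partial>PN) \<partial>\<omega>)"
      by (rule mecke_rectangle[OF that])
    also have "\<dots> = ?J (a \<times> L)"
      by (intro nn_integral_cong) (simp add: indicator_times nn_integral_cmult)
    finally show ?thesis .
  qed
  have "?G \<subseteq> Pow ?\<Omega>" by auto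
  from Int_stable_pair_measure_generator this set[unfolded sets_pair_measure] show ?case
  proof (induction rule: sigma_sets_induct_disjoint)
    case (basic X)
    then show ?case using rect by auto
  next
    case (compl X)
    have X: "X \<in> sets (borel \<Otimes>\<^sub>M cfg_space)" using compl(1) by (simp add: sets_pair_measure)
    have X': "?\<Omega> - X \<in> sets (borel \<Otimes>\<^sub>M cfg_space)"
      using sets.compl_sets[OF X] by (simp add: space_pair_measure)
    note X [measurable] X' [measurable]
    have split: "indicator ?\<Omega> w = (indicator (?\<Omega> - X) w + indicator X w :: ennreal)" for w
      by (auto split: split_indicator)
    have I: "?I ?\<Omega> = ?I (?\<Omega> - X) + ?I X"
      unfolding split sum_mset.distrib
      by (intro nn_integral_add measurable_sum_mset_self borel_measurable_indicator X X')
    have J: "?J ?\<Omega> = ?J (?\<Omega> - X) + ?J X"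
      unfolding split by (simp add: nn_integral_add)
    \<comment> \<open>Complements are handled by cancellation, which is legitimate because the whole
      space contributes the finite total mass of \<omega>.\<close>
    have fin: "?J ?\<Omega> < \<infinity>"
      using PN.emeasure_space_1 by (simp add: less_top[symmetric])
    have "?I ?\<Omega> = ?J ?\<Omega>" using rect[of UNIV UNIV] sets.top[of cfg_space] by simp
    then have "?J X + ?I (?\<Omega> - X) = ?J X + ?J (?\<Omega> - X)"
      using I J compl(2) by (simp add: ac_simps)
    moreover have "?J X \<noteq> \<infinity>" using fin J by (auto simp: top_unique)
    ultimately show ?case by (simp add: ennreal_add_left_cancel)
  next
    case (union X)
    have [measurable]: "X i \<in> sets (borel \<Otimes>\<^sub>M cfg_space)" for i
      using union(2) by (auto simp: sets_pair_measure)
    have ind: "indicator (\<Union>i. X i) w = (\<Sum>i. indicator (X i) w :: ennreal)" for w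
      using suminf_indicator[OF union(1)] by simp
    show ?case
      unfolding ind sum_mset_suminf
      by (simp add: nn_integral_suminf measurable_sum_mset_self union(3))
  qed simp
next
  case (mult u c)
  note mult(2)[measurable]
  show ?case
    by (simp add: sum_mset_distrib_left[symmetric] nn_integral_cmult measurable_sum_mset_self mult)
next
  case (add u v)
  note add(1,3)[measurable]
  show ?case
    by (simp add: sum_mset.distrib nn_integral_add measurable_sum_mset_self add)
next
  case (seq U)
  note seq(1)[measurable]
  have inc: "incseq (\<lambda>i. U i w)" for w
    using seq(3) by (cases w) (auto simp: incseq_def le_fun_def)
  have incs: "incseq (\<lambda>i \<nu>. \<Sum>x\<in>#\<nu>. U i (x, \<nu>))"
    using inc by (intro incseq_SucI le_funI sum_mset_mono) (auto dest: incseq_SucD)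
  have "(\<integral>\<^sup>+\<nu>. (\<Sum>x\<in>#\<nu>. (SUP i. U i) (x, \<nu>)) \<partial>PN) = (\<integral>\<^sup>+\<nu>. (SUP i. \<Sum>x\<in>#\<nu>. U i (x, \<nu>)) \<partial>PN)"
    unfolding SUP_apply by (simp add: sum_mset_SUP inc)
  also have "\<dots> = (SUP i. \<integral>\<^sup>+\<nu>. (\<Sum>x\<in>#\<nu>. U i (x, \<nu>)) \<partial>PN)"
    by (rule nn_integral_monotone_convergence_SUP[OF incs]) (simp add: measurable_sum_mset_self)
  also have "\<dots> = (SUP i. \<integral>\<^sup>+x. \<integral>\<^sup>+\<nu>. U i (x, add_mset x \<nu>) \<partial>PN \<partial>\<omega>)" by (simp add: seq)
  also have "\<dots> = (\<integral>\<^sup>+x. (SUP i. \<integral>\<^sup>+\<nu>. U i (x, add_mset x \<nu>) \<partial>PN) \<partial>\<omega>)"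
    using inc by (intro nn_integral_monotone_convergence_SUP[symmetric] incseq_SucI le_funI nn_integral_mono)
      (auto dest: incseq_SucD)
  also have "\<dots> = (\<integral>\<^sup>+x. \<integral>\<^sup>+\<nu>. (SUP i. U i (x, add_mset x \<nu>)) \<partial>PN \<partial>\<omega>)"
    using inc by (intro nn_integral_cong nn_integral_monotone_convergence_SUP[symmetric] incseq_SucI le_funI)
      (auto dest: incseq_SucD)
  finally show ?case by (simp add: SUP_apply image_comp)
qed

sublocale prod_\<omega>: product_sigma_finite "\<lambda>_::nat. \<omega>"
  by unfold_locales

theorem mecke_tuple:
  fixes F :: "(nat \<Rightarrow> 'a) \<times> 'a multiset \<Rightarrow> ennreal"
  assumes "F \<in> borel_measurable (PiM UNIV (\<lambda>_. borel) \<Otimes>\<^sub>M cfg_space)"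
    and "\<And>y \<nu>. (\<And>i. k \<le> i \<Longrightarrow> y i = z i) \<Longrightarrow> \<not> inj_on y {..<k} \<Longrightarrow> F (y, \<nu>) = 0"
  shows "(\<integral>\<^sup>+\<nu>. tuple_sum k (\<lambda>y. F (y, \<nu>)) z \<nu> \<partial>PN)
    = (\<integral>\<^sup>+y. \<integral>\<^sup>+\<nu>. F (\<lambda>i. if i < k then y i else z i, \<nu> + tup_mset k y) \<partial>PN \<partial>PiM {..<k} (\<lambda>_. \<omega>))"
  using assms
proof (induction k arbitrary: F z)
  case 0
  then show ?case by (simp add: tup_mset_def PiM_empty nn_integral_count_space_finite)
next
  case (Suc k)
  note F [measurable] = Suc.prems(1)
  define T where "T w = tuple_sum k (\<lambda>y. F (y, snd w)) (z(k := fst w)) (snd w)" for w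
  have T [measurable]: "T \<in> borel_measurable (borel \<Otimes>\<^sub>M cfg_space)"
  proof -
    have "(\<lambda>w. (z(k := fst w), snd w)) \<in> measurable (borel \<Otimes>\<^sub>M cfg_space) (PiM UNIV (\<lambda>_. borel) \<Otimes>\<^sub>M cfg_space)"
      by (intro measurable_Pair measurable_fun_upd_UNIV measurable_const measurable_fst measurable_snd)
         (simp add: space_PiM)
    from measurable_compose[OF this measurable_tuple_sum[OF measurable_ident F, of k]]
    show ?thesis by (simp add: T_def[abs_def])
  qed
  have "(\<integral>\<^sup>+\<nu>. tuple_sum (Suc k) (\<lambda>y. F (y, \<nu>)) z \<nu> \<partial>PN) = (\<integral>\<^sup>+\<nu>. (\<Sum>x\<in>#\<nu>. T (x, \<nu>)) \<partial>PN)"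
    by (simp add: T_def)
  also have "\<dots> = (\<integral>\<^sup>+x. \<integral>\<^sup>+\<nu>. T (x, add_mset x \<nu>) \<partial>PN \<partial>\<omega>)"
    by (rule mecke) measurable
  also have "\<dots> = (\<integral>\<^sup>+x. \<integral>\<^sup>+\<nu>. tuple_sum k (\<lambda>y. F (y, add_mset x \<nu>)) (z(k := x)) \<nu> \<partial>PN \<partial>\<omega>)"
  proof (intro nn_integral_cong)
    fix x \<nu>
    show "T (x, add_mset x \<nu>) = tuple_sum k (\<lambda>y. F (y, add_mset x \<nu>)) (z(k := x)) \<nu>"
      unfolding T_def fst_conv snd_conv
    proof (rule tuple_sum_add_mset)
      fix y i assume *: "\<And>i. k \<le> i \<Longrightarrow> y i = (z(k := x)) i" "i < k" "y i = x"
      have "y k = x" using *(1)[of k] by simp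
      with * have "\<not> inj_on y {..<Suc k}" unfolding inj_on_def
        by (metis lessI lessThan_iff less_SucI nat_neq_iff)
      then show "F (y, add_mset x \<nu>) = 0" by (intro Suc.prems(2)) (simp_all add: *)
    qed
  qed
  also have "\<dots> = (\<integral>\<^sup>+x. \<integral>\<^sup>+y. \<integral>\<^sup>+\<nu>. F (\<lambda>i. if i < k then y i else (z(k := x)) i,
      add_mset x (\<nu> + tup_mset k y)) \<partial>PN \<partial>PiM {..<k} (\<lambda>_. \<omega>) \<partial>\<omega>)"
  proof (intro nn_integral_cong)
    fix x
    \<comment> \<open>Absorbing the added point into the function puts the inner integral in the
      form of the induction hypothesis with background z(k := x).\<close>
    define F' where "F' w = F (fst w, add_mset x (snd w))" for w
    have "(\<integral>\<^sup>+\<nu>. tuple_sum k (\<lambda>y. F' (y, \<nu>)) (z(k := x)) \<nu> \<partial>PN)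
      = (\<integral>\<^sup>+y. \<integral>\<^sup>+\<nu>. F' (\<lambda>i. if i < k then y i else (z(k := x)) i, \<nu> + tup_mset k y) \<partial>PN \<partial>PiM {..<k} (\<lambda>_. \<omega>))"
    proof (rule Suc.IH)
      show "F' \<in> borel_measurable (PiM UNIV (\<lambda>_. borel) \<Otimes>\<^sub>M cfg_space)"
        unfolding F'_def by measurable
      fix y \<nu> assume *: "\<And>i. k \<le> i \<Longrightarrow> y i = (z(k := x)) i" "\<not> inj_on y {..<k}"
      have "\<not> inj_on y {..<Suc k}"
        using *(2) inj_on_subset[of y "{..<Suc k}" "{..<k}"] by auto
      then show "F' (y, \<nu>) = 0" unfolding F'_def fst_conv snd_conv
        by (intro Suc.prems(2)) (simp_all add: *)
    qed
    then show "(\<integral>\<^sup>+\<nu>. tuple_sum k (\<lambda>y. F (y, add_mset x \<nu>)) (z(k := x)) \<nu> \<partial>PN)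
      = (\<integral>\<^sup>+y. \<integral>\<^sup>+\<nu>. F (\<lambda>i. if i < k then y i else (z(k := x)) i, add_mset x (\<nu> + tup_mset k y)) \<partial>PN \<partial>PiM {..<k} (\<lambda>_. \<omega>))"
      by (simp add: F'_def)
  qed
  also have "\<dots> = (\<integral>\<^sup>+x. \<integral>\<^sup>+y. (\<integral>\<^sup>+\<nu>. F (\<lambda>i. if i < Suc k then (y(k := x)) i else z i,
      \<nu> + tup_mset (Suc k) (y(k := x))) \<partial>PN) \<partial>PiM {..<k} (\<lambda>_. \<omega>) \<partial>\<omega>)"
  proof (intro nn_integral_cong arg_cong[where f=F] prod_eqI)
    fix x y \<nu>
    show "fst (\<lambda>i. if i < k then y i else (z(k := x)) i, add_mset x (\<nu> + tup_mset k y))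
      = fst (\<lambda>i. if i < Suc k then (y(k := x)) i else z i, \<nu> + tup_mset (Suc k) (y(k := x)))"
      by auto
    have "tup_mset (Suc k) (y(k := x)) = add_mset x (tup_mset k y)"
      unfolding tup_mset_def by (auto intro!: arg_cong[where f=mset])
    then show "snd (\<lambda>i. if i < k then y i else (z(k := x)) i, add_mset x (\<nu> + tup_mset k y))
      = snd (\<lambda>i. if i < Suc k then (y(k := x)) i else z i, \<nu> + tup_mset (Suc k) (y(k := x)))"
      by simp
  qed
  also have "\<dots> = (\<integral>\<^sup>+y. \<integral>\<^sup>+\<nu>. F (\<lambda>i. if i < Suc k then y i else z i, \<nu> + tup_mset (Suc k) y) \<partial>PN
      \<partial>PiM (insert k {..<k}) (\<lambda>_. \<omega>))"
  proof (rule prod_\<omega>.product_nn_integral_insert_rev[symmetric])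
    let ?M = "PiM (insert k {..<k}) (\<lambda>_. \<omega>)"
    have comp: "(\<lambda>w. fst w i) \<in> borel_measurable (?M \<Otimes>\<^sub>M PN)" if "i < Suc k" for i
      using that measurable_component_singleton[of i "insert k {..<k}" "\<lambda>_. \<omega>"]
      by (auto intro!: measurable_compose[OF measurable_fst] simp: less_Suc_eq cong: measurable_cong_sets simp: sets_\<omega>)
    have 1: "(\<lambda>w i. if i < Suc k then fst w i else z i) \<in> measurable (?M \<Otimes>\<^sub>M PN) (PiM UNIV (\<lambda>_. borel))"
    proof (rule measurable_PiM_single')
      fix i show "(\<lambda>w. if i < Suc k then fst w i else z i) \<in> borel_measurable (?M \<Otimes>\<^sub>M PN)"
        using comp[of i] by (cases "i < Suc k") auto
    qed (auto simp: space_PiM)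
    have 2: "(\<lambda>w. snd w + tup_mset (Suc k) (fst w)) \<in> measurable (?M \<Otimes>\<^sub>M PN) cfg_space"
      using comp by measurable
    note 1 [measurable] 2 [measurable]
    have "(\<lambda>w. F (\<lambda>i. if i < Suc k then fst w i else z i, snd w + tup_mset (Suc k) (fst w)))
        \<in> borel_measurable (?M \<Otimes>\<^sub>M PN)"
      by measurable
    then show "(\<lambda>y. \<integral>\<^sup>+\<nu>. F (\<lambda>i. if i < Suc k then y i else z i, \<nu> + tup_mset (Suc k) y) \<partial>PN)
        \<in> borel_measurable ?M"
      by (intro PN.borel_measurable_nn_integral) (simp add: split_beta)
  qed auto
  also have "insert k {..<k} = {..<Suc k}" by auto
  finally show ?case .
qed

end

section \<open>Reduced Palm laws of Gibbs processes\<close>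

lemma tuple_sum_suminf:
  "tuple_sum k (\<lambda>y. \<Sum>i. G i y) z \<nu> = (\<Sum>i. tuple_sum k (G i) z \<nu>)"
  by (induction k arbitrary: z) (simp_all add: sum_mset_suminf)

text \<open>Lets membership in a set of extensional tuples be tested by a function on all functions
  from nat, which is the setting of \<open>measurable_tuple_sum\<close> and
  \<open>mecke_tuple\<close>.\<close>

lemma tuple_sum_undefined_restrict:
  "tuple_sum k (\<lambda>y. G (restrict y {..<k})) (\<lambda>_. undefined) \<nu> = tuple_sum k G (\<lambda>_. undefined) \<nu>"
proof (rule tuple_sum_cong)
  fix y :: "nat \<Rightarrow> 'a" assume *: "\<And>i. k \<le> i \<Longrightarrow> y i = undefined"
  have "restrict y {..<k} = y" by (rule ext) (simp add: restrict_def *)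
  then show "G (restrict y {..<k}) = G y" by simp
qed

lemma measurable_cfg_pow:
  fixes B :: "(nat \<Rightarrow> 'b::topological_space) set"
  assumes "B \<in> sets (tup_space k)"
  shows "(\<lambda>\<nu>. of_nat (cfg_pow k \<nu> B) :: ennreal) \<in> borel_measurable cfg_space"
proof -
  have B [measurable]: "B \<in> sets (PiM {..<k} (\<lambda>_. borel))" using assms by (simp add: tup_space_def)
  have [measurable]: "(\<lambda>y. restrict y {..<k}) \<in> measurable (PiM UNIV (\<lambda>_. borel)) (PiM {..<k} (\<lambda>_. borel :: 'b measure))"
    by (rule measurable_restrict_subset) simp
  have "(\<lambda>w. indicator B (restrict (fst w) {..<k}) :: ennreal)
      \<in> borel_measurable (PiM UNIV (\<lambda>_. borel) \<Otimes>\<^sub>M cfg_space)"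
    by measurable
  from measurable_tuple_sum[OF measurable_ident this, of k]
  have "(\<lambda>(z, \<nu>). tuple_sum k (\<lambda>y. indicator B (restrict y {..<k})) z \<nu>)
      \<in> borel_measurable (PiM UNIV (\<lambda>_. borel) \<Otimes>\<^sub>M cfg_space)"
    by simp
  from measurable_compose[OF measurable_Pair1'[of "\<lambda>_. undefined"] this]
  show ?thesis
    by (simp add: space_PiM cfg_pow_eq_tuple_sum tuple_sum_undefined_restrict)
qed

text \<open>\<open>measure_of\<close> yields the intended values only for a countably additive set
  function. Additivity is the interchange of a series with the finite sum over tuples and then with
  the integral.\<close>

lemma
  fixes P :: "'b::topological_space multiset measure"
  assumes "sets P = sets cfg_space"
  shows sets_moment_measure [simp]: "sets (moment_measure k P) = sets (tup_space k)"
    and space_moment_measure [simp]: "space (moment_measure k P) = space (tup_space k)"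
    and emeasure_moment_measure:
      "B \<in> sets (tup_space k) \<Longrightarrow> emeasure (moment_measure k P) B = (\<integral>\<^sup>+\<nu>. of_nat (cfg_pow k \<nu> B) \<partial>P)"
proof -
  show s: "sets (moment_measure k P) = sets (tup_space k)"
    and "space (moment_measure k P) = space (tup_space k)"
    by (simp_all add: moment_measure_def sets.space_closed space_measure_of_conv sets.sigma_sets_eq)
  assume B: "B \<in> sets (tup_space k)"
  show "emeasure (moment_measure k P) B = (\<integral>\<^sup>+\<nu>. of_nat (cfg_pow k \<nu> B) \<partial>P)"
  proof (rule emeasure_measure_of[OF moment_measure_def])
    show "positive (sets (moment_measure k P)) (\<lambda>B. \<integral>\<^sup>+\<nu>. of_nat (cfg_pow k \<nu> B) \<partial>P)"
      by (simp add: positive_def cfg_pow_def Let_def)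
    show "countably_additive (sets (moment_measure k P)) (\<lambda>B. \<integral>\<^sup>+\<nu>. of_nat (cfg_pow k \<nu> B) \<partial>P)"
    proof (rule countably_additiveI)
      fix A :: "nat \<Rightarrow> (nat \<Rightarrow> 'b) set"
      assume A: "range A \<subseteq> sets (moment_measure k P)" "disjoint_family A"
      have "(\<lambda>\<nu>. of_nat (cfg_pow k \<nu> (A i)) :: ennreal) \<in> borel_measurable P" for i
        using measurable_cfg_pow[of "A i" k] A s by (auto cong: measurable_cong_sets simp: assms)
      then have "(\<Sum>i. \<integral>\<^sup>+\<nu>. of_nat (cfg_pow k \<nu> (A i)) \<partial>P) = (\<integral>\<^sup>+\<nu>. (\<Sum>i. of_nat (cfg_pow k \<nu> (A i))) \<partial>P)"
        by (rule nn_integral_suminf[symmetric])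
      also have "\<dots> = (\<integral>\<^sup>+\<nu>. of_nat (cfg_pow k \<nu> (\<Union>i. A i)) \<partial>P)"
        unfolding cfg_pow_eq_tuple_sum tuple_sum_suminf[symmetric]
        by (simp add: suminf_indicator[OF A(2)])
      finally show "(\<Sum>i. \<integral>\<^sup>+\<nu>. of_nat (cfg_pow k \<nu> (A i)) \<partial>P) = (\<integral>\<^sup>+\<nu>. of_nat (cfg_pow k \<nu> (\<Union>i. A i)) \<partial>P)" .
    qed
  qed (use B s in \<open>auto simp: sets.space_closed\<close>)
qed

definition distinct_tuples :: "nat \<Rightarrow> (nat \<Rightarrow> 'b::topological_space) set" where
  "distinct_tuples k = {y \<in> space (tup_space k). distinct (map y [0..<k])}"

lemma distinct_map_upt: "distinct (map y [0..<k]) \<longleftrightarrow> inj_on y {..<k}"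
  by (simp add: distinct_map atLeast0LessThan)

lemma sets_distinct_tuples [measurable]:
  "(distinct_tuples k :: (nat \<Rightarrow> 'b::polish_space) set) \<in> sets (tup_space k)"
proof -
  have "(distinct_tuples k :: (nat \<Rightarrow> 'b) set) = {y \<in> space (tup_space k).
      \<forall>i\<in>{..<k}. \<forall>j\<in>{..<k}. dist (y i) (y j) = 0 \<longrightarrow> i = j}"
    by (auto simp: distinct_tuples_def distinct_map_upt inj_on_def)
  also have "\<dots> \<in> sets (tup_space k)"
  proof (intro sets.sets_Collect_finite_All)
    fix i j assume "i \<in> {..<k}" "j \<in> {..<k}"
    then have [measurable]: "(\<lambda>y. y i) \<in> measurable (tup_space k) borel" "(\<lambda>y. y j) \<in> measurable (tup_space k) borel"
      by (simp_all add: tup_space_def)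
    show "{y \<in> space (tup_space k). dist (y i :: 'b) (y j) = 0 \<longrightarrow> i = j} \<in> sets (tup_space k)"
      by measurable
  qed auto
  finally show ?thesis .
qed

locale gibbs_process = poisson_process \<omega> PN
  for \<omega> :: "'a::polish_space measure" and PN +
  fixes f :: "'a multiset \<Rightarrow> real"
  assumes f_measurable [measurable]: "f \<in> borel_measurable cfg_space"
    and f_nonneg: "\<And>\<nu>. 0 \<le> f \<nu>"
begin

abbreviation "P \<equiv> density PN (\<lambda>\<nu>. ennreal (f \<nu>))"

abbreviation "W k \<equiv> PiM {..<k} (\<lambda>_::nat. \<omega>)"

text \<open>On distinct tuples this is the density, with respect to \<open>W k\<close>, of the
  Campbell measure of the event L; for L = UNIV it is the k-point correlation function of the Gibbs
  process.\<close>

definition palm_weight :: "nat \<Rightarrow> 'a multiset set \<Rightarrow> (nat \<Rightarrow> 'a) \<Rightarrow> ennreal" where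
  "palm_weight k L y = (\<integral>\<^sup>+\<nu>. ennreal (f (\<nu> + tup_mset k y)) * indicator L (\<nu> + tup_mset k y) \<partial>PN)"

lemma sets_P: "sets P = sets cfg_space"
  by (simp add: sets_PN)

lemma sets_W [measurable_cong]: "sets (W k) = sets (tup_space k)"
  unfolding tup_space_def by (intro sets_PiM_cong) (auto simp: sets_\<omega>)

lemma measurable_palm_weight [measurable]:
  assumes [measurable]: "L \<in> sets cfg_space"
  shows "palm_weight k L \<in> borel_measurable (tup_space k)"
proof -
  have "(\<lambda>w. fst w i) \<in> borel_measurable (tup_space k \<Otimes>\<^sub>M PN)" if "i < k" for i
    using that unfolding tup_space_def
    by (intro measurable_compose[OF measurable_fst] measurable_component_singleton) auto
  then have [measurable]: "(\<lambda>w. tup_mset k (fst w)) \<in> measurable (tup_space k \<Otimes>\<^sub>M PN) cfg_space"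
    by (rule measurable_tup_mset)
  have "(\<lambda>w. ennreal (f (snd w + tup_mset k (fst w))) * indicator L (snd w + tup_mset k (fst w)))
      \<in> borel_measurable (tup_space k \<Otimes>\<^sub>M PN)"
    by measurable
  then show ?thesis unfolding palm_weight_def[abs_def]
    by (intro PN.borel_measurable_nn_integral) (simp add: split_beta)
qed

text \<open>A tuple in B never uses a point twice, so the summand vanishes on tuples with a
  repetition, as \<open>mecke_tuple\<close> requires, and no diagonal terms arise.\<close>

lemma campbell_distinct:
  assumes B: "B \<in> sets (tup_space k)" "B \<subseteq> distinct_tuples k" and L [measurable]: "L \<in> sets cfg_space"
  shows "(\<integral>\<^sup>+\<nu>. indicator L \<nu> * of_nat (cfg_pow k \<nu> B) \<partial>P)
    = (\<integral>\<^sup>+y. indicator B y * palm_weight k L y \<partial>W k)"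
proof -
  note measurable_cfg_pow[OF B(1), measurable]
  define F where "F w = ennreal (f (snd w)) * indicator L (snd w) * indicator B (restrict (fst w) {..<k})"
    for w :: "(nat \<Rightarrow> 'a) \<times> 'a multiset"
  have "(\<integral>\<^sup>+\<nu>. indicator L \<nu> * of_nat (cfg_pow k \<nu> B) \<partial>P)
      = (\<integral>\<^sup>+\<nu>. ennreal (f \<nu>) * (indicator L \<nu> * of_nat (cfg_pow k \<nu> B)) \<partial>PN)"
    by (rule nn_integral_density) measurable
  also have "\<dots> = (\<integral>\<^sup>+\<nu>. tuple_sum k (\<lambda>y. F (y, \<nu>)) (\<lambda>_. undefined) \<nu> \<partial>PN)"
    unfolding F_def fst_conv snd_conv tuple_sum_mult tuple_sum_undefined_restrict
    by (simp add: cfg_pow_eq_tuple_sum mult.assoc)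
  also have "\<dots> = (\<integral>\<^sup>+y. \<integral>\<^sup>+\<nu>. F (\<lambda>i. if i < k then y i else undefined, \<nu> + tup_mset k y) \<partial>PN \<partial>W k)"
  proof (rule mecke_tuple)
    have [measurable]: "(\<lambda>y. restrict y {..<k}) \<in> measurable (PiM UNIV (\<lambda>_. borel)) (tup_space k :: (nat \<Rightarrow> 'a) measure)"
      unfolding tup_space_def by (rule measurable_restrict_subset) simp
    note B(1)[measurable]
    show "F \<in> borel_measurable (PiM UNIV (\<lambda>_. borel) \<Otimes>\<^sub>M cfg_space)"
      unfolding F_def[abs_def] by measurable
    fix y :: "nat \<Rightarrow> 'a" and \<nu>
    assume *: "\<And>i. k \<le> i \<Longrightarrow> y i = undefined" "\<not> inj_on y {..<k}"
    have "restrict y {..<k} = y" by (rule ext) (simp add: restrict_def *(1))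
    then have "restrict y {..<k} \<notin> B" using *(2) B(2) by (auto simp: distinct_tuples_def distinct_map_upt)
    then show "F (y, \<nu>) = 0" by (simp add: F_def)
  qed
  also have "\<dots> = (\<integral>\<^sup>+y. indicator B y * palm_weight k L y \<partial>W k)"
  proof (rule nn_integral_cong)
    fix y assume "y \<in> space (W k)"
    then have y: "y \<in> extensional {..<k}" by (auto simp: space_PiM PiE_def)
    then have "(\<lambda>i. if i < k then y i else undefined) = y" by (auto simp: extensional_def)
    moreover have "restrict y {..<k} = y" using y by (rule extensional_restrict)
    ultimately show "(\<integral>\<^sup>+\<nu>. F (\<lambda>i. if i < k then y i else undefined, \<nu> + tup_mset k y) \<partial>PN)
        = indicator B y * palm_weight k L y"
      by (cases "y \<in> B") (simp_all add: F_def palm_weight_def)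
  qed
  finally show ?thesis .
qed

text \<open>The Campbell measure of L over distinct tuples can be written with the kernel and the
  moment measure, or with \<open>palm_weight\<close> and \<open>W k\<close>. Expressing the moment
  measure through \<open>W k\<close> as well turns this into an equality of two densities.\<close>

lemma AE_palm_weight:
  assumes sf: "sigma_finite_measure (moment_measure k P)"
    and palm: "is_palm_kernel k P Palm"
    and \<L>: "countable \<L>" "\<L> \<subseteq> sets cfg_space"
  shows "AE y in moment_measure k P. y \<in> distinct_tuples k \<longrightarrow>
    0 < palm_weight k UNIV y \<and> palm_weight k UNIV y < \<infinity> \<and>
    (\<forall>L\<in>\<L>. palm_weight k UNIV y * emeasure (Palm y) L = palm_weight k L y)"
proof -
  let ?M = "moment_measure k P" and ?D = "distinct_tuples k :: (nat \<Rightarrow> 'a) set"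
  interpret M: sigma_finite_measure ?M by fact
  interpret W: sigma_finite_measure "W k"
    by (rule prod_\<omega>.sigma_finite) simp
  note sets_moment_measure[OF sets_P, of k, measurable_cong]
  have top [measurable]: "(UNIV :: 'a multiset set) \<in> sets cfg_space"
    using sets.top[of cfg_space] by simp
  \<comment> \<open>The moment measure is the Campbell measure of the sure event, so
    \<open>campbell_distinct\<close> with L = UNIV supplies its density on distinct tuples.\<close>
  have N: "density ?M (indicator ?D) = density (W k) (\<lambda>y. indicator ?D y * palm_weight k UNIV y)"
    (is "_ = ?N")
  proof (rule measure_eqI)
    show "sets (density ?M (indicator ?D)) = sets ?N"
      by (simp add: sets_moment_measure[OF sets_P] sets_W)
    fix B assume "B \<in> sets (density ?M (indicator ?D))"
    then have B [measurable]: "B \<in> sets (tup_space k)" by (simp add: sets_moment_measure[OF sets_P])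
    have "emeasure (density ?M (indicator ?D)) B = emeasure ?M (B \<inter> ?D)"
      by (subst emeasure_density)
         (auto simp: indicator_inter_arith[symmetric] Int_commute sets_moment_measure[OF sets_P])
    also have "\<dots> = (\<integral>\<^sup>+\<nu>. indicator UNIV \<nu> * of_nat (cfg_pow k \<nu> (B \<inter> ?D)) \<partial>P)"
      by (simp add: emeasure_moment_measure[OF sets_P])
    also have "\<dots> = (\<integral>\<^sup>+y. indicator (B \<inter> ?D) y * palm_weight k UNIV y \<partial>W k)"
      by (rule campbell_distinct) auto
    also have "\<dots> = emeasure ?N B"
      by (subst emeasure_density)
         (auto intro!: nn_integral_cong simp: indicator_inter_arith ac_simps sets_W)
    finally show "emeasure (density ?M (indicator ?D)) B = emeasure ?N B" .
  qed
  \<comment> \<open>Sigma-finiteness passes to the restriction of the moment measure; for a density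
    with respect to the sigma-finite \<open>W k\<close> it means finiteness almost
    everywhere.\<close>
  have "sigma_finite_measure ?N"
    unfolding N[symmetric] by (subst M.sigma_finite_iff_density_finite) (auto split: split_indicator)
  then have fin: "AE y in W k. indicator ?D y * palm_weight k UNIV y \<noteq> \<infinity>"
    by (subst (asm) W.sigma_finite_iff_density_finite) auto
  have "AE y in W k. \<forall>L\<in>\<L>. indicator ?D y * palm_weight k UNIV y * emeasure (Palm y) L
      = indicator ?D y * palm_weight k L y"
  proof (subst AE_ball_countable[OF \<L>(1)], safe)
    fix L assume "L \<in> \<L>"
    then have L [measurable]: "L \<in> sets cfg_space" using \<L> by auto
    have [measurable]: "(\<lambda>y. emeasure (Palm y) L) \<in> borel_measurable (tup_space k)"
      using palm L by (auto simp: is_palm_kernel_def)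
    let ?l = "\<lambda>y. indicator ?D y * palm_weight k UNIV y * emeasure (Palm y) L"
    let ?r = "\<lambda>y. indicator ?D y * palm_weight k L y"
    \<comment> \<open>Both measures give B the Campbell measure of L over the distinct tuples in B:
      the left one by the defining property of the Palm kernel, the right one by
      \<open>campbell_distinct\<close>.\<close>
    have "density (W k) ?l = density (W k) ?r"
    proof (rule measure_eqI)
      fix B assume "B \<in> sets (density (W k) ?l)"
      then have B [measurable]: "B \<in> sets (tup_space k)" by (simp add: sets_W)
      have "emeasure (density (W k) ?l) B
          = (\<integral>\<^sup>+y. (indicator ?D y * palm_weight k UNIV y) * (emeasure (Palm y) L * indicator B y) \<partial>W k)"
        by (subst emeasure_density) (auto simp: sets_W ac_simps)
      also have "\<dots> = (\<integral>\<^sup>+y. emeasure (Palm y) L * indicator B y \<partial>?N)"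
        by (rule nn_integral_density[symmetric]) measurable
      also have "\<dots> = (\<integral>\<^sup>+y. indicator ?D y * (emeasure (Palm y) L * indicator B y) \<partial>?M)"
        unfolding N[symmetric] by (rule nn_integral_density) measurable
      also have "\<dots> = (\<integral>\<^sup>+y\<in>B \<inter> ?D. emeasure (Palm y) L \<partial>?M)"
        by (intro nn_integral_cong) (simp add: indicator_inter_arith ac_simps)
      also have "\<dots> = (\<integral>\<^sup>+\<nu>. indicator L \<nu> * of_nat (cfg_pow k \<nu> (B \<inter> ?D)) \<partial>P)"
        by (rule palm[unfolded is_palm_kernel_def, THEN conjunct2, THEN conjunct2, rule_format, symmetric])
           measurable
      also have "\<dots> = (\<integral>\<^sup>+y. indicator (B \<inter> ?D) y * palm_weight k L y \<partial>W k)"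
        by (rule campbell_distinct) auto
      also have "\<dots> = emeasure (density (W k) ?r) B"
        by (subst emeasure_density)
           (auto intro!: nn_integral_cong simp: indicator_inter_arith ac_simps sets_W)
      finally show "emeasure (density (W k) ?l) B = emeasure (density (W k) ?r) B" .
    qed simp
    then show "AE y in W k. ?l y = ?r y"
      by (subst (asm) W.density_unique_iff) auto
  qed
  \<comment> \<open>Passing from \<open>W k\<close> to \<open>?N\<close> adds positivity, since a
    measure does not charge the zeros of its own density.\<close>
  with fin have "AE y in ?N. 0 < palm_weight k UNIV y \<and> palm_weight k UNIV y < \<infinity> \<and>
    (\<forall>L\<in>\<L>. palm_weight k UNIV y * emeasure (Palm y) L = palm_weight k L y)"
  proof (subst AE_density, goal_cases)
    case 2
    then show ?case
      by eventually_elim (auto simp: less_top split: split_indicator_asm)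
  qed measurable
  then show ?thesis
    unfolding N[symmetric] by (subst (asm) AE_density) (auto elim!: eventually_mono)
qed

text \<open>The countable generator yields one null set outside which Palm y is known on all events
  at once; c is the value of \<open>palm_weight k UNIV\<close> at y.\<close>

theorem AE_reduced_palm:
  assumes sf: "sigma_finite_measure (moment_measure k P)"
    and palm: "is_palm_kernel k P Palm"
  shows "AE y in moment_measure k P. distinct (map y [0..<k]) \<longrightarrow>
    (\<exists>c>0. (\<integral>\<^sup>+\<nu>. ennreal (f (\<nu> + tup_mset k y)) \<partial>PN) = ennreal c \<and>
     distr (Palm y) cfg_space (\<lambda>\<nu>. \<nu> - tup_mset k y)
       = density PN (\<lambda>\<nu>. ennreal (f (\<nu> + tup_mset k y) / c)))"
proof -
  obtain \<L> :: "'a multiset set set" where \<L>: "countable \<L>" "Int_stable \<L>" "UNIV \<in> \<L>"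
    "sets cfg_space = sigma_sets UNIV \<L>"
    by (rule cfg_space_countable_generator)
  then have "\<L> \<subseteq> sets cfg_space" by (auto intro: sigma_sets.Basic)
  from AE_palm_weight[OF sf palm \<L>(1) this] show ?thesis
  proof (rule AE_mp, intro AE_I2 impI)
    fix y
    assume "y \<in> space (moment_measure k P)" and dist: "distinct (map y [0..<k])"
      and *: "y \<in> distinct_tuples k \<longrightarrow> 0 < palm_weight k UNIV y \<and> palm_weight k UNIV y < \<infinity> \<and>
        (\<forall>L\<in>\<L>. palm_weight k UNIV y * emeasure (Palm y) L = palm_weight k L y)"
    then have y: "y \<in> space (tup_space k)" by (simp add: space_moment_measure[OF sets_P])
    with dist * have w: "0 < palm_weight k UNIV y" "palm_weight k UNIV y < \<infinity>"
      and weight: "\<And>L. L \<in> \<L> \<Longrightarrow> palm_weight k UNIV y * emeasure (Palm y) L = palm_weight k L y"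
      by (auto simp: distinct_tuples_def)
    define Y where "Y = tup_mset k y"
    obtain c where c: "0 < c" "palm_weight k UNIV y = ennreal c"
      using w by (cases "palm_weight k UNIV y") auto
    interpret palm: prob_space "Palm y" using palm y by (auto simp: is_palm_kernel_def)
    have sets_palm: "sets (Palm y) = sets cfg_space" using palm y by (auto simp: is_palm_kernel_def)
    let ?R = "density PN (\<lambda>\<nu>. ennreal (f (\<nu> + Y) / c))"
    \<comment> \<open>The unreduced law is identified first, as that of \<nu> + Y, because
      \<open>palm_weight\<close> evaluates events at \<nu> + Y. The generator contains the whole
      space, and Palm y is a probability.\<close>
    have "Palm y = distr ?R cfg_space (\<lambda>\<nu>. \<nu> + Y)"
    proof (rule measure_eqI_generator_eq[where E=\<L> and \<Omega>=UNIV and A="\<lambda>_. UNIV"])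
      fix L assume L: "L \<in> \<L>"
      have [measurable]: "L \<in> sets cfg_space" using L \<open>\<L> \<subseteq> sets cfg_space\<close> by auto
      have "emeasure (distr ?R cfg_space (\<lambda>\<nu>. \<nu> + Y)) L = (\<integral>\<^sup>+\<nu>. indicator L \<nu> \<partial>distr ?R cfg_space (\<lambda>\<nu>. \<nu> + Y))"
        by simp
      also have "\<dots> = (\<integral>\<^sup>+\<nu>. indicator L (\<nu> + Y) \<partial>?R)"
        by (rule nn_integral_distr) measurable
      also have "\<dots> = (\<integral>\<^sup>+\<nu>. ennreal (f (\<nu> + Y) / c) * indicator L (\<nu> + Y) \<partial>PN)"
        by (rule nn_integral_density) measurable
      also have "\<dots> = (\<integral>\<^sup>+\<nu>. ennreal (1 / c) * (ennreal (f (\<nu> + Y)) * indicator L (\<nu> + Y)) \<partial>PN)"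
      proof (rule nn_integral_cong)
        fix \<nu>
        have "ennreal (f (\<nu> + Y) / c) = ennreal (1 / c) * ennreal (f (\<nu> + Y))"
          using c(1) f_nonneg by (simp add: ennreal_mult'[symmetric])
        then show "ennreal (f (\<nu> + Y) / c) * indicator L (\<nu> + Y)
            = ennreal (1 / c) * (ennreal (f (\<nu> + Y)) * indicator L (\<nu> + Y))"
          by (simp add: mult.assoc)
      qed
      also have "\<dots> = ennreal (1 / c) * palm_weight k L y"
        unfolding palm_weight_def Y_def by (rule nn_integral_cmult) measurable
      also have "\<dots> = ennreal (1 / c) * ennreal c * emeasure (Palm y) L"
        using weight[OF L] c by (simp add: mult.assoc)
      also have "ennreal (1 / c) * ennreal c = 1"
        using c(1) by (simp add: ennreal_mult'[symmetric])
      finally show "emeasure (Palm y) L = emeasure (distr ?R cfg_space (\<lambda>\<nu>. \<nu> + Y)) L" by simp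
    qed (use \<L> sets_palm in auto)
    \<comment> \<open>Subtracting Y undoes the addition of Y pointwise, so the image under reduction
      is the weighted Poisson law itself.\<close>
    then have "distr (Palm y) cfg_space (\<lambda>\<nu>. \<nu> - Y)
        = distr (distr ?R cfg_space (\<lambda>\<nu>. \<nu> + Y)) cfg_space (\<lambda>\<nu>. \<nu> - Y)" by simp
    also have "\<dots> = distr ?R cfg_space (\<lambda>\<nu>. \<nu>)"
      by (subst distr_distr) (auto simp: o_def intro: measurable_diff_const_mset)
    also have "\<dots> = ?R" by (rule distr_id2) (simp add: sets_PN)
    finally show "\<exists>c>0. (\<integral>\<^sup>+\<nu>. ennreal (f (\<nu> + tup_mset k y)) \<partial>PN) = ennreal c \<and>
       distr (Palm y) cfg_space (\<lambda>\<nu>. \<nu> - tup_mset k y)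
         = density PN (\<lambda>\<nu>. ennreal (f (\<nu> + tup_mset k y) / c))"
      using c by (intro exI[of _ c]) (simp add: Y_def palm_weight_def)
  qed
qed

end

section \<open>Independent marks\<close>

text \<open>The map behind \<open>mark_law\<close> with the list as a parameter, so that the
  enumeration can be changed.\<close>

definition attach_marks :: "'b list \<Rightarrow> (nat \<Rightarrow> real) \<Rightarrow> ('b \<times> real) multiset" where
  "attach_marks xs s = mset (map (\<lambda>i. (xs ! i, s i)) [0..<length xs])"

lemma attach_marks_Nil [simp]: "attach_marks [] s = {#}"
  by (simp add: attach_marks_def)

lemma attach_marks_snoc [simp]:
  "attach_marks (xs @ [x]) s = add_mset (x, s (length xs)) (attach_marks xs s)"
proof -
  have eq: "map (\<lambda>i. ((xs @ [x]) ! i, s i)) [0..<length xs] = map (\<lambda>i. (xs ! i, s i)) [0..<length xs]"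
    by (rule map_cong) (auto simp: nth_append)
  have upt: "[0..<length (xs @ [x])] = [0..<length xs] @ [length xs]" by simp
  show ?thesis unfolding attach_marks_def upt map_append eq by simp
qed

lemma attach_marks_cong:
  "(\<And>i. i < length xs \<Longrightarrow> s i = t i) \<Longrightarrow> attach_marks xs s = attach_marks xs t"
  unfolding attach_marks_def by (intro arg_cong[where f=mset] map_cong) auto

lemma measurable_attach_marks:
  fixes xs :: "'b::second_countable_topology list"
  assumes "\<And>i. i < length xs \<Longrightarrow> (\<lambda>w. s w i) \<in> borel_measurable M"
  shows "(\<lambda>w. attach_marks xs (s w)) \<in> measurable M cfg_space"
  using assms
proof (induction xs rule: rev_induct)
  case (snoc x xs)
  have [measurable]: "(\<lambda>w. attach_marks xs (s w)) \<in> measurable M cfg_space"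
    "(\<lambda>w. s w (length xs)) \<in> borel_measurable M"
    using snoc by auto
  show ?case by simp
qed simp

lemma attach_marks_permute:
  assumes "p permutes {..<length ys}"
  shows "attach_marks ys s = attach_marks (permute_list p ys) (\<lambda>i. s (p i))"
proof -
  have "attach_marks ys s = image_mset (\<lambda>i. (ys ! i, s i)) (mset_set (p ` {..<length ys}))"
    using permutes_image[OF assms]
    by (simp add: attach_marks_def atLeast0LessThan)
  also have "mset_set (p ` {..<length ys}) = image_mset p (mset_set {..<length ys})"
    using permutes_inj_on[OF assms] by (simp add: image_mset_mset_set)
  also have "image_mset (\<lambda>i. (ys ! i, s i)) (image_mset p (mset_set {..<length ys}))
      = image_mset (\<lambda>i. (permute_list p ys ! i, s (p i))) (mset_set {..<length ys})"
    unfolding multiset.map_comp using permute_list_nth[OF assms]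
    by (intro image_mset_cong) auto
  also have "\<dots> = attach_marks (permute_list p ys) (\<lambda>i. s (p i))"
    by (simp add: attach_marks_def atLeast0LessThan)
  finally show ?thesis .
qed

section \<open>Weighted measures built from marked configurations\<close>

lemma sets_wmeas [simp]: "sets (wmeas \<psi>) = sets (borel :: 'b::topological_space measure)"
  by (simp add: wmeas_def sets.sigma_sets_eq[where M="borel :: 'b measure", simplified])

lemma emeasure_wmeas:
  fixes \<psi> :: "('b::topological_space \<times> real) multiset"
  assumes "A \<in> sets borel"
  shows "emeasure (wmeas \<psi>) A = (\<Sum>z\<in>#\<psi>. ennreal (snd z) * indicator A (fst z))"
proof -
  let ?\<mu> = "\<lambda>A. \<Sum>(x, s)\<in>#\<psi>. if x \<in> A then ennreal s else 0"
  have \<mu>: "?\<mu> A = (\<Sum>z\<in>#\<psi>. ennreal (snd z) * indicator A (fst z))" for A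
    by (intro arg_cong[where f=sum_mset] image_mset_cong) (auto split: split_indicator)
  have "emeasure (wmeas \<psi>) A = ?\<mu> A"
  proof (rule emeasure_measure_of[OF wmeas_def])
    show "positive (sets (wmeas \<psi>)) ?\<mu>" unfolding \<mu> by (simp add: positive_def)
    show "countably_additive (sets (wmeas \<psi>)) ?\<mu>"
      unfolding \<mu>
    proof (rule countably_additiveI)
      fix B :: "nat \<Rightarrow> 'b set" assume "disjoint_family B"
      then show "(\<Sum>i. \<Sum>z\<in>#\<psi>. ennreal (snd z) * indicator (B i) (fst z))
          = (\<Sum>z\<in>#\<psi>. ennreal (snd z) * indicator (\<Union>i. B i) (fst z))"
        by (simp add: sum_mset_suminf[symmetric] suminf_indicator)
    qed
  qed (use assms in auto)
  then show ?thesis by (simp only: \<mu>)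
qed

lemma measurable_sum_mset_const:
  fixes F :: "'b::topological_space \<Rightarrow> ennreal"
  assumes [measurable]: "F \<in> borel_measurable borel"
  shows "(\<lambda>\<psi>. \<Sum>z\<in>#\<psi>. F z) \<in> borel_measurable cfg_space"
  using measurable_sum_mset[where n="\<lambda>\<psi>. \<psi>" and P=cfg_space and F="\<lambda>w. F (fst w)"] by simp

lemma measurable_fst_snd_borel [measurable]:
  "(fst :: 'b::second_countable_topology \<times> real \<Rightarrow> 'b) \<in> borel_measurable borel"
  "(snd :: 'b::second_countable_topology \<times> real \<Rightarrow> real) \<in> borel_measurable borel"
  unfolding borel_prod[symmetric] by simp_all

lemma measurable_wmeas [measurable]:
  "(wmeas :: ('b::second_countable_topology \<times> real) multiset \<Rightarrow> _) \<in> measurable cfg_space (meas_algebra borel)"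
proof (rule measurable_meas_algebraI)
  fix A :: "'b set" assume [measurable]: "A \<in> sets borel"
  have "(\<lambda>\<psi>. \<Sum>z\<in>#\<psi>. ennreal (snd z) * indicator A (fst z :: 'b)) \<in> borel_measurable cfg_space"
    by (rule measurable_sum_mset_const) measurable
  then show "(\<lambda>\<psi>. emeasure (wmeas \<psi>) A) \<in> borel_measurable cfg_space"
    by (simp add: emeasure_wmeas)
qed simp

lemma nn_integral_wmeas:
  fixes g :: "'b::topological_space \<Rightarrow> ennreal"
  assumes "g \<in> borel_measurable borel"
  shows "(\<integral>\<^sup>+x. g x \<partial>wmeas \<psi>) = (\<Sum>z\<in>#\<psi>. ennreal (snd z) * g (fst z))"
  using assms
proof (induction rule: borel_measurable_induct)
  case (cong f g)
  then have "f = g" by auto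
  with cong show ?case by simp
next
  case (set A)
  then show ?case by (simp add: emeasure_wmeas)
next
  case (mult u c)
  have "u \<in> borel_measurable (wmeas \<psi>)" using mult(2) by (simp cong: measurable_cong_sets)
  then have "(\<integral>\<^sup>+x. c * u x \<partial>wmeas \<psi>) = c * (\<Sum>z\<in>#\<psi>. ennreal (snd z) * u (fst z))"
    using mult by (simp add: nn_integral_cmult)
  also have "\<dots> = (\<Sum>z\<in>#\<psi>. c * (ennreal (snd z) * u (fst z)))"
    by (rule sum_mset_distrib_left)
  finally show ?case by (simp add: mult.left_commute)
next
  case (add u v)
  have "u \<in> borel_measurable (wmeas \<psi>)" "v \<in> borel_measurable (wmeas \<psi>)"
    using add(1,3) by (simp_all cong: measurable_cong_sets)
  with add show ?case by (simp add: nn_integral_add sum_mset.distrib distrib_left)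
next
  case (seq U)
  have U: "U i \<in> borel_measurable (wmeas \<psi>)" for i using seq(1) by (simp cong: measurable_cong_sets)
  have "incseq (\<lambda>i. U i x)" for x using seq(3) by (auto simp: incseq_def le_fun_def)
  then have inc: "incseq (\<lambda>i. ennreal (snd z) * U i (fst z))" for z :: "'b \<times> real"
    by (auto simp: incseq_def intro: mult_left_mono)
  have "(\<integral>\<^sup>+x. (SUP i. U i x) \<partial>wmeas \<psi>) = (SUP i. \<integral>\<^sup>+x. U i x \<partial>wmeas \<psi>)"
    by (rule nn_integral_monotone_convergence_SUP[OF seq(3) U])
  also have "\<dots> = (SUP i. \<Sum>z\<in>#\<psi>. ennreal (snd z) * U i (fst z))" by (simp add: seq)
  also have "\<dots> = (\<Sum>z\<in>#\<psi>. SUP i. ennreal (snd z) * U i (fst z))"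
    by (rule sum_mset_SUP[OF inc, symmetric])
  finally show ?case by (simp add: SUP_mult_left_ennreal image_comp)
qed

section \<open>The marking kernel and its Laplace functional\<close>

locale mark_distribution = prob_space K for K :: "real measure" +
  assumes sets_K [measurable_cong]: "sets K = sets borel"
    and K_nonneg: "AE s in K. 0 \<le> s"
begin

lemma space_K [simp]: "space K = UNIV"
  using sets_eq_imp_space_eq[OF sets_K] by simp

sublocale prod_K: product_sigma_finite "\<lambda>_::nat. K"
  by unfold_locales

lemma measurable_attach_marks_PiM:
  "attach_marks xs \<in> measurable (PiM {..<length xs} (\<lambda>_. K)) (cfg_space :: ('b::second_countable_topology \<times> real) multiset measure)"
proof (rule measurable_attach_marks)
  fix i assume "i < length xs"
  then have "(\<lambda>w. w i) \<in> measurable (PiM {..<length xs} (\<lambda>_. K)) K" by simp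
  then show "(\<lambda>w. w i) \<in> borel_measurable (PiM {..<length xs} (\<lambda>_. K))"
    by (simp cong: measurable_cong_sets add: sets_K)
qed

text \<open>Independent identically distributed marks are exchangeable: another enumeration permutes
  the coordinates, and the product measure is invariant under that. The choice made by
  \<open>enum_mset\<close> is therefore harmless.\<close>

lemma mark_law_eq:
  fixes \<nu> :: "'b::second_countable_topology multiset"
  assumes xs: "mset xs = \<nu>"
  shows "mark_law K \<nu> = distr (PiM {..<length xs} (\<lambda>_. K)) cfg_space (attach_marks xs)"
proof -
  define ys where "ys = enum_mset \<nu>"
  have "mset xs = mset ys" using xs by (simp add: ys_def mset_enum_mset)
  then obtain p where p: "p permutes {..<length ys}" "permute_list p ys = xs"
    by (rule mset_eq_permutation)
  define n where "n = length ys"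
  have n: "length xs = n" using p(2) by (auto simp: n_def)
  let ?t = "\<lambda>s. \<lambda>i\<in>{..<n}. s (p i) :: real"
  have "mark_law K \<nu> = distr (PiM {..<n} (\<lambda>_. K)) cfg_space (attach_marks ys)"
    by (simp add: mark_law_def Let_def ys_def n_def attach_marks_def[abs_def])
  also have "attach_marks ys = attach_marks xs \<circ> ?t"
  proof
    fix s
    have "attach_marks ys s = attach_marks xs (\<lambda>i. s (p i))"
      using attach_marks_permute[OF p(1)] p(2) by simp
    also have "\<dots> = attach_marks xs (?t s)" by (rule attach_marks_cong) (simp add: n)
    finally show "attach_marks ys s = (attach_marks xs \<circ> ?t) s" by simp
  qed
  also have "distr (PiM {..<n} (\<lambda>_. K)) cfg_space (attach_marks xs \<circ> ?t)
      = distr (distr (PiM {..<n} (\<lambda>_. K)) (PiM {..<n} (\<lambda>_. K)) ?t) cfg_space (attach_marks xs)"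
  proof (rule distr_distr[symmetric])
    show "attach_marks xs \<in> measurable (PiM {..<n} (\<lambda>_. K)) cfg_space"
      using measurable_attach_marks_PiM[of xs] by (simp add: n)
    show "?t \<in> measurable (PiM {..<n} (\<lambda>_. K)) (PiM {..<n} (\<lambda>_. K))"
      using permutes_in_image[OF p(1)]
      by (intro measurable_restrict measurable_component_singleton) (simp add: n_def)
  qed
  also have "distr (PiM {..<n} (\<lambda>_. K)) (PiM {..<n} (\<lambda>_. K)) ?t = PiM {..<n} (\<lambda>_. K)"
    using permutes_in_image[OF p(1)] permutes_inj_on[OF p(1)] prob_space_axioms
    by (intro distr_PiM_reindex) (auto simp: n_def)
  finally show ?thesis by (simp add: n)
qed

lemma sets_mark_law [simp]: "sets (mark_law K \<nu>) = sets cfg_space"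
  by (simp add: mark_law_def Let_def)

lemma prob_space_mark_law:
  fixes \<nu> :: "'b::second_countable_topology multiset"
  shows "prob_space (mark_law K \<nu>)"
proof -
  obtain xs where xs: "mset xs = \<nu>" using ex_mset by auto
  have "prob_space (PiM {..<length xs} (\<lambda>_. K))"
    by (intro prob_space_PiM prob_space_axioms)
  then show ?thesis
    unfolding mark_law_eq[OF xs]
    by (rule prob_space.prob_space_distr[OF _ measurable_attach_marks_PiM])
qed

lemma nn_integral_mark_law_empty:
  fixes F :: "('b::second_countable_topology \<times> real) multiset \<Rightarrow> ennreal"
  assumes "F \<in> borel_measurable cfg_space"
  shows "(\<integral>\<^sup>+\<psi>. F \<psi> \<partial>mark_law K {#}) = F {#}"
  using assms measurable_attach_marks_PiM[of "[] :: 'b list"]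
  by (subst mark_law_eq[of "[]"])
     (simp_all add: nn_integral_distr PiM_empty nn_integral_count_space_finite)

text \<open>Any enumeration may be used, in particular one that ends in x; Fubini then splits off
  the last coordinate of the product measure.\<close>

lemma nn_integral_mark_law_add_mset:
  fixes F :: "('b::second_countable_topology \<times> real) multiset \<Rightarrow> ennreal"
  assumes F [measurable]: "F \<in> borel_measurable cfg_space"
  shows "(\<integral>\<^sup>+\<psi>. F \<psi> \<partial>mark_law K (add_mset x \<nu>)) = (\<integral>\<^sup>+s. \<integral>\<^sup>+\<psi>. F (add_mset (x, s) \<psi>) \<partial>mark_law K \<nu> \<partial>K)"
proof -
  obtain xs where xs: "mset xs = \<nu>" using ex_mset by auto
  let ?n = "length xs"
  have ins: "{..<length (xs @ [x])} = insert ?n {..<?n}" by auto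
  note m = measurable_attach_marks_PiM[of xs, measurable]
  have m': "attach_marks (xs @ [x]) \<in> measurable (PiM (insert ?n {..<?n}) (\<lambda>_. K)) cfg_space"
    using measurable_attach_marks_PiM[of "xs @ [x]"] unfolding ins .
  have "(\<integral>\<^sup>+\<psi>. F \<psi> \<partial>mark_law K (add_mset x \<nu>))
      = (\<integral>\<^sup>+w. F (attach_marks (xs @ [x]) w) \<partial>PiM (insert ?n {..<?n}) (\<lambda>_. K))"
    using xs by (subst mark_law_eq[of "xs @ [x]"]) (simp, unfold ins, rule nn_integral_distr[OF m'], simp)
  also have "\<dots> = (\<integral>\<^sup>+s. \<integral>\<^sup>+w. F (attach_marks (xs @ [x]) (w(?n := s))) \<partial>PiM {..<?n} (\<lambda>_. K) \<partial>K)"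
    using measurable_compose[OF m' F] by (intro prod_K.product_nn_integral_insert_rev) auto
  also have "\<dots> = (\<integral>\<^sup>+s. \<integral>\<^sup>+w. F (add_mset (x, s) (attach_marks xs w)) \<partial>PiM {..<?n} (\<lambda>_. K) \<partial>K)"
  proof (intro nn_integral_cong arg_cong[where f=F])
    fix s w
    have "attach_marks xs (w(?n := s)) = attach_marks xs w" by (rule attach_marks_cong) simp
    then show "attach_marks (xs @ [x]) (w(?n := s)) = add_mset (x, s) (attach_marks xs w)" by simp
  qed
  also have "\<dots> = (\<integral>\<^sup>+s. \<integral>\<^sup>+\<psi>. F (add_mset (x, s) \<psi>) \<partial>mark_law K \<nu> \<partial>K)"
    unfolding mark_law_eq[OF xs] by (intro nn_integral_cong nn_integral_distr[symmetric] m) measurable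
  finally show ?thesis .
qed

text \<open>Induction on the size replaces a measurable enumeration: for n + 1 points the integral
  is the average, over the points x, of marking x first and then the rest, and sums over points are
  measurable. The second component collects the points already marked, which makes the statement
  stable under the induction.\<close>

lemma measurable_mark_law_size:
  fixes H :: "('b::{second_countable_topology, t1_space} \<times> real) multiset \<Rightarrow> ennreal"
  assumes H [measurable]: "H \<in> borel_measurable cfg_space"
  shows "(\<lambda>w. if size (fst w) = n then \<integral>\<^sup>+\<psi>. H (\<psi> + snd w) \<partial>mark_law K (fst w) else 0)
    \<in> borel_measurable (cfg_space \<Otimes>\<^sub>M cfg_space)"
proof (induction n)
  case 0
  have "(if size (fst w) = 0 then \<integral>\<^sup>+\<psi>. H (\<psi> + snd w) \<partial>mark_law K (fst w) else 0)
      = (if size (fst w) = 0 then H (snd w) else 0)" for w :: "'b multiset \<times> ('b \<times> real) multiset"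
    by (cases "fst w = {#}") (simp_all add: nn_integral_mark_law_empty)
  then show ?case by (simp only:) measurable
next
  case (Suc n)
  let ?I = "\<lambda>\<nu> \<xi>. \<integral>\<^sup>+\<psi>. H (\<psi> + \<xi>) \<partial>mark_law K \<nu>"
  define G where "G w = (if size (fst w) = n then ?I (fst w) (snd w) else 0)"
    for w :: "'b multiset \<times> ('b \<times> real) multiset"
  have G [measurable]: "G \<in> borel_measurable (cfg_space \<Otimes>\<^sub>M cfg_space)"
    using Suc by (simp add: G_def[abs_def])
  define S where "S v = (\<integral>\<^sup>+s. G (fst (snd v) - {#fst v#}, add_mset (fst v, s) (snd (snd v))) \<partial>K)"
    for v :: "'b \<times> 'b multiset \<times> ('b \<times> real) multiset"
  have [measurable]: "S \<in> borel_measurable (borel \<Otimes>\<^sub>M cfg_space \<Otimes>\<^sub>M cfg_space)"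
    unfolding S_def by measurable
  have S: "S (x, w) = ?I (fst w) (snd w)" if w: "size (fst w) = Suc n" "x \<in># fst w" for x w
  proof -
    obtain \<nu> where \<nu>: "fst w = add_mset x \<nu>" using w(2) by (metis insert_DiffM)
    have "?I (add_mset x \<nu>) (snd w) = (\<integral>\<^sup>+s. ?I \<nu> (add_mset (x, s) (snd w)) \<partial>K)"
      by (subst nn_integral_mark_law_add_mset) auto
    then show ?thesis using w \<nu> by (simp add: S_def G_def)
  qed
  \<comment> \<open>Each of the Suc n summands already equals the whole integral, whichever point is
    marked first; hence the factor 1 / Suc n.\<close>
  have eq: "(if size (fst w) = Suc n then ?I (fst w) (snd w) else 0)
      = (if size (fst w) = Suc n then ennreal (1 / Suc n) * (\<Sum>x\<in>#fst w. S (x, w)) else 0)" for w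
  proof (cases "size (fst w) = Suc n")
    case True
    then have "(\<Sum>x\<in>#fst w. S (x, w)) = (\<Sum>x\<in>#fst w. ?I (fst w) (snd w))"
      by (intro arg_cong[where f=sum_mset] image_mset_cong S)
    also have "\<dots> = of_nat (Suc n) * ?I (fst w) (snd w)"
      by (simp add: sum_mset_constant True)
    finally have "ennreal (1 / Suc n) * (\<Sum>x\<in>#fst w. S (x, w))
        = (ennreal (1 / Suc n) * of_nat (Suc n)) * ?I (fst w) (snd w)"
      by (simp only: mult.assoc)
    also have "ennreal (1 / Suc n) * of_nat (Suc n) = 1"
      unfolding ennreal_of_nat_eq_real_of_nat by (subst ennreal_mult'[symmetric]) simp_all
    finally show ?thesis by simp
  qed simp
  have [measurable]: "(\<lambda>w. \<Sum>x\<in>#fst w. S (x, w)) \<in> borel_measurable (cfg_space \<Otimes>\<^sub>M cfg_space)"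
    by (intro measurable_sum_mset) auto
  show ?case unfolding eq by measurable
qed

lemma measurable_mark_law [measurable]:
  "mark_law K \<in> measurable (cfg_space :: 'b::{second_countable_topology, t1_space} multiset measure) (subprob_algebra cfg_space)"
proof (rule measurable_subprob_algebra)
  fix A :: "('b \<times> real) multiset set" assume A [measurable]: "A \<in> sets cfg_space"
  have *: "(\<lambda>\<nu>. if size \<nu> = n then \<integral>\<^sup>+\<psi>. indicator A (\<psi> + {#}) \<partial>mark_law K \<nu> else 0) \<in> borel_measurable cfg_space" for n
  proof -
    have "(\<lambda>\<nu>. (\<nu>, {#})) \<in> measurable (cfg_space :: 'b multiset measure)
        (cfg_space \<Otimes>\<^sub>M (cfg_space :: ('b \<times> real) multiset measure))"
      by measurable
    from measurable_compose[OF this measurable_mark_law_size[OF borel_measurable_indicator[OF A], of n]]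
    show ?thesis by (simp only: fst_conv snd_conv)
  qed
  \<comment> \<open>The vacuous condition is the family indexed by n, evaluated at the countably
    valued index n = size \<nu>.\<close>
  have "(\<lambda>\<nu>. if size \<nu> = size \<nu> then \<integral>\<^sup>+\<psi>. indicator A (\<psi> + {#}) \<partial>mark_law K \<nu> else 0) \<in> borel_measurable cfg_space"
    by (rule measurable_compose_countable[OF *]) measurable
  then show "(\<lambda>\<nu>. emeasure (mark_law K \<nu>) A) \<in> borel_measurable cfg_space" by simp
qed (simp_all add: prob_space_imp_subprob_space prob_space_mark_law)

lemma integrable_exp: "0 \<le> t \<Longrightarrow> integrable K (\<lambda>s. exp (- s * t))"
  using K_nonneg by (intro integrable_const_bound[where B=1]) auto

text \<open>Marks are nonnegative almost surely, so \<open>ennreal s\<close> truncates only on a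
  null set.\<close>

lemma lap_u_nn_integral:
  assumes "0 \<le> t"
  shows "(\<integral>\<^sup>+s. ennreal (exp_neg_ext (ennreal s * ennreal t)) \<partial>K) = ennreal (lap_u K t)"
proof -
  have "(\<integral>\<^sup>+s. ennreal (exp_neg_ext (ennreal s * ennreal t)) \<partial>K) = (\<integral>\<^sup>+s. ennreal (exp (- s * t)) \<partial>K)"
    using K_nonneg
    by (intro nn_integral_cong_AE, eventually_elim)
       (use assms in \<open>auto simp: exp_neg_ext_ennreal simp flip: ennreal_mult\<close>)
  also have "\<dots> = ennreal (\<integral>s. exp (- s * t) \<partial>K)"
    by (rule nn_integral_eq_integral[OF integrable_exp[OF assms]]) simp
  finally show ?thesis by (simp add: lap_u_def)
qed

lemma lap_u_bounds: assumes "0 \<le> t" shows "0 < lap_u K t" "lap_u K t \<le> 1"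
proof -
  note int = integrable_exp[OF assms]
  show "lap_u K t \<le> 1"
    unfolding lap_u_def using K_nonneg assms
    by (intro integral_le_const int) auto
  have "0 \<le> lap_u K t" unfolding lap_u_def by (rule integral_nonneg_AE) simp
  moreover have "lap_u K t \<noteq> 0"
    unfolding lap_u_def using integral_nonneg_eq_0_iff_AE[OF int] by (auto simp: AE_False)
  ultimately show "0 < lap_u K t" by simp
qed

text \<open>Given the configuration, the integrand is a product of functions of independent marks,
  each of which integrates to a Laplace transform of K. Finite configurations make this valid for
  functions without bounded support, such as g + u.\<close>

lemma
  fixes P :: "'b::{second_countable_topology, t1_space} multiset measure"
  assumes "prob_space P" and sets_P [measurable_cong]: "sets P = sets cfg_space"
  shows prob_space_rm_law: "prob_space (rm_law P K)"
    and laplace_rm_law: "\<lbrakk>g \<in> borel_measurable borel; \<And>x. 0 \<le> g x\<rbrakk> \<Longrightarrow>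
      ennreal (laplace (rm_law P K) g) = (\<integral>\<^sup>+\<nu>. (\<Prod>x\<in>#\<nu>. ennreal (lap_u K (g x))) \<partial>P)"
proof -
  interpret P: prob_space P by fact
  have kernel [measurable]: "mark_law K \<in> measurable P (subprob_algebra cfg_space)"
    using measurable_mark_law by (simp cong: measurable_cong_sets add: sets_P)
  have "space P \<noteq> {}" by (rule P.not_empty)
  then have sets_bind: "sets (P \<bind> mark_law K) = sets cfg_space" by simp
  interpret B: prob_space "P \<bind> mark_law K"
    by (rule P.prob_space_bind[OF _ kernel]) (simp add: prob_space_mark_law)
  have wmeas: "wmeas \<in> measurable (P \<bind> mark_law K) (meas_algebra borel)"
    using measurable_wmeas by (simp cong: measurable_cong_sets add: sets_bind)
  show prob: "prob_space (rm_law P K)"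
    unfolding rm_law_def by (rule B.prob_space_distr[OF wmeas])
  interpret R: prob_space "rm_law P K" by fact
  assume g [measurable]: "g \<in> borel_measurable borel" and g0: "\<And>x. 0 \<le> g x"
  let ?E = "\<lambda>m. exp_neg_ext (\<integral>\<^sup>+x. ennreal (g x) \<partial>m)"
  have E: "?E \<in> borel_measurable (meas_algebra borel)"
    by (intro measurable_compose[OF _ measurable_exp_neg_ext] measurable_nn_integral_meas_algebra) measurable
  have E': "?E \<in> borel_measurable (rm_law P K)"
    using E by (simp add: rm_law_def)
  define L where "L \<psi> = exp_neg_ext (\<Sum>z\<in>#\<psi>. ennreal (snd z) * ennreal (g (fst z)))"
    for \<psi> :: "('b \<times> real) multiset"
  have L [measurable]: "L \<in> borel_measurable cfg_space"
    unfolding L_def[abs_def]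
    by (intro measurable_compose[OF _ measurable_exp_neg_ext] measurable_sum_mset_const) measurable
  have marks: "(\<integral>\<^sup>+\<psi>. ennreal (L \<psi>) \<partial>mark_law K \<nu>) = (\<Prod>x\<in>#\<nu>. ennreal (lap_u K (g x)))" for \<nu>
  proof (induction \<nu>)
    case empty
    show ?case by (subst nn_integral_mark_law_empty, measurable) (simp add: L_def)
  next
    case (add x \<nu>)
    have mult: "ennreal (L (add_mset (x, s) \<psi>))
        = ennreal (exp_neg_ext (ennreal s * ennreal (g x))) * ennreal (L \<psi>)" for s \<psi>
      by (simp add: L_def exp_neg_ext_add ennreal_mult' exp_neg_ext_bounds)
    have LK: "(\<lambda>\<psi>. ennreal (L \<psi>)) \<in> borel_measurable (mark_law K \<nu>)"
      using L by (simp cong: measurable_cong_sets)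
    have "(\<integral>\<^sup>+\<psi>. ennreal (L \<psi>) \<partial>mark_law K (add_mset x \<nu>))
        = (\<integral>\<^sup>+s. \<integral>\<^sup>+\<psi>. ennreal (L (add_mset (x, s) \<psi>)) \<partial>mark_law K \<nu> \<partial>K)"
      by (rule nn_integral_mark_law_add_mset) measurable
    also have "\<dots> = (\<integral>\<^sup>+s. ennreal (exp_neg_ext (ennreal s * ennreal (g x))) *
        (\<integral>\<^sup>+\<psi>. ennreal (L \<psi>) \<partial>mark_law K \<nu>) \<partial>K)"
      unfolding mult by (intro nn_integral_cong nn_integral_cmult LK)
    also have "\<dots> = (\<integral>\<^sup>+s. ennreal (exp_neg_ext (ennreal s * ennreal (g x))) \<partial>K) *
        (\<integral>\<^sup>+\<psi>. ennreal (L \<psi>) \<partial>mark_law K \<nu>)"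
      by (rule nn_integral_multc) measurable
    finally show ?case by (simp add: add lap_u_nn_integral g0)
  qed
  have "ennreal (laplace (rm_law P K) g) = (\<integral>\<^sup>+m. ennreal (?E m) \<partial>rm_law P K)"
    unfolding laplace_def
    by (intro nn_integral_eq_integral[symmetric] R.integrable_const_bound[where B=1] AE_I2 E')
       (simp_all add: exp_neg_ext_bounds)
  also have "\<dots> = (\<integral>\<^sup>+\<psi>. ennreal (?E (wmeas \<psi>)) \<partial>(P \<bind> mark_law K))"
    unfolding rm_law_def by (rule nn_integral_distr[OF wmeas]) (use E in measurable)
  also have "\<dots> = (\<integral>\<^sup>+\<psi>. ennreal (L \<psi>) \<partial>(P \<bind> mark_law K))"
    by (simp add: nn_integral_wmeas L_def)
  also have "\<dots> = (\<integral>\<^sup>+\<nu>. \<integral>\<^sup>+\<psi>. ennreal (L \<psi>) \<partial>mark_law K \<nu> \<partial>P)"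
    by (rule nn_integral_bind[OF _ kernel]) measurable
  finally show "ennreal (laplace (rm_law P K) g) = (\<integral>\<^sup>+\<nu>. (\<Prod>x\<in>#\<nu>. ennreal (lap_u K (g x))) \<partial>P)"
    by (simp add: marks)
qed

end

section \<open>The posterior law\<close>

text \<open>The product is exp of minus the sum of the terms - ln (a x), which are nonnegative
  because a x lies in (0, 1]; this reduces it to a sum over points.\<close>

lemma measurable_prod_mset:
  fixes a :: "'b::topological_space \<Rightarrow> real"
  assumes [measurable]: "a \<in> borel_measurable borel" and a: "\<And>x. 0 < a x" "\<And>x. a x \<le> 1"
  shows "(\<lambda>\<nu>. \<Prod>x\<in>#\<nu>. ennreal (a x)) \<in> borel_measurable cfg_space"
proof -
  have "(\<Prod>x\<in>#\<nu>. ennreal (a x)) = ennreal (exp_neg_ext (\<Sum>x\<in>#\<nu>. ennreal (- ln (a x))))" for \<nu>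
  proof (induction \<nu>)
    case (add x \<nu>)
    have "exp_neg_ext (ennreal (- ln (a x))) = a x"
      using a[of x] by (simp add: exp_neg_ext_ennreal ln_le_zero_iff)
    with add show ?case
      using a[of x] by (simp add: exp_neg_ext_add ennreal_mult' exp_neg_ext_bounds)
  qed simp
  moreover have "(\<lambda>\<nu>. \<Sum>x\<in>#\<nu>. ennreal (- ln (a x))) \<in> borel_measurable cfg_space"
    by (rule measurable_sum_mset_const) measurable
  ultimately show ?thesis by simp
qed

text \<open>With c = \<open>lap_u K u\<close>, the exponential factor of the posterior density
  becomes one factor c for each point.\<close>

lemma exp_cfg_int_const: "0 < c \<Longrightarrow> exp (cfg_int (\<lambda>x. ln c) \<nu>) = c ^ size \<nu>"
  by (induction \<nu>) (simp_all add: cfg_int_def exp_add)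

context mark_distribution
begin

lemma measurable_lap_u [measurable]: "lap_u K \<in> borel_measurable borel"
  unfolding lap_u_def[abs_def] by measurable

lemma mark_distribution_tilt:
  assumes u: "0 \<le> u"
  shows "mark_distribution (tilt K u)"
proof -
  note lap = lap_u_bounds[OF u]
  have "emeasure (tilt K u) UNIV = (\<integral>\<^sup>+s. ennreal (exp (- s * u) / lap_u K u) \<partial>K)"
    unfolding tilt_def using sets.top[of K] by (subst emeasure_density) auto
  also have "\<dots> = ennreal (\<integral>s. exp (- s * u) / lap_u K u \<partial>K)"
    using integrable_exp[OF u] lap by (intro nn_integral_eq_integral) auto
  also have "(\<integral>s. exp (- s * u) / lap_u K u \<partial>K) = 1"
    using lap by (simp add: lap_u_def)
  finally have "prob_space (tilt K u)"
    by (intro prob_spaceI) (simp add: tilt_def)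
  moreover have "AE s in tilt K u. 0 \<le> s"
    unfolding tilt_def using K_nonneg by (subst AE_density) auto
  moreover have "sets (tilt K u) = sets borel" by (simp add: tilt_def sets_K)
  ultimately show ?thesis
    by (simp add: mark_distribution_def mark_distribution_axioms_def)
qed

lemma lap_u_tilt:
  assumes u: "0 \<le> u"
  shows "lap_u (tilt K u) t = lap_u K (t + u) / lap_u K u"
proof -
  note lap = lap_u_bounds[OF u]
  have "lap_u (tilt K u) t = (\<integral>s. exp (- s * t) \<partial>tilt K u)" by (rule lap_u_def)
  also have "\<dots> = (\<integral>s. exp (- s * u) / lap_u K u * exp (- s * t) \<partial>K)"
    unfolding tilt_def using lap by (subst integral_real_density) auto
  also have "\<dots> = (\<integral>s. exp (- s * (t + u)) / lap_u K u \<partial>K)"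
    by (intro Bochner_Integration.integral_cong) (auto simp: exp_add[symmetric] algebra_simps)
  also have "\<dots> = lap_u K (t + u) / lap_u K u" by (simp add: lap_u_def)
  finally show ?thesis .
qed

end

locale marked_gibbs_process = gibbs_process \<omega> PN f + mark_distribution K
  for \<omega> :: "'a::polish_space measure" and PN f K
begin

text \<open>Both Laplace functionals equal A g / A 0, where A g integrates the product of transforms
  against the unnormalised weight f (\<nu> + Y). The constant c cancels in the quotient, and A 0 is
  the normalising constant of the posterior density.\<close>

lemma eq_rm_law_post_density:
  assumes c: "0 < c" "(\<integral>\<^sup>+\<nu>. ennreal (f (\<nu> + Y)) \<partial>PN) = ennreal c"
    and u: "0 < u"
    and Q: "prob_space Q" "sets Q = sets (meas_algebra borel)"
    and laplace_Q: "\<And>g. g \<in> borel_measurable borel \<Longrightarrow> (\<And>z. 0 \<le> g z) \<Longrightarrow> bounded (range g) \<Longrightarrow>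
      bounded {z. g z \<noteq> 0} \<Longrightarrow>
      laplace Q g = laplace (rm_law (density PN (\<lambda>\<nu>. ennreal (f (\<nu> + Y) / c))) K) (\<lambda>z. g z + u) /
                    laplace (rm_law (density PN (\<lambda>\<nu>. ennreal (f (\<nu> + Y) / c))) K) (\<lambda>z. u)"
  shows "Q = rm_law (density PN (\<lambda>\<nu>. ennreal (post_density PN f K u Y \<nu>))) (tilt K u)"
proof -
  interpret tilt: mark_distribution "tilt K u"
    using u by (intro mark_distribution_tilt) simp
  define \<phi> where "\<phi> = lap_u K u"
  have \<phi>: "0 < \<phi>" "\<phi> \<le> 1" using lap_u_bounds[of u] u by (simp_all add: \<phi>_def)
  define R where "R = density PN (\<lambda>\<nu>. ennreal (f (\<nu> + Y) / c))"
  define T where "T g \<nu> = (\<Prod>x\<in>#\<nu>. ennreal (lap_u K (g x + u)))" for g :: "'a \<Rightarrow> real" and \<nu>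
  define A where "A g = (\<integral>\<^sup>+\<nu>. ennreal (f (\<nu> + Y)) * T g \<nu> \<partial>PN)" for g
  have T_measurable: "T g \<in> borel_measurable cfg_space"
    if [measurable]: "g \<in> borel_measurable borel" and "\<And>x. 0 \<le> g x" for g
    unfolding T_def[abs_def] using lap_u_bounds that(2) u
    by (intro measurable_prod_mset) (auto simp: add_nonneg_nonneg less_imp_le)
  have scale: "ennreal (f (\<nu> + Y) / d) = ennreal (1 / d) * ennreal (f (\<nu> + Y))" if "0 < d" for d \<nu>
    using that f_nonneg by (simp add: ennreal_mult'[symmetric])
  have inv: "ennreal (1 / d) * ennreal d = 1" if "0 < d" for d
    using that by (simp add: ennreal_mult'[symmetric])
  have sets_R: "sets R = sets cfg_space" by (simp add: R_def sets_PN)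
  have "prob_space R"
  proof (rule prob_spaceI)
    have "emeasure R (space R) = (\<integral>\<^sup>+\<nu>. ennreal (1 / c) * ennreal (f (\<nu> + Y)) \<partial>PN)"
      unfolding R_def using sets.top[of PN] by (subst emeasure_density) (auto simp: scale c)
    also have "\<dots> = ennreal (1 / c) * ennreal c"
      by (subst nn_integral_cmult) (auto simp: c)
    finally show "emeasure R (space R) = 1" using inv[OF c(1)] by simp
  qed
  have laplace_R: "ennreal (laplace (rm_law R K) (\<lambda>z. g z + u)) = ennreal (1 / c) * A g"
    if g [measurable]: "g \<in> borel_measurable borel" and g0: "\<And>x. 0 \<le> g x" for g
  proof -
    note T_measurable[OF that, measurable]
    have "ennreal (laplace (rm_law R K) (\<lambda>z. g z + u)) = (\<integral>\<^sup>+\<nu>. T g \<nu> \<partial>R)"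
      unfolding T_def using u g0
      by (intro laplace_rm_law \<open>prob_space R\<close> sets_R) (auto intro: add_nonneg_nonneg less_imp_le)
    also have "\<dots> = (\<integral>\<^sup>+\<nu>. ennreal (f (\<nu> + Y) / c) * T g \<nu> \<partial>PN)"
      unfolding R_def by (rule nn_integral_density) measurable
    also have "\<dots> = ennreal (1 / c) * A g"
      unfolding A_def scale[OF c(1)] mult.assoc by (rule nn_integral_cmult) measurable
    finally show ?thesis .
  qed
  have T0: "T (\<lambda>_. 0) \<nu> = ennreal (\<phi> ^ size \<nu>)" for \<nu>
    using \<phi> by (induction \<nu>) (simp_all add: T_def \<phi>_def[symmetric] ennreal_mult')
  define C where "C = (\<integral>N. exp (cfg_int (\<lambda>x. ln \<phi>) N) * f (N + Y) \<partial>PN)"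
  have A0: "A (\<lambda>_. 0) = (\<integral>\<^sup>+\<nu>. ennreal (\<phi> ^ size \<nu> * f (\<nu> + Y)) \<partial>PN)"
    unfolding A_def T0 using \<phi> f_nonneg
    by (intro nn_integral_cong) (simp add: ennreal_mult' mult.commute)
  \<comment> \<open>Each factor \<phi> is at most 1, so c bounds the normalising constant.\<close>
  have "A (\<lambda>_. 0) \<le> (\<integral>\<^sup>+\<nu>. ennreal (f (\<nu> + Y)) \<partial>PN)"
    unfolding A0 using \<phi> f_nonneg
    by (intro nn_integral_mono ennreal_leI) (simp add: mult_left_le_one_le power_le_one)
  then have A0_fin: "A (\<lambda>_. 0) < \<infinity>" using c by (metis ennreal_less_top infinity_ennreal_def le_less_trans)
  have "C = enn2real (A (\<lambda>_. 0))"
    unfolding C_def exp_cfg_int_const[OF \<phi>(1)] A0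
    using \<phi> f_nonneg by (intro integral_eq_nn_integral) auto
  then have AC: "A (\<lambda>_. 0) = ennreal C" using A0_fin by simp
  \<comment> \<open>The factors \<phi> ^ size \<nu> are positive, so a vanishing integral would
    force f (\<nu> + Y) = 0 almost surely, against c > 0.\<close>
  have "C \<noteq> 0"
  proof
    assume "C = 0"
    then have "(\<integral>\<^sup>+\<nu>. ennreal (\<phi> ^ size \<nu> * f (\<nu> + Y)) \<partial>PN) = 0"
      using AC unfolding A0 by simp
    then have "AE \<nu> in PN. ennreal (\<phi> ^ size \<nu> * f (\<nu> + Y)) = 0"
      by (subst (asm) nn_integral_0_iff_AE) auto
    then have "AE \<nu> in PN. ennreal (f (\<nu> + Y)) = 0"
      by eventually_elim (use \<phi> f_nonneg in \<open>auto simp: ennreal_eq_0_iff mult_le_0_iff zero_less_power power_le_zero_eq\<close>)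
    then have "(\<integral>\<^sup>+\<nu>. ennreal (f (\<nu> + Y)) \<partial>PN) = 0"
      by (subst nn_integral_0_iff_AE) auto
    with c show False by simp
  qed
  moreover have "0 \<le> C" unfolding C_def using f_nonneg by (intro integral_nonneg_AE) auto
  ultimately have C: "0 < C" by simp
  define S where "S = density PN (\<lambda>\<nu>. ennreal (post_density PN f K u Y \<nu>))"
  have post: "post_density PN f K u Y \<nu> = \<phi> ^ size \<nu> * f (\<nu> + Y) / C" for \<nu>
    unfolding post_density_def C_def \<phi>_def[symmetric] exp_cfg_int_const[OF \<phi>(1)] ..
  have S: "S = density PN (\<lambda>\<nu>. ennreal (\<phi> ^ size \<nu> * f (\<nu> + Y) / C))"
    unfolding S_def post ..
  have sets_S: "sets S = sets cfg_space" by (simp add: S sets_PN)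
  have post': "ennreal (\<phi> ^ size \<nu> * f (\<nu> + Y) / C)
      = ennreal (1 / C) * (ennreal (f (\<nu> + Y)) * ennreal (\<phi> ^ size \<nu>))" for \<nu>
    using C \<phi> f_nonneg by (simp add: ennreal_mult'[symmetric] mult.commute)
  have "prob_space S"
  proof (rule prob_spaceI)
    have "emeasure S (space S) = (\<integral>\<^sup>+\<nu>. ennreal (1 / C) * (ennreal (f (\<nu> + Y)) * T (\<lambda>_. 0) \<nu>) \<partial>PN)"
      unfolding S T0 post'[symmetric] using sets.top[of PN] by (subst emeasure_density) auto
    also have "\<dots> = ennreal (1 / C) * A (\<lambda>_. 0)"
      unfolding A_def T0 by (rule nn_integral_cmult) measurable
    finally show "emeasure S (space S) = 1" using inv[OF C] by (simp add: AC)
  qed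
  have laplace_S: "ennreal (laplace (rm_law S (tilt K u)) g) = ennreal (1 / C) * A g"
    if g [measurable]: "g \<in> borel_measurable borel" and g0: "\<And>x. 0 \<le> g x" for g
  proof -
    note T_measurable[OF that, measurable]
    \<comment> \<open>By \<open>lap_u_tilt\<close> each point contributes a quotient with
      denominator \<phi>. Collected over all points, these denominators cancel the factor \<phi> ^
      size \<nu> of the posterior density.\<close>
    have tilted: "(\<Prod>x\<in>#\<nu>. ennreal (lap_u (tilt K u) (g x))) = ennreal ((1 / \<phi>) ^ size \<nu>) * T g \<nu>" for \<nu>
    proof (induction \<nu>)
      case (add x \<nu>)
      have "ennreal (lap_u (tilt K u) (g x)) = ennreal (1 / \<phi>) * ennreal (lap_u K (g x + u))"
        using u \<phi> by (simp add: lap_u_tilt \<phi>_def[symmetric] ennreal_mult'[symmetric])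
      moreover have "ennreal ((1 / \<phi>) ^ size (add_mset x \<nu>)) = ennreal (1 / \<phi>) * ennreal ((1 / \<phi>) ^ size \<nu>)"
        using \<phi> by (simp add: ennreal_mult'[symmetric])
      ultimately show ?case using add by (simp del: size_add_mset add: T_def ac_simps)
    qed (simp add: T_def)
    have "ennreal (laplace (rm_law S (tilt K u)) g)
        = (\<integral>\<^sup>+\<nu>. ennreal ((1 / \<phi>) ^ size \<nu>) * T g \<nu> \<partial>S)"
      unfolding tilted[symmetric]
      by (intro tilt.laplace_rm_law \<open>prob_space S\<close> sets_S g g0)
    also have "\<dots> = (\<integral>\<^sup>+\<nu>. ennreal (\<phi> ^ size \<nu> * f (\<nu> + Y) / C) * (ennreal ((1 / \<phi>) ^ size \<nu>) * T g \<nu>) \<partial>PN)"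
      unfolding S by (rule nn_integral_density) measurable
    also have "\<dots> = (\<integral>\<^sup>+\<nu>. ennreal (1 / C) * (ennreal (f (\<nu> + Y)) * T g \<nu>) \<partial>PN)"
    proof (rule nn_integral_cong)
      fix \<nu> :: "'a multiset"
      have cancel: "ennreal (\<phi> ^ size \<nu>) * ennreal ((1 / \<phi>) ^ size \<nu>) = 1"
        using \<phi> by (simp add: ennreal_mult'[symmetric] power_mult_distrib[symmetric])
      have "ennreal (\<phi> ^ size \<nu> * f (\<nu> + Y) / C) * (ennreal ((1 / \<phi>) ^ size \<nu>) * T g \<nu>)
          = ennreal (1 / C) * (ennreal (f (\<nu> + Y)) * ((ennreal (\<phi> ^ size \<nu>) * ennreal ((1 / \<phi>) ^ size \<nu>)) * T g \<nu>))"
        unfolding post' by (simp only: mult.assoc)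
      then show "ennreal (\<phi> ^ size \<nu> * f (\<nu> + Y) / C) * (ennreal ((1 / \<phi>) ^ size \<nu>) * T g \<nu>)
          = ennreal (1 / C) * (ennreal (f (\<nu> + Y)) * T g \<nu>)"
        by (simp only: cancel mult_1)
    qed
    also have "\<dots> = ennreal (1 / C) * A g"
      unfolding A_def by (rule nn_integral_cmult) measurable
    finally show ?thesis .
  qed
  \<comment> \<open>The identities so far live in \<open>ennreal\<close>, while
    \<open>laplace\<close> is real; nonnegativity permits the transfer without loss.\<close>
  have nonneg: "0 \<le> laplace M g" for M :: "'a measure measure" and g
    unfolding laplace_def by (rule integral_nonneg_AE) (simp add: exp_neg_ext_bounds)
  have real: "laplace M g = d * enn2real a"
    if "ennreal (laplace M g) = ennreal d * a" "0 \<le> d" for M :: "'a measure measure" and g d a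
    using arg_cong[OF that(1), of enn2real] nonneg[of M g] that(2) by (simp add: enn2real_mult)
  have "Q = rm_law S (tilt K u)"
  proof (rule laplace_unique[OF Q])
    show "prob_space (rm_law S (tilt K u))"
      by (rule tilt.prob_space_rm_law[OF \<open>prob_space S\<close> sets_S])
    show "sets (rm_law S (tilt K u)) = sets (meas_algebra borel)" by (simp add: rm_law_def)
    fix g :: "'a \<Rightarrow> real"
    assume g: "g \<in> borel_measurable borel" "\<And>z. 0 \<le> g z" "bounded (range g)" "bounded {z. g z \<noteq> 0}"
    have "laplace Q g = laplace (rm_law R K) (\<lambda>z. g z + u) / laplace (rm_law R K) (\<lambda>z. u)"
      unfolding R_def by (rule laplace_Q[OF g])
    also have "laplace (rm_law R K) (\<lambda>z. g z + u) = 1 / c * enn2real (A g)"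
      using c by (intro real laplace_R g) simp
    also have "laplace (rm_law R K) (\<lambda>z. u) = 1 / c * enn2real (A (\<lambda>_. 0))"
      using laplace_R[of "\<lambda>_. 0"] c by (intro real) simp_all
    also have "enn2real (A (\<lambda>_. 0)) = C" using C by (simp add: AC)
    also have "1 / c * enn2real (A g) / (1 / c * C) = 1 / C * enn2real (A g)"
      using c by simp
    also have "\<dots> = laplace (rm_law S (tilt K u)) g"
      using C by (intro real[symmetric] laplace_S g) simp
    finally show "laplace Q g = laplace (rm_law S (tilt K u)) g" .
  qed
  then show ?thesis unfolding S_def .
qed

end

text \<open>Palm laws are determined only up to null sets of the moment measure, hence the claim for
  almost every tuple. The exceptional set comes from identifying the reduced Palm law alone, so it
  serves all u and Q simultaneously.\<close>

theorem theorem8: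
  fixes \<omega> :: "'a::polish_space measure"
    and PN :: "'a multiset measure"
    and f\<Phi> :: "'a multiset \<Rightarrow> real"
    and h :: "real \<Rightarrow> real"
    and k :: nat
    and Palm :: "(nat \<Rightarrow> 'a) \<Rightarrow> 'a multiset measure"
  assumes "finite_measure \<omega>" and "sets \<omega> = sets borel"
    and "poisson_pp \<omega> PN"
    and "f\<Phi> \<in> borel_measurable cfg_space" and "\<forall>\<nu>. f\<Phi> \<nu> \<ge> 0"
    and "prob_space (density PN (\<lambda>\<nu>. ennreal (f\<Phi> \<nu>)))"
    and "h \<in> borel_measurable borel"
    and "prob_space (density lborel (\<lambda>s. ennreal (h s)))"
    and "emeasure (density lborel (\<lambda>s. ennreal (h s))) {..<0} = 0"
    and "sigma_finite_measure (moment_measure k (density PN (\<lambda>\<nu>. ennreal (f\<Phi> \<nu>))))"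
    and "is_palm_kernel k (density PN (\<lambda>\<nu>. ennreal (f\<Phi> \<nu>))) Palm"
  shows "AE y in moment_measure k (density PN (\<lambda>\<nu>. ennreal (f\<Phi> \<nu>))).
           distinct (map y [0..<k]) \<longrightarrow>
           (\<forall>u>0. \<forall>Q. prob_space Q \<and> sets Q = sets (meas_algebra borel) \<and>
              (\<forall>f. f \<in> borel_measurable borel \<and> (\<forall>z. f z \<ge> 0) \<and> bounded (range f) \<and>
                   bounded {z. f z \<noteq> 0} \<longrightarrow>
                 laplace Q f =
                   laplace (rm_law (distr (Palm y) cfg_space (\<lambda>\<nu>. \<nu> - tup_mset k y))
                              (density lborel (\<lambda>s. ennreal (h s)))) (\<lambda>z. f z + u) /
                   laplace (rm_law (distr (Palm y) cfg_space (\<lambda>\<nu>. \<nu> - tup_mset k y))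
                              (density lborel (\<lambda>s. ennreal (h s)))) (\<lambda>z. u))
              \<longrightarrow> Q = rm_law
                     (density PN (\<lambda>\<nu>. ennreal (post_density PN f\<Phi>
                        (density lborel (\<lambda>s. ennreal (h s))) u (tup_mset k y) \<nu>)))
                     (tilt (density lborel (\<lambda>s. ennreal (h s))) u))"
proof -
  let ?H = "density lborel (\<lambda>s. ennreal (h s))"
  have "AE s in ?H. 0 \<le> s"
    using assms(9) by (intro AE_I'[of "{..<0}"]) (auto simp: null_sets_def not_le)
  then interpret marked_gibbs_process \<omega> PN f\<Phi> ?H
    using assms
    by (simp add: marked_gibbs_process_def gibbs_process_def gibbs_process_axioms_def
        poisson_process_def mark_distribution_def mark_distribution_axioms_def)
  from AE_reduced_palm[OF assms(10,11)] show ?thesis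
  proof (rule AE_mp, intro AE_I2 impI allI)
    fix y u Q
    assume palm: "distinct (map y [0..<k]) \<longrightarrow>
      (\<exists>c>0. (\<integral>\<^sup>+\<nu>. ennreal (f\<Phi> (\<nu> + tup_mset k y)) \<partial>PN) = ennreal c \<and>
       distr (Palm y) cfg_space (\<lambda>\<nu>. \<nu> - tup_mset k y)
         = density PN (\<lambda>\<nu>. ennreal (f\<Phi> (\<nu> + tup_mset k y) / c)))"
      and "distinct (map y [0..<k])" and u: "0 < u"
      and Q: "prob_space Q \<and> sets Q = sets (meas_algebra borel) \<and>
        (\<forall>f. f \<in> borel_measurable borel \<and> (\<forall>z. f z \<ge> 0) \<and> bounded (range f) \<and>
             bounded {z. f z \<noteq> 0} \<longrightarrow>
           laplace Q f =
             laplace (rm_law (distr (Palm y) cfg_space (\<lambda>\<nu>. \<nu> - tup_mset k y)) ?H) (\<lambda>z. f z + u) /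
             laplace (rm_law (distr (Palm y) cfg_space (\<lambda>\<nu>. \<nu> - tup_mset k y)) ?H) (\<lambda>z. u))"
    then obtain c where c: "0 < c" "(\<integral>\<^sup>+\<nu>. ennreal (f\<Phi> (\<nu> + tup_mset k y)) \<partial>PN) = ennreal c"
      and reduced: "distr (Palm y) cfg_space (\<lambda>\<nu>. \<nu> - tup_mset k y)
         = density PN (\<lambda>\<nu>. ennreal (f\<Phi> (\<nu> + tup_mset k y) / c))"
      by blast
    show "Q = rm_law (density PN (\<lambda>\<nu>. ennreal (post_density PN f\<Phi> ?H u (tup_mset k y) \<nu>))) (tilt ?H u)"
      by (rule eq_rm_law_post_density[OF c u]) (use Q reduced in simp_all)
  qed
qed

end
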